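(* (1) For every non-trivial $L_\infty$-centralizer $\Omega$ on $L_2$ there is a complex structure $u$ on $L_2$ that cannot be extended to an operator on $d_\Omega L_2$; that is, there is no bounded linear operator $\beta: d_\Omega L_2\to d_\Omega L_2$ with $\beta(x,0)=(u(x),0)$ for all $x\in L_2$. (2) For every non-trivial $\ell_\infty$-centralizer $\Omega$ on $\ell_2$ there is a complex structure $u$ on $\ell_2$ that cannot be extended to an operator on $d_\Omega \ell_2$; that is, there is no bounded linear operator $\beta: d_\Omega \ell_2\to d_\Omega \ell_2$ with $\beta(x,0)=(u(x),0)$ for all $x\in \ell_2$.
   Context: All spaces are real. $L_0$, $L_2$, $L_\infty$ denote the spaces of measurable, square-integrable, and essentially bounded functions on a fixed $\sigma$-finite measure space; in the sequence case $L_0$ is replaced by the space $\mathbb R^{\mathbb N}$ of all scalar sequences, $L_2$ by $\ell_2$ and $L_\infty$ by $\ell_\infty$. A complex structure on a real Banach space $X$ is a bounded linear operator $u:X\to X$ with $u^2=-\mathrm{id}_X$. Let $X=L_2$ (resp. $\ell_2$). An $L_\infty$-centralizer (resp. $\ell_\infty$-centralizer) on $X$ is a map $\Omega:X\to L_0$ which is homogeneous ($\Omega(\lambda x)=\lambda\Omega(x)$), quasi-linear (there is a constant $C$ such that for all $x,y\in X$ the difference $\Omega(x+y)-\Omega(x)-\Omega(y)$ belongs to $X$ and $\|\Omega(x+y)-\Omega(x)-\Omega(y)\|_X\le C(\|x\|_X+\|y\|_X)$), and such that there is a constant $C$ with $\Omega(fx)-f\Omega(x)\in X$ and $\|\Omega(fx)-f\Omega(x)\|_X\le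 C\|f\|_\infty\|x\|_X$ for all $f\in L_\infty$ (resp. $\ell_\infty$) and $x\in X$. The centralizer $\Omega$ is trivial if there is a linear map $L:X\to L_0$ such that $\Omega-L$ takes values in $X$ and is bounded: $\|\Omega x-Lx\|_X\le C\|x\|_X$ for all $x \in X$; otherwise it is non-trivial. The induced twisted sum is $d_\Omega X=\{(w,x): w\in L_0,\ x\in X,\ w-\Omega x\in X\}$ with quasi-norm $\|(w,x)\|_{d_\Omega X}=\|x\|_X+\|w-\Omega x\|_X$ (equivalent to a norm here); it contains $X$ via $x\mapsto(x,0)$. *)

theory Defs
  imports "HOL-Probability.Essential_Supremum"
begin

text \<open>
  Elements of L_0, L_2, L_infinity are represented by measurable functions, and equality of
  elements is equality almost everywhere. A map between such spaces is accordingly a map of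
  representatives that sends almost everywhere equal functions to almost everywhere equal
  functions, and every identity required of it is an identity almost everywhere.
\<close>

definition ae_eq :: "'a measure \<Rightarrow> ('a \<Rightarrow> real) \<Rightarrow> ('a \<Rightarrow> real) \<Rightarrow> bool" where
  "ae_eq M f g \<longleftrightarrow> (AE t in M. f t = g t)"

abbreviation L0 :: "'a measure \<Rightarrow> ('a \<Rightarrow> real) set" where
  "L0 M \<equiv> borel_measurable M"

definition L2 :: "'a measure \<Rightarrow> ('a \<Rightarrow> real) set" where
  "L2 M = {f \<in> L0 M. integrable M (\<lambda>t. (f t)\<^sup>2)}"

definition norm_L2 :: "'a measure \<Rightarrow> ('a \<Rightarrow> real) \<Rightarrow> real" where
  "norm_L2 M f = sqrt (\<integral>t. (f t)\<^sup>2 \<partial>M)"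

definition Linf :: "'a measure \<Rightarrow> ('a \<Rightarrow> real) set" where
  "Linf M = {f \<in> L0 M. esssup M (\<lambda>t. ereal \<bar>f t\<bar>) < \<infinity>}"

definition norm_Linf :: "'a measure \<Rightarrow> ('a \<Rightarrow> real) \<Rightarrow> real" where
  "norm_Linf M f = real_of_ereal (esssup M (\<lambda>t. ereal \<bar>f t\<bar>))"

definition L2_to :: "'a measure \<Rightarrow> ('a \<Rightarrow> real) set \<Rightarrow> (('a \<Rightarrow> real) \<Rightarrow> ('a \<Rightarrow> real)) \<Rightarrow> bool" where
  "L2_to M Y T \<longleftrightarrow>
     (\<forall>x \<in> L2 M. T x \<in> Y) \<and>
     (\<forall>x \<in> L2 M. \<forall>y \<in> L2 M. ae_eq M x y \<longrightarrow> ae_eq M (T x) (T y))"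

definition L2_homogeneous :: "'a measure \<Rightarrow> (('a \<Rightarrow> real) \<Rightarrow> ('a \<Rightarrow> real)) \<Rightarrow> bool" where
  "L2_homogeneous M T \<longleftrightarrow>
     (\<forall>c::real. \<forall>x \<in> L2 M. ae_eq M (T (\<lambda>t. c * x t)) (\<lambda>t. c * T x t))"

definition L2_linear :: "'a measure \<Rightarrow> (('a \<Rightarrow> real) \<Rightarrow> ('a \<Rightarrow> real)) \<Rightarrow> bool" where
  "L2_linear M T \<longleftrightarrow>
     (\<forall>x \<in> L2 M. \<forall>y \<in> L2 M. ae_eq M (T (\<lambda>t. x t + y t)) (\<lambda>t. T x t + T y t)) \<and>
     L2_homogeneous M T"

definition complex_structure :: "'a measure \<Rightarrow> (('a \<Rightarrow> real) \<Rightarrow> ('a \<Rightarrow> real)) \<Rightarrow> bool" where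
  "complex_structure M u \<longleftrightarrow>
     L2_to M (L2 M) u \<and> L2_linear M u \<and>
     (\<exists>C. \<forall>x \<in> L2 M. norm_L2 M (u x) \<le> C * norm_L2 M x) \<and>
     (\<forall>x \<in> L2 M. ae_eq M (u (u x)) (\<lambda>t. - x t))"

definition quasi_linear :: "'a measure \<Rightarrow> (('a \<Rightarrow> real) \<Rightarrow> ('a \<Rightarrow> real)) \<Rightarrow> bool" where
  "quasi_linear M \<Omega> \<longleftrightarrow>
     (\<exists>C. \<forall>x \<in> L2 M. \<forall>y \<in> L2 M.
        (\<lambda>t. \<Omega> (\<lambda>s. x s + y s) t - \<Omega> x t - \<Omega> y t) \<in> L2 M \<and>
        norm_L2 M (\<lambda>t. \<Omega> (\<lambda>s. x s + y s) t - \<Omega> x t - \<Omega> y t)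
          \<le> C * (norm_L2 M x + norm_L2 M y))"

definition centralizer :: "'a measure \<Rightarrow> (('a \<Rightarrow> real) \<Rightarrow> ('a \<Rightarrow> real)) \<Rightarrow> bool" where
  "centralizer M \<Omega> \<longleftrightarrow>
     L2_to M (L0 M) \<Omega> \<and> L2_homogeneous M \<Omega> \<and> quasi_linear M \<Omega> \<and>
     (\<exists>C. \<forall>f \<in> Linf M. \<forall>x \<in> L2 M.
        (\<lambda>t. \<Omega> (\<lambda>s. f s * x s) t - f t * \<Omega> x t) \<in> L2 M \<and>
        norm_L2 M (\<lambda>t. \<Omega> (\<lambda>s. f s * x s) t - f t * \<Omega> x t)
          \<le> C * norm_Linf M f * norm_L2 M x)"

definition trivial_centralizer :: "'a measure \<Rightarrow> (('a \<Rightarrow> real) \<Rightarrow> ('a \<Rightarrow> real)) \<Rightarrow> bool" where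
  "trivial_centralizer M \<Omega> \<longleftrightarrow>
     (\<exists>L. L2_to M (L0 M) L \<and> L2_linear M L \<and>
        (\<exists>C. \<forall>x \<in> L2 M.
           (\<lambda>t. \<Omega> x t - L x t) \<in> L2 M \<and>
           norm_L2 M (\<lambda>t. \<Omega> x t - L x t) \<le> C * norm_L2 M x))"

definition twisted_sum ::
  "'a measure \<Rightarrow> (('a \<Rightarrow> real) \<Rightarrow> ('a \<Rightarrow> real)) \<Rightarrow> (('a \<Rightarrow> real) \<times> ('a \<Rightarrow> real)) set" where
  "twisted_sum M \<Omega> =
     {(w, x). w \<in> L0 M \<and> x \<in> L2 M \<and> (\<lambda>t. w t - \<Omega> x t) \<in> L2 M}"

definition twisted_norm ::
  "'a measure \<Rightarrow> (('a \<Rightarrow> real) \<Rightarrow> ('a \<Rightarrow> real)) \<Rightarrow> ('a \<Rightarrow> real) \<times> ('a \<Rightarrow> real) \<Rightarrow> real" where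
  "twisted_norm M \<Omega> p = norm_L2 M (snd p) + norm_L2 M (\<lambda>t. fst p t - \<Omega> (snd p) t)"

definition pair_eq ::
  "'a measure \<Rightarrow> ('a \<Rightarrow> real) \<times> ('a \<Rightarrow> real) \<Rightarrow> ('a \<Rightarrow> real) \<times> ('a \<Rightarrow> real) \<Rightarrow> bool" where
  "pair_eq M p q \<longleftrightarrow> ae_eq M (fst p) (fst q) \<and> ae_eq M (snd p) (snd q)"

definition pair_add ::
  "('a \<Rightarrow> real) \<times> ('a \<Rightarrow> real) \<Rightarrow> ('a \<Rightarrow> real) \<times> ('a \<Rightarrow> real) \<Rightarrow> ('a \<Rightarrow> real) \<times> ('a \<Rightarrow> real)" where
  "pair_add p q = (\<lambda>t. fst p t + fst q t, \<lambda>t. snd p t + snd q t)"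

definition pair_scale ::
  "real \<Rightarrow> ('a \<Rightarrow> real) \<times> ('a \<Rightarrow> real) \<Rightarrow> ('a \<Rightarrow> real) \<times> ('a \<Rightarrow> real)" where
  "pair_scale c p = (\<lambda>t. c * fst p t, \<lambda>t. c * snd p t)"

definition twisted_operator ::
  "'a measure \<Rightarrow> (('a \<Rightarrow> real) \<Rightarrow> ('a \<Rightarrow> real)) \<Rightarrow>
   (('a \<Rightarrow> real) \<times> ('a \<Rightarrow> real) \<Rightarrow> ('a \<Rightarrow> real) \<times> ('a \<Rightarrow> real)) \<Rightarrow> bool" where
  "twisted_operator M \<Omega> \<beta> \<longleftrightarrow>
     (\<forall>p \<in> twisted_sum M \<Omega>. \<beta> p \<in> twisted_sum M \<Omega>) \<and>
     (\<forall>p \<in> twisted_sum M \<Omega>. \<forall>q \<in> twisted_sum M \<Omega>. pair_eq M p q \<longrightarrow> pair_eq M (\<beta> p) (\<beta> q)) \<and>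
     (\<forall>p \<in> twisted_sum M \<Omega>. \<forall>q \<in> twisted_sum M \<Omega>.
        pair_eq M (\<beta> (pair_add p q)) (pair_add (\<beta> p) (\<beta> q))) \<and>
     (\<forall>c. \<forall>p \<in> twisted_sum M \<Omega>. pair_eq M (\<beta> (pair_scale c p)) (pair_scale c (\<beta> p))) \<and>
     (\<exists>C. \<forall>p \<in> twisted_sum M \<Omega>. twisted_norm M \<Omega> (\<beta> p) \<le> C * twisted_norm M \<Omega> p)"

definition extends_to_twisted_sum ::
  "'a measure \<Rightarrow> (('a \<Rightarrow> real) \<Rightarrow> ('a \<Rightarrow> real)) \<Rightarrow> (('a \<Rightarrow> real) \<Rightarrow> ('a \<Rightarrow> real)) \<Rightarrow> bool" where
  "extends_to_twisted_sum M \<Omega> u \<longleftrightarrow>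
     (\<exists>\<beta>. twisted_operator M \<Omega> \<beta> \<and>
        (\<forall>x \<in> L2 M. pair_eq M (\<beta> (x, \<lambda>t. 0)) (u x, \<lambda>t. 0)))"

text \<open>
  The sequence case is the case of counting measure on the natural numbers. The following
  lemmas identify the resulting notions with all scalar sequences, square-summable sequences,
  and bounded sequences, with equality almost everywhere being equality.
\<close>

abbreviation counting :: "nat measure" where
  "counting \<equiv> count_space UNIV"

lemma ae_eq_counting: "ae_eq counting x y \<longleftrightarrow> x = y"
  by (auto simp: ae_eq_def AE_count_space)

lemma L0_counting: "L0 counting = UNIV"
  by auto

lemma L2_counting: "L2 counting = {x. summable (\<lambda>n. (x n)\<^sup>2)}"
  by (auto simp: L2_def integrable_count_space_nat_iff)

lemma norm_L2_counting:
  "x \<in> L2 counting \<Longrightarrow> norm_L2 counting x = sqrt (\<Sum>n. (x n)\<^sup>2)"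
  by (simp add: L2_def norm_L2_def integral_count_space_nat)

lemma esssup_counting: "esssup counting f = (SUP n. f n :: ereal)"
proof (rule antisym)
  show "esssup counting f \<le> (SUP n. f n)"
    by (rule esssup_I) (auto simp: AE_count_space intro: SUP_upper)
  show "(SUP n. f n) \<le> esssup counting f"
    using esssup_AE[of f counting] by (auto simp: AE_count_space intro: SUP_least)
qed

lemma Linf_counting: "Linf counting = {x. bounded (range x)}"
proof -
  have "(SUP n. ereal \<bar>x n\<bar>) < \<infinity> \<longleftrightarrow> bounded (range x)" for x :: "nat \<Rightarrow> real"
  proof
    assume *: "(SUP n. ereal \<bar>x n\<bar>) < \<infinity>"
    have 0: "0 \<le> (SUP n. ereal \<bar>x n\<bar>)"
      by (rule SUP_upper2[of 0]) auto
    obtain c where c: "(SUP n. ereal \<bar>x n\<bar>) = ereal c"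
      using * 0 by (cases "SUP n. ereal \<bar>x n\<bar>") auto
    have "\<bar>x n\<bar> \<le> c" for n
      using SUP_upper[of n UNIV "\<lambda>n. ereal \<bar>x n\<bar>"] c by simp
    then show "bounded (range x)"
      by (auto simp: bounded_iff)
  next
    assume "bounded (range x)"
    then obtain c where "\<And>n. \<bar>x n\<bar> \<le> c"
      by (auto simp: bounded_iff)
    then have "(SUP n. ereal \<bar>x n\<bar>) \<le> ereal c"
      by (intro SUP_least) auto
    then show "(SUP n. ereal \<bar>x n\<bar>) < \<infinity>"
      by (rule le_less_trans) simp
  qed
  then show ?thesis
    by (auto simp: Linf_def esssup_counting)
qed

lemma norm_Linf_counting:
  assumes "x \<in> Linf counting"
  shows "norm_Linf counting x = (SUP n. \<bar>x n\<bar>)"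
proof -
  have 0: "0 \<le> (SUP n. ereal \<bar>x n\<bar>)"
    by (rule SUP_upper2[of 0]) auto
  have "(SUP n. ereal \<bar>x n\<bar>) < \<infinity>"
    using assms by (simp add: Linf_def esssup_counting)
  then have "ereal (SUP n. \<bar>x n\<bar>) = (SUP n. ereal \<bar>x n\<bar>)"
    using 0 by (intro ereal_SUP) auto
  then show ?thesis
    by (metis norm_Linf_def esssup_counting real_of_ereal.simps(1))
qed

end

theory Submission
  imports Defs
begin

text \<open>
  If \<open>\<Omega>\<close> is not trivial, a gliding hump yields disjoint finite families \<open>F\<^sub>n\<close> of cells on which
  \<open>\<Omega>\<close> deviates from multiplication by a function by more than \<open>n\<close>. On the span of the unit vectors
  \<open>e\<^sub>A = 1\<^sub>A / \<parallel>1\<^sub>A\<parallel>\<close>, \<open>A \<in> F\<^sub>n\<close>, let \<open>u\<close> act as a skew orthogonal matrix with flat entries (built from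
  Hartley matrices), and extend it to a complex structure by pairing the rest of an orthonormal basis.

  An extension \<open>\<beta>\<close> of \<open>u\<close> induces a bounded \<open>v\<close> with \<open>u \<Omega> - \<Omega> v\<close> linear up to a bounded map. Since
  \<open>\<integral>z \<Omega>(x) - x \<Omega>(z)\<close> is a bounded form, this relation can be transposed: the nonlinearity of
  \<open>\<Omega>\<close> on random combinations \<open>\<Sum>\<epsilon>\<^sub>A \<alpha>\<^sub>A e\<^sub>A\<close> is controlled by its nonlinearity on the combinations
  \<open>\<Sum>\<epsilon>\<^sub>A \<alpha>\<^sub>A u e\<^sub>A\<close> of flat vectors. The latter are products \<open>f y\<^sub>0\<close> with one fixed \<open>y\<^sub>0\<close> and \<open>f\<close> random and
  mostly bounded, so the centralizer property makes the nonlinearity there bounded, up to a small multiple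
  of the deviation on \<open>F\<^sub>n\<close>. Hence the deviation is bounded independently of \<open>n\<close>, a contradiction.
\<close>

section \<open>The space of square-integrable functions\<close>

text \<open>Three obstacles shape the proof. In general \<open>\<Omega> x\<close> is only
  measurable: it lies outside the domain of \<open>u\<close>, and its product with a vector need not
  be integrable, so all estimates go through differences that are in \<open>L2\<close> or
  integrable. Next, \<open>u\<close> is fixed before an extension and its norm are known, so a
  single \<open>u\<close> must serve humps of unbounded height, and non-triviality must survive
  inside ever smaller sets. This rests on a converse: a uniform bound on the deviations of all
  families inside a set already yields one multiplier there, found by compactness from multipliers
  for finitely many vectors. Finally, the estimate for flat vectors refers back to the deviation
  being estimated; its coefficient is brought down to 1/2, and a crude bound by the number of cells
  starts the iteration. Real skew orthogonal matrices exist only in even dimension, hence the even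
  cardinalities; Hartley matrices are real, symmetric, orthogonal and flat in every order. One spare
  cell per family keeps the rest of the basis infinite, so that it can be paired off.\<close>

definition ip :: "'a measure \<Rightarrow> ('a \<Rightarrow> real) \<Rightarrow> ('a \<Rightarrow> real) \<Rightarrow> real" where
  "ip M f g = (\<integral>t. f t * g t \<partial>M)"

lemma L2_measurable [measurable_dest]: "f \<in> L2 M \<Longrightarrow> f \<in> borel_measurable M"
  by (simp add: L2_def)

lemma L2_square_integrable: "f \<in> L2 M \<Longrightarrow> integrable M (\<lambda>t. (f t)\<^sup>2)"
  by (simp add: L2_def)

lemma L2_dominated:
  assumes "f \<in> L2 M" "g \<in> borel_measurable M" "AE t in M. \<bar>g t\<bar> \<le> \<bar>f t\<bar>"
  shows "g \<in> L2 M" "norm_L2 M g \<le> norm_L2 M f"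
proof -
  have le: "AE t in M. (g t)\<^sup>2 \<le> (f t)\<^sup>2"
    using assms(3) by eventually_elim (simp add: abs_le_square_iff[symmetric])
  have "integrable M (\<lambda>t. (g t)\<^sup>2)"
    by (rule Bochner_Integration.integrable_bound[OF L2_square_integrable[OF assms(1)]])
      (use assms(2) le in auto)
  then show "g \<in> L2 M"
    using assms(2) by (simp add: L2_def)
  show "norm_L2 M g \<le> norm_L2 M f"
    unfolding norm_L2_def
    by (intro real_sqrt_le_mono integral_mono_AE L2_square_integrable) fact+
qed

lemma L2_AE_cong:
  assumes "f \<in> L2 M" "g \<in> borel_measurable M" "AE t in M. f t = g t"
  shows "g \<in> L2 M"
  by (rule L2_dominated(1)[OF assms(1,2)]) (use assms(3) in auto)

lemma norm_L2_AE_cong: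
  assumes "f \<in> borel_measurable M" "g \<in> borel_measurable M" "AE t in M. f t = g t"
  shows "norm_L2 M f = norm_L2 M g"
  unfolding norm_L2_def
  by (intro arg_cong[where f = sqrt] integral_cong_AE) (use assms in auto)

lemma L2_mult_integrable:
  assumes "f \<in> L2 M" "g \<in> L2 M"
  shows "integrable M (\<lambda>t. f t * g t)"
proof (rule Bochner_Integration.integrable_bound)
  show "integrable M (\<lambda>t. (f t)\<^sup>2 + (g t)\<^sup>2)"
    by (intro Bochner_Integration.integrable_add L2_square_integrable assms)
  have "\<bar>a * b\<bar> \<le> a\<^sup>2 + b\<^sup>2" for a b :: real
  proof -
    have "2 * (\<bar>a\<bar> * \<bar>b\<bar>) \<le> a\<^sup>2 + b\<^sup>2"
      using sum_squares_bound[of "\<bar>a\<bar>" "\<bar>b\<bar>"] by simp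
    moreover have "0 \<le> \<bar>a\<bar> * \<bar>b\<bar>"
      by simp
    ultimately show ?thesis
      unfolding abs_mult by linarith
  qed
  then show "AE t in M. norm (f t * g t) \<le> norm ((f t)\<^sup>2 + (g t)\<^sup>2)"
    by (simp add: abs_mult)
qed (use assms in measurable)

lemma L2_zero [simp]: "(\<lambda>t. 0) \<in> L2 M"
  by (simp add: L2_def)

lemma norm_L2_zero [simp]: "norm_L2 M (\<lambda>t. 0) = 0"
  by (simp add: norm_L2_def)

lemma L2_cmult [intro]: "f \<in> L2 M \<Longrightarrow> (\<lambda>t. c * f t) \<in> L2 M"
  by (auto simp: L2_def power_mult_distrib)

lemma L2_uminus [intro]: "f \<in> L2 M \<Longrightarrow> (\<lambda>t. - f t) \<in> L2 M"
  by (auto simp: L2_def)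

lemma L2_add [intro]:
  assumes "f \<in> L2 M" "g \<in> L2 M"
  shows "(\<lambda>t. f t + g t) \<in> L2 M"
proof -
  have "integrable M (\<lambda>t. (f t)\<^sup>2 + (g t)\<^sup>2 + 2 * (f t * g t))"
    by (intro Bochner_Integration.integrable_add integrable_mult_right L2_square_integrable
        L2_mult_integrable assms)
  then show ?thesis
    using assms by (auto simp: L2_def power2_sum algebra_simps)
qed

lemma L2_diff [intro]:
  assumes "f \<in> L2 M" "g \<in> L2 M"
  shows "(\<lambda>t. f t - g t) \<in> L2 M"
  using L2_add[OF assms(1) L2_uminus[OF assms(2)]] by simp

lemma L2_sum:
  assumes "\<And>i. i \<in> I \<Longrightarrow> f i \<in> L2 M"
  shows "(\<lambda>t. \<Sum>i\<in>I. f i t) \<in> L2 M"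
  using assms
proof (induction I rule: infinite_finite_induct)
  case (insert i I)
  then show ?case
    using L2_add[of "f i" M "\<lambda>t. \<Sum>i\<in>I. f i t"] by simp
qed auto

lemma norm_L2_nonneg [simp]: "0 \<le> norm_L2 M f"
  by (simp add: norm_L2_def)

lemma norm_L2_power2: "(norm_L2 M f)\<^sup>2 = ip M f f"
  by (simp add: norm_L2_def ip_def power2_eq_square)

lemma norm_L2_cmult: "norm_L2 M (\<lambda>t. c * f t) = \<bar>c\<bar> * norm_L2 M f"
  by (simp add: norm_L2_def power_mult_distrib real_sqrt_mult)

lemma norm_L2_uminus [simp]: "norm_L2 M (\<lambda>t. - f t) = norm_L2 M f"
  by (simp add: norm_L2_def)

lemma norm_L2_minus_commute: "norm_L2 M (\<lambda>t. f t - g t) = norm_L2 M (\<lambda>t. g t - f t)"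
  by (simp add: norm_L2_def power2_commute)

lemma ip_commute: "ip M f g = ip M g f"
  by (simp add: ip_def mult.commute)

lemma ip_add_left:
  "f \<in> L2 M \<Longrightarrow> g \<in> L2 M \<Longrightarrow> h \<in> L2 M \<Longrightarrow> ip M (\<lambda>t. f t + g t) h = ip M f h + ip M g h"
  by (simp add: ip_def distrib_right L2_mult_integrable)

lemma ip_diff_left:
  "f \<in> L2 M \<Longrightarrow> g \<in> L2 M \<Longrightarrow> h \<in> L2 M \<Longrightarrow> ip M (\<lambda>t. f t - g t) h = ip M f h - ip M g h"
  by (simp add: ip_def left_diff_distrib L2_mult_integrable)

lemma ip_cmult_left: "ip M (\<lambda>t. c * f t) h = c * ip M f h"
  by (simp add: ip_def mult.assoc)

lemma ip_sum_left:
  "(\<And>i. i \<in> I \<Longrightarrow> f i \<in> L2 M) \<Longrightarrow> h \<in> L2 M \<Longrightarrow>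
    ip M (\<lambda>t. \<Sum>i\<in>I. f i t) h = (\<Sum>i\<in>I. ip M (f i) h)"
  by (simp add: ip_def sum_distrib_right L2_mult_integrable)

lemma ip_add_right:
  "f \<in> L2 M \<Longrightarrow> g \<in> L2 M \<Longrightarrow> h \<in> L2 M \<Longrightarrow> ip M h (\<lambda>t. f t + g t) = ip M h f + ip M h g"
  by (simp add: ip_commute[of M h] ip_add_left)

lemma ip_diff_right:
  "f \<in> L2 M \<Longrightarrow> g \<in> L2 M \<Longrightarrow> h \<in> L2 M \<Longrightarrow> ip M h (\<lambda>t. f t - g t) = ip M h f - ip M h g"
  by (simp add: ip_commute[of M h] ip_diff_left)

lemma ip_cmult_right: "ip M h (\<lambda>t. c * f t) = c * ip M h f"
  by (simp add: ip_commute[of M h] ip_cmult_left)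

lemma ip_sum_right:
  "(\<And>i. i \<in> I \<Longrightarrow> f i \<in> L2 M) \<Longrightarrow> h \<in> L2 M \<Longrightarrow>
    ip M h (\<lambda>t. \<Sum>i\<in>I. f i t) = (\<Sum>i\<in>I. ip M h (f i))"
  by (simp add: ip_commute[of M h] ip_sum_left)

lemma norm_L2_add_power2:
  assumes "f \<in> L2 M" "g \<in> L2 M"
  shows "(norm_L2 M (\<lambda>t. f t + g t))\<^sup>2 = (norm_L2 M f)\<^sup>2 + 2 * ip M f g + (norm_L2 M g)\<^sup>2"
  using assms by (simp add: norm_L2_power2 ip_add_left ip_add_right L2_add ip_commute[of M g f])

lemma norm_L2_diff_power2:
  assumes "f \<in> L2 M" "g \<in> L2 M"
  shows "(norm_L2 M (\<lambda>t. f t - g t))\<^sup>2 = (norm_L2 M f)\<^sup>2 - 2 * ip M f g + (norm_L2 M g)\<^sup>2"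
  using assms by (simp add: norm_L2_power2 ip_diff_left ip_diff_right L2_diff ip_commute[of M g f])

lemma norm_L2_eq_0_iff:
  assumes "f \<in> L2 M"
  shows "norm_L2 M f = 0 \<longleftrightarrow> (AE t in M. f t = 0)"
  using integral_nonneg_eq_0_iff_AE[OF L2_square_integrable[OF assms]]
  by (simp add: norm_L2_def)

lemma ip_Cauchy_Schwarz:
  assumes "f \<in> L2 M" "g \<in> L2 M"
  shows "\<bar>ip M f g\<bar> \<le> norm_L2 M f * norm_L2 M g"
proof (cases "norm_L2 M g = 0")
  case True
  then have "AE t in M. g t = 0"
    using norm_L2_eq_0_iff assms by blast
  then have "ip M f g = 0"
    unfolding ip_def by (intro integral_eq_zero_AE) auto
  then show ?thesis
    by simp
next
  case False
  define n where "n = (norm_L2 M g)\<^sup>2"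
  have n: "n > 0"
    using False by (simp add: n_def)
  define c where "c = ip M f g / n"
  have "0 \<le> (norm_L2 M (\<lambda>t. f t - c * g t))\<^sup>2"
    by simp
  also have "\<dots> = (norm_L2 M f)\<^sup>2 - 2 * c * ip M f g + c\<^sup>2 * n"
    using assms by (simp add: norm_L2_diff_power2 L2_cmult ip_cmult_right norm_L2_cmult
        power_mult_distrib n_def)
  also have "\<dots> = (norm_L2 M f)\<^sup>2 - (ip M f g)\<^sup>2 / n"
    using n by (simp add: c_def field_simps power2_eq_square)
  finally have "(ip M f g)\<^sup>2 \<le> (norm_L2 M f * norm_L2 M g)\<^sup>2"
    using n by (simp add: field_simps power_mult_distrib n_def)
  then have "\<bar>ip M f g\<bar> \<le> \<bar>norm_L2 M f * norm_L2 M g\<bar>"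
    by (simp only: abs_le_square_iff)
  then show ?thesis
    by (simp add: abs_mult)
qed

lemma norm_L2_triangle:
  assumes "f \<in> L2 M" "g \<in> L2 M"
  shows "norm_L2 M (\<lambda>t. f t + g t) \<le> norm_L2 M f + norm_L2 M g"
proof (rule power2_le_imp_le)
  show "(norm_L2 M (\<lambda>t. f t + g t))\<^sup>2 \<le> (norm_L2 M f + norm_L2 M g)\<^sup>2"
    using norm_L2_add_power2[OF assms] ip_Cauchy_Schwarz[OF assms]
    by (simp add: power2_sum)
qed simp

lemma norm_L2_triangle_diff:
  assumes "f \<in> L2 M" "g \<in> L2 M"
  shows "norm_L2 M (\<lambda>t. f t - g t) \<le> norm_L2 M f + norm_L2 M g"
  using norm_L2_triangle[OF assms(1) L2_uminus[OF assms(2)]] by simp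

lemma norm_L2_triangle3:
  assumes "f \<in> L2 M" "g \<in> L2 M" "h \<in> L2 M"
  shows "norm_L2 M (\<lambda>t. f t - h t) \<le> norm_L2 M (\<lambda>t. f t - g t) + norm_L2 M (\<lambda>t. g t - h t)"
  using norm_L2_triangle[OF L2_diff[OF assms(1,2)] L2_diff[OF assms(2,3)]] by simp

lemma norm_L2_dist:
  assumes "f \<in> L2 M" "g \<in> L2 M"
  shows "\<bar>norm_L2 M f - norm_L2 M g\<bar> \<le> norm_L2 M (\<lambda>t. f t - g t)"
  using norm_L2_triangle[OF L2_diff[OF assms] assms(2)]
    norm_L2_triangle[OF L2_diff[OF assms(2,1)] assms(1)] norm_L2_minus_commute[of M f g]
  by simp

lemma L2_mult_bounded:
  assumes "x \<in> L2 M" "f \<in> borel_measurable M" "\<And>t. t \<in> space M \<Longrightarrow> \<bar>f t\<bar> \<le> c"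
  shows "(\<lambda>t. f t * x t) \<in> L2 M" "norm_L2 M (\<lambda>t. f t * x t) \<le> c * norm_L2 M x"
proof -
  have le: "AE t in M. \<bar>f t * x t\<bar> \<le> \<bar>c * x t\<bar>"
  proof (rule AE_I2)
    fix t assume "t \<in> space M"
    then have "\<bar>f t\<bar> \<le> \<bar>c\<bar>"
      using assms(3)[of t] by linarith
    then show "\<bar>f t * x t\<bar> \<le> \<bar>c * x t\<bar>"
      by (simp add: abs_mult mult_right_mono)
  qed
  have m: "(\<lambda>t. f t * x t) \<in> borel_measurable M"
    using assms by measurable
  show "(\<lambda>t. f t * x t) \<in> L2 M"
    by (rule L2_dominated(1)[OF L2_cmult[OF assms(1)] m le])
  have "norm_L2 M (\<lambda>t. f t * x t) \<le> \<bar>c\<bar> * norm_L2 M x"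
    using L2_dominated(2)[OF L2_cmult[OF assms(1)] m le] by (simp add: norm_L2_cmult)
  also have "\<dots> \<le> c * norm_L2 M x"
  proof (cases "space M = {}")
    case True
    then have "norm_L2 M x = 0"
      using assms(1) by (simp add: norm_L2_eq_0_iff, intro AE_I2, simp)
    then show ?thesis by simp
  next
    case False
    then obtain t where "t \<in> space M"
      by auto
    then have "0 \<le> c"
      using assms(3)[of t] by linarith
    then show ?thesis by simp
  qed
  finally show "norm_L2 M (\<lambda>t. f t * x t) \<le> c * norm_L2 M x" .
qed

section \<open>Limits, almost everywhere convergent sequences and completeness\<close>

lemma L2_Fatou:
  assumes f: "\<And>n. f n \<in> L2 M" and lim: "AE t in M. (\<lambda>n. f n t) \<longlonglongrightarrow> g t"
    and g: "g \<in> borel_measurable M" and le: "\<And>n. norm_L2 M (f n) \<le> c"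
  shows "g \<in> L2 M" "norm_L2 M g \<le> c"
proof -
  have c: "0 \<le> c"
    using le[of 0] norm_L2_nonneg order_trans by blast
  have sq: "(\<integral>\<^sup>+t. ennreal ((f n t)\<^sup>2) \<partial>M) \<le> ennreal (c\<^sup>2)" for n
  proof -
    have "(\<integral>\<^sup>+t. ennreal ((f n t)\<^sup>2) \<partial>M) = ennreal (\<integral>t. (f n t)\<^sup>2 \<partial>M)"
      by (rule nn_integral_eq_integral) (auto intro: L2_square_integrable f)
    also have "(\<integral>t. (f n t)\<^sup>2 \<partial>M) = (norm_L2 M (f n))\<^sup>2"
      by (simp add: norm_L2_def)
    also have "ennreal \<dots> \<le> ennreal (c\<^sup>2)"
      by (intro ennreal_leI power_mono le) simp
    finally show ?thesis .
  qed
  have [measurable]: "f n \<in> borel_measurable M" for n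
    using f by (rule L2_measurable)
  have "(\<integral>\<^sup>+t. ennreal ((g t)\<^sup>2) \<partial>M) = (\<integral>\<^sup>+t. liminf (\<lambda>n. ennreal ((f n t)\<^sup>2)) \<partial>M)"
  proof (rule nn_integral_cong_AE)
    show "AE t in M. ennreal ((g t)\<^sup>2) = liminf (\<lambda>n. ennreal ((f n t)\<^sup>2))"
      using lim
    proof eventually_elim
      case (elim t)
      then have "(\<lambda>n. ennreal ((f n t)\<^sup>2)) \<longlonglongrightarrow> ennreal ((g t)\<^sup>2)"
        by (intro tendsto_ennrealI tendsto_power)
      then show ?case
        by (rule lim_imp_Liminf[OF sequentially_bot, symmetric])
    qed
  qed
  also have "\<dots> \<le> liminf (\<lambda>n. \<integral>\<^sup>+t. ennreal ((f n t)\<^sup>2) \<partial>M)"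
    by (rule nn_integral_liminf) simp
  also have "\<dots> \<le> ennreal (c\<^sup>2)"
    by (rule Liminf_le) (simp_all add: sq)
  finally have le2: "(\<integral>\<^sup>+t. ennreal ((g t)\<^sup>2) \<partial>M) \<le> ennreal (c\<^sup>2)" .
  then have "(\<integral>\<^sup>+t. ennreal ((g t)\<^sup>2) \<partial>M) < \<infinity>"
    by (rule le_less_trans) simp
  then have int: "integrable M (\<lambda>t. (g t)\<^sup>2)"
    using g by (intro integrableI_nonneg) auto
  then show "g \<in> L2 M"
    using g by (simp add: L2_def)
  have "ennreal (\<integral>t. (g t)\<^sup>2 \<partial>M) \<le> ennreal (c\<^sup>2)"
    using le2 by (subst (asm) nn_integral_eq_integral[OF int]) auto
  then have "(\<integral>t. (g t)\<^sup>2 \<partial>M) \<le> c\<^sup>2"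
    by (simp add: ennreal_le_iff)
  then show "norm_L2 M g \<le> c"
    using c by (simp add: norm_L2_def real_le_lsqrt)
qed

text \<open>Weighting the squared increments by \<open>2 ^ n\<close> keeps their integrals summable,
  so almost everywhere the weighted squares tend to 0 and the increments are eventually dominated by
  a geometric series.\<close>

lemma L2_Cauchy_AE_subseq:
  assumes f: "\<And>n. f n \<in> L2 M" and le: "\<And>n. norm_L2 M (\<lambda>t. f (Suc n) t - f n t) \<le> (1/2) ^ n"
  shows "AE t in M. convergent (\<lambda>n. f n t)"
proof -
  have [measurable]: "f n \<in> borel_measurable M" for n
    using f by (rule L2_measurable)
  define d where "d n t = f (Suc n) t - f n t" for n t
  have d: "d n \<in> L2 M" for n
    using L2_diff[OF f[of "Suc n"] f[of n]] by (simp add: d_def[abs_def])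
  have [measurable]: "d n \<in> borel_measurable M" for n
    using d by (rule L2_measurable)
  have int: "(\<integral>\<^sup>+t. ennreal (2 ^ n * (d n t)\<^sup>2) \<partial>M) \<le> ennreal ((1/2) ^ n)" for n
  proof -
    have "(\<integral>\<^sup>+t. ennreal (2 ^ n * (d n t)\<^sup>2) \<partial>M) = ennreal (\<integral>t. 2 ^ n * (d n t)\<^sup>2 \<partial>M)"
      by (intro nn_integral_eq_integral integrable_mult_right L2_square_integrable d) auto
    also have "(\<integral>t. 2 ^ n * (d n t)\<^sup>2 \<partial>M) = 2 ^ n * (norm_L2 M (d n))\<^sup>2"
      by (simp add: norm_L2_def)
    also have "\<dots> \<le> 2 ^ n * ((1/2) ^ n)\<^sup>2"
      using le[of n] by (intro mult_left_mono power_mono) (auto simp: d_def[abs_def])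
    also have "\<dots> = (1/2) ^ n"
      by (simp add: power2_eq_square field_simps flip: power_mult_distrib)
    finally show ?thesis
      by (simp add: ennreal_leI)
  qed
  have "(\<integral>\<^sup>+t. (\<Sum>n. ennreal (2 ^ n * (d n t)\<^sup>2)) \<partial>M) = (\<Sum>n. \<integral>\<^sup>+t. ennreal (2 ^ n * (d n t)\<^sup>2) \<partial>M)"
    by (rule nn_integral_suminf) simp
  also have "\<dots> \<le> (\<Sum>n. ennreal ((1/2) ^ n))"
    by (intro suminf_le int) auto
  also have "\<dots> = ennreal (\<Sum>n. (1/2) ^ n)"
    by (intro suminf_ennreal2) (auto intro: summable_geometric)
  finally have "(\<integral>\<^sup>+t. (\<Sum>n. ennreal (2 ^ n * (d n t)\<^sup>2)) \<partial>M) \<noteq> \<infinity>"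
    by (auto simp: top_unique)
  then have "AE t in M. (\<Sum>n. ennreal (2 ^ n * (d n t)\<^sup>2)) \<noteq> \<infinity>"
    by (intro nn_integral_PInf_AE) auto
  then show ?thesis
  proof eventually_elim
    case (elim t)
    have "summable (\<lambda>n. 2 ^ n * (d n t)\<^sup>2)"
      using elim by (intro summable_suminf_not_top) auto
    then have "(\<lambda>n. 2 ^ n * (d n t)\<^sup>2) \<longlonglongrightarrow> 0"
      by (rule summable_LIMSEQ_zero)
    then have "eventually (\<lambda>n. 2 ^ n * (d n t)\<^sup>2 < 1) sequentially"
      by (rule order_tendstoD) simp
    then have ev: "eventually (\<lambda>n. norm (d n t) \<le> (sqrt (1/2)) ^ n) sequentially"
    proof eventually_elim
      case (elim n)
      then have "(d n t)\<^sup>2 \<le> (1/2) ^ n"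
        by (simp add: field_simps)
      then have "\<bar>d n t\<bar> \<le> sqrt ((1/2) ^ n)"
        by (rule real_le_rsqrt[OF order_trans, rotated]) simp
      then show ?case
        by (simp only: real_sqrt_power real_norm_def)
    qed
    have "summable (\<lambda>n. (sqrt (1/2)) ^ n :: real)"
      by (intro summable_geometric) (simp add: real_sqrt_divide)
    then have "summable (\<lambda>n. d n t)"
      using summable_comparison_test_ev[OF ev] by blast
    then have "convergent (\<lambda>n. \<Sum>k<n. d k t)"
      by (simp add: summable_iff_convergent)
    then have "convergent (\<lambda>n. f 0 t + (\<Sum>k<n. d k t))"
      by (intro convergent_add convergent_const)
    moreover have "f 0 t + (\<Sum>k<n. d k t) = f n t" for n
      unfolding d_def using sum_lessThan_telescope[of "\<lambda>k. f k t" n] by simp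
    ultimately show ?case
      by simp
  qed
qed

text \<open>A fast subsequence converges almost everywhere and defines \<open>g\<close>; Fatou
  applied to the differences with that subsequence turns the Cauchy estimate into a bound on the
  distance to \<open>g\<close>.\<close>

lemma L2_complete:
  assumes f: "\<And>n. f n \<in> L2 M"
    and Cauchy: "\<And>e. e > 0 \<Longrightarrow> \<exists>N. \<forall>m\<ge>N. \<forall>n\<ge>N. norm_L2 M (\<lambda>t. f m t - f n t) \<le> e"
  obtains g r where "g \<in> L2 M" "(\<lambda>n. norm_L2 M (\<lambda>t. f n t - g t)) \<longlonglongrightarrow> 0"
    "AE t in M. (\<lambda>n. f (r n) t) \<longlonglongrightarrow> g t"
proof -
  have [measurable]: "f n \<in> borel_measurable M" for n
    using f by (rule L2_measurable)
  have "\<exists>r. \<forall>k. (\<forall>m\<ge>r k. \<forall>n\<ge>r k. norm_L2 M (\<lambda>t. f m t - f n t) \<le> (1/2) ^ k) \<and> r k < r (Suc k)"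
  proof (rule dependent_nat_choice)
    show "\<exists>N. \<forall>m\<ge>N. \<forall>n\<ge>N. norm_L2 M (\<lambda>t. f m t - f n t) \<le> (1/2) ^ 0"
      by (rule Cauchy) simp
    fix N k
    obtain N' where N': "\<forall>m\<ge>N'. \<forall>n\<ge>N'. norm_L2 M (\<lambda>t. f m t - f n t) \<le> (1/2) ^ Suc k"
      using Cauchy[of "(1/2) ^ Suc k"] by auto
    show "\<exists>N''. (\<forall>m\<ge>N''. \<forall>n\<ge>N''. norm_L2 M (\<lambda>t. f m t - f n t) \<le> (1/2) ^ Suc k) \<and> N < N''"
      by (rule exI[of _ "max N' (Suc N)"]) (use N' in auto)
  qed
  then obtain r where r: "\<And>k m n. m \<ge> r k \<Longrightarrow> n \<ge> r k \<Longrightarrow> norm_L2 M (\<lambda>t. f m t - f n t) \<le> (1/2) ^ k"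
    and mono: "\<And>k. r k < r (Suc k)"
    by metis
  have sm: "strict_mono r"
    using mono by (simp add: strict_mono_Suc_iff)
  \<comment> \<open>\<open>lim\<close> is a total function, so \<open>g\<close> is measurable even
    where the subsequence diverges.\<close>
  define g where "g t = lim (\<lambda>n. f (r n) t)" for t
  have [measurable]: "g \<in> borel_measurable M"
    unfolding g_def by (rule borel_measurable_lim_metric) simp
  have "AE t in M. convergent (\<lambda>n. f (r n) t)"
    by (rule L2_Cauchy_AE_subseq) (use f r mono[THEN less_imp_le] in auto)
  then have lim: "AE t in M. (\<lambda>n. f (r n) t) \<longlonglongrightarrow> g t"
    by eventually_elim (simp add: g_def convergent_LIMSEQ_iff)
  have close: "(\<lambda>t. f n t - g t) \<in> L2 M \<and> norm_L2 M (\<lambda>t. f n t - g t) \<le> e"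
    if N: "\<forall>m\<ge>N. \<forall>n\<ge>N. norm_L2 M (\<lambda>t. f m t - f n t) \<le> e" "n \<ge> N" for N n e
  proof -
    have ge: "r (k + N) \<ge> N" for k
      using seq_suble[OF sm, of "k + N"] by simp
    have l: "AE t in M. (\<lambda>k. f n t - f (r (k + N)) t) \<longlonglongrightarrow> f n t - g t"
      using lim
    proof eventually_elim
      case (elim t)
      then show ?case
        by (intro tendsto_diff tendsto_const LIMSEQ_ignore_initial_segment)
    qed
    have "(\<lambda>t. f n t - f (r (k + N)) t) \<in> L2 M" for k
      by (intro L2_diff f)
    moreover have "norm_L2 M (\<lambda>t. f n t - f (r (k + N)) t) \<le> e" for k
      using N ge by auto
    ultimately show ?thesis
      using L2_Fatou[of "\<lambda>k t. f n t - f (r (k + N)) t", OF _ l] by auto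
  qed
  obtain N0 where N0: "\<forall>m\<ge>N0. \<forall>n\<ge>N0. norm_L2 M (\<lambda>t. f m t - f n t) \<le> 1"
    using Cauchy[of 1] by auto
  have g: "g \<in> L2 M"
    using L2_diff[OF f[of N0], of "\<lambda>t. f N0 t - g t"] close[OF N0, of N0] by simp
  have "(\<lambda>n. norm_L2 M (\<lambda>t. f n t - g t)) \<longlonglongrightarrow> 0"
  proof (rule LIMSEQ_I)
    fix e :: real assume "e > 0"
    then obtain N where N: "\<forall>m\<ge>N. \<forall>n\<ge>N. norm_L2 M (\<lambda>t. f m t - f n t) \<le> e / 2"
      using Cauchy[of "e / 2"] by auto
    have "norm (norm_L2 M (\<lambda>t. f n t - g t) - 0) < e" if "n \<ge> N" for n
      using close[OF N that] \<open>e > 0\<close> by simp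
    then show "\<exists>N. \<forall>n\<ge>N. norm (norm_L2 M (\<lambda>t. f n t - g t) - 0) < e"
      by blast
  qed
  with g lim that show thesis
    by blast
qed

section \<open>Convex sets and points of nearly minimal norm\<close>

lemma norm_L2_parallelogram:
  assumes "f \<in> L2 M" "g \<in> L2 M"
  shows "(norm_L2 M (\<lambda>t. f t - g t))\<^sup>2 =
    2 * (norm_L2 M f)\<^sup>2 + 2 * (norm_L2 M g)\<^sup>2 - 4 * (norm_L2 M (\<lambda>t. (f t + g t) / 2))\<^sup>2"
proof -
  have "norm_L2 M (\<lambda>t. (f t + g t) / 2) = norm_L2 M (\<lambda>t. f t + g t) / 2"
    using norm_L2_cmult[of M "1/2" "\<lambda>t. f t + g t"] by simp
  then have "4 * (norm_L2 M (\<lambda>t. (f t + g t) / 2))\<^sup>2 = (norm_L2 M (\<lambda>t. f t + g t))\<^sup>2"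
    by (simp only: power_divide) simp
  then show ?thesis
    using norm_L2_add_power2[OF assms] norm_L2_diff_power2[OF assms] by linarith
qed

text \<open>
  This replaces weak compactness of balls: points of almost minimal norm in a directed family of
  convex sets form a Cauchy net.
\<close>

lemma L2_convex_finite_intersection:
  fixes K :: "'i \<Rightarrow> ('a \<Rightarrow> real) set"
  assumes sub: "\<And>i. i \<in> I \<Longrightarrow> K i \<subseteq> L2 M"
    and convex: "\<And>i x y. i \<in> I \<Longrightarrow> x \<in> K i \<Longrightarrow> y \<in> K i \<Longrightarrow> (\<lambda>t. (x t + y t) / 2) \<in> K i"
    and closed: "\<And>i f g. i \<in> I \<Longrightarrow> (\<And>n. f n \<in> K i) \<Longrightarrow> g \<in> L2 M \<Longrightarrow>
      (\<lambda>n. norm_L2 M (\<lambda>t. f n t - g t)) \<longlonglongrightarrow> 0 \<Longrightarrow> g \<in> K i"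
    and \<iota>: "\<iota> \<in> I" and bounded: "\<And>x. x \<in> K \<iota> \<Longrightarrow> norm_L2 M x \<le> b"
    and FIP: "\<And>J. finite J \<Longrightarrow> J \<subseteq> I \<Longrightarrow> \<exists>x. \<forall>i\<in>J. x \<in> K i"
  shows "\<exists>x. \<forall>i\<in>I. x \<in> K i"
proof -
  define \<J> where "\<J> = {J. finite J \<and> J \<subseteq> I \<and> \<iota> \<in> J}"
  define KJ where "KJ J = {x. \<forall>i\<in>J. x \<in> K i}" for J
  define d where "d J = Inf (norm_L2 M ` KJ J)" for J
  have ne: "KJ J \<noteq> {}" if "J \<in> \<J>" for J
    using FIP[of J] that by (auto simp: \<J>_def KJ_def)
  have bb: "bdd_below (norm_L2 M ` A)" for A
    by (rule bdd_belowI[of _ 0]) auto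
  have d_le: "d J \<le> norm_L2 M x" if "x \<in> KJ J" for x J
    unfolding d_def using that by (intro cInf_lower bb) auto
  have d_ex: "\<exists>x\<in>KJ J. norm_L2 M x < r" if "J \<in> \<J>" "d J < r" for J r
  proof -
    have "\<exists>n\<in>norm_L2 M ` KJ J. n < r"
      using that ne[OF that(1)] bb[of "KJ J"] unfolding d_def
      by (subst (asm) cInf_less_iff) auto
    then show ?thesis
      by auto
  qed
  have d_b: "d J \<le> b" if J: "J \<in> \<J>" for J
  proof -
    obtain x where x: "x \<in> KJ J"
      using ne[OF J] by blast
    then have "norm_L2 M x \<le> b"
      using J by (intro bounded) (auto simp: KJ_def \<J>_def)
    then show ?thesis
      using d_le[OF x] by linarith
  qed
  have d_nonneg: "0 \<le> d J" if "J \<in> \<J>" for J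
    unfolding d_def using ne[OF that] by (intro cInf_greatest) auto
  \<comment> \<open>The infimum of the norms can only grow when indices are added, and it stays
    below \<open>b\<close>; points of norm close to the supremum \<open>s\<close> are nearly minimal
    for all large finite index sets at once.\<close>
  define s where "s = Sup (d ` \<J>)"
  have J_ne: "{\<iota>} \<in> \<J>"
    using \<iota> by (simp add: \<J>_def)
  have bd: "bdd_above (d ` \<J>)"
    by (rule bdd_aboveI[of _ b]) (use d_b in auto)
  have d_s: "d J \<le> s" if "J \<in> \<J>" for J
    unfolding s_def using that bd by (intro cSup_upper) auto
  have s0: "0 \<le> s"
    using d_s[OF J_ne] d_nonneg[OF J_ne] by linarith
  have "\<exists>J\<in>\<J>. s - r < d J" if "r > 0" for r
  proof -
    have "s - r < Sup (d ` \<J>)"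
      using that by (simp add: s_def)
    then obtain z where "z \<in> d ` \<J>" "s - r < z"
      using J_ne less_cSupE[of "s - r" "d ` \<J>"] by blast
    then show ?thesis
      by auto
  qed
  then have "\<forall>n. \<exists>J\<in>\<J>. s - 1 / real (Suc n) < d J"
    by simp
  then obtain J where J: "\<And>n. J n \<in> \<J>" "\<And>n. s - 1 / real (Suc n) < d (J n)"
    by metis
  define J' where "J' n = (\<Union>m\<le>n. J m)" for n
  have J': "J' n \<in> \<J>" for n
    using J(1) by (auto simp: J'_def \<J>_def)
  \<comment> \<open>Midpoints stay in \<open>KJ (J n)\<close>, where norms exceed
    \<open>s - \<epsilon>\<close>, so the parallelogram identity forces points of norm at most
    \<open>s + \<epsilon>\<close> together. The case \<open>s < \<epsilon>\<close> is separate
    because squaring \<open>s - \<epsilon>\<close> is not monotone there.\<close>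
  have near: "norm_L2 M (\<lambda>t. x t - y t) \<le> sqrt (16 * (s + 1) / real (Suc n))"
    if x: "x \<in> KJ (J n)" "norm_L2 M x \<le> s + 1 / real (Suc n)"
      and y: "y \<in> KJ (J n)" "norm_L2 M y \<le> s + 1 / real (Suc n)" for x y n
  proof -
    define \<epsilon> where "\<epsilon> = 1 / real (Suc n)"
    have J_I: "J n \<subseteq> I" "\<iota> \<in> J n"
      using J(1)[of n] by (auto simp: \<J>_def)
    have "x \<in> K \<iota>" "y \<in> K \<iota>"
      using x(1) y(1) J_I(2) by (auto simp: KJ_def)
    then have xy: "x \<in> L2 M" "y \<in> L2 M"
      using sub[OF \<iota>] by auto
    define m where "m = (\<lambda>t. (x t + y t) / 2)"
    have m: "m \<in> KJ (J n)"
      using x(1) y(1) J_I(1) convex unfolding KJ_def m_def by blast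
    have "s - \<epsilon> < norm_L2 M m"
      using J(2)[of n] d_le[OF m] by (simp add: \<epsilon>_def)
    then have m1: "\<bar>s - \<epsilon>\<bar>\<^sup>2 \<le> (norm_L2 M m)\<^sup>2 \<or> s < \<epsilon>"
      by (cases "s < \<epsilon>") (auto intro!: power_mono)
    have x2: "(norm_L2 M x)\<^sup>2 \<le> (s + \<epsilon>)\<^sup>2" and y2: "(norm_L2 M y)\<^sup>2 \<le> (s + \<epsilon>)\<^sup>2"
      using x(2) y(2) by (auto simp: \<epsilon>_def intro!: power_mono)
    have eq: "(norm_L2 M (\<lambda>t. x t - y t))\<^sup>2 =
        2 * (norm_L2 M x)\<^sup>2 + 2 * (norm_L2 M y)\<^sup>2 - 4 * (norm_L2 M m)\<^sup>2"
      using norm_L2_parallelogram[OF xy] by (simp add: m_def)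
    have e: "0 < \<epsilon>" "\<epsilon> \<le> 1"
      by (auto simp: \<epsilon>_def)
    have "(norm_L2 M (\<lambda>t. x t - y t))\<^sup>2 \<le> 16 * (s + 1) * \<epsilon>"
    proof (cases "s < \<epsilon>")
      case True
      have "(norm_L2 M (\<lambda>t. x t - y t))\<^sup>2 \<le> 4 * (s + \<epsilon>)\<^sup>2"
        using eq x2 y2 zero_le_power2[of "norm_L2 M m"] by linarith
      also have "\<dots> \<le> 4 * (2 * \<epsilon>)\<^sup>2"
        using True s0 e by (intro mult_left_mono power_mono) auto
      also have "\<dots> = 16 * \<epsilon> * \<epsilon>"
        by (simp add: power2_eq_square)
      also have "\<dots> \<le> 16 * (s + 1) * \<epsilon>"
        using e s0 by (intro mult_right_mono) auto
      finally show ?thesis .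
    next
      case False
      then have "(s - \<epsilon>)\<^sup>2 \<le> (norm_L2 M m)\<^sup>2"
        using m1 by auto
      then have "(norm_L2 M (\<lambda>t. x t - y t))\<^sup>2 \<le> 4 * (s + \<epsilon>)\<^sup>2 - 4 * (s - \<epsilon>)\<^sup>2"
        using eq x2 y2 by linarith
      also have "\<dots> = 16 * s * \<epsilon>"
        by (simp add: power2_eq_square algebra_simps)
      also have "\<dots> \<le> 16 * (s + 1) * \<epsilon>"
        using e by (intro mult_right_mono) auto
      finally show ?thesis .
    qed
    then show ?thesis
      by (intro real_le_rsqrt) (simp add: \<epsilon>_def)
  qed
  have "\<exists>x\<in>KJ (J' n). norm_L2 M x < s + 1 / real (Suc n)" for n
    by (intro d_ex J' le_less_trans[OF d_s[OF J']]) simp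
  then obtain x where x: "\<And>n. x n \<in> KJ (J' n)" "\<And>n. norm_L2 M (x n) < s + 1 / real (Suc n)"
    by metis
  have x_J: "x m \<in> KJ (J n)" if "n \<le> m" for m n
    using x(1)[of m] that by (auto simp: KJ_def J'_def)
  have x_L2: "x n \<in> L2 M" for n
    using x(1)[of n] J'[of n] sub[OF \<iota>] by (auto simp: KJ_def \<J>_def)
  have lim0: "(\<lambda>n. sqrt (16 * (s + 1) / real (Suc n))) \<longlonglongrightarrow> 0"
    using tendsto_real_sqrt[OF tendsto_mult[OF tendsto_const[of "16 * (s + 1)"] LIMSEQ_inverse_real_of_nat]]
    by (simp add: divide_inverse)
  have small: "\<exists>N. sqrt (16 * (s + 1) / real (Suc N)) \<le> e" if "e > 0" for e
    using order_tendstoD(2)[OF lim0 that] by (auto simp: eventually_sequentially intro: less_imp_le)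
  have x_le: "norm_L2 M (x m) \<le> s + 1 / real (Suc n)" if "n \<le> m" for m n
  proof -
    have "1 / real (Suc m) \<le> 1 / real (Suc n)"
      using that by (simp add: frac_le)
    then show ?thesis
      using x(2)[of m] by linarith
  qed
  have "\<exists>N. \<forall>m\<ge>N. \<forall>n\<ge>N. norm_L2 M (\<lambda>t. x m t - x n t) \<le> e" if e: "e > 0" for e
  proof -
    obtain N where N: "sqrt (16 * (s + 1) / real (Suc N)) \<le> e"
      using small[OF e] by blast
    show ?thesis
      by (intro exI[of _ N] allI impI order_trans[OF near N] x_J x_le)
  qed
  then obtain g r where g: "g \<in> L2 M" "(\<lambda>n. norm_L2 M (\<lambda>t. x n t - g t)) \<longlonglongrightarrow> 0"
    using L2_complete[of x M, OF x_L2] by blast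
  \<comment> \<open>The limit \<open>g\<close> comes from the index sets \<open>J' n\<close>, which
    need not contain \<open>i\<close>. Adding \<open>i\<close> to them gives nearly minimal points
    of \<open>K i\<close>, and these converge to the same \<open>g\<close>.\<close>
  have "g \<in> K i" if i: "i \<in> I" for i
  proof -
    have Ji: "insert i (J' n) \<in> \<J>" for n
      using J'[of n] i by (auto simp: \<J>_def)
    have "\<exists>y\<in>KJ (insert i (J' n)). norm_L2 M y < s + 1 / real (Suc n)" for n
      by (intro d_ex Ji le_less_trans[OF d_s[OF Ji]]) simp
    then obtain y where y: "\<And>n. y n \<in> KJ (insert i (J' n))"
        "\<And>n. norm_L2 M (y n) < s + 1 / real (Suc n)"
      by metis
    have yK: "y n \<in> K i" for n
      using y(1)[of n] by (simp add: KJ_def)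
    have yL2: "y n \<in> L2 M" for n
      using yK sub[OF i] by blast
    have xy: "norm_L2 M (\<lambda>t. y n t - x n t) \<le> sqrt (16 * (s + 1) / real (Suc n))" for n
      using y[of n] x_J[of n n] x_le[of n n] by (intro near) (auto simp: KJ_def J'_def)
    have "(\<lambda>n. norm_L2 M (\<lambda>t. y n t - g t)) \<longlonglongrightarrow> 0"
    proof (rule tendsto_sandwich[OF _ _ tendsto_const])
      show "\<forall>\<^sub>F n in sequentially. norm_L2 M (\<lambda>t. y n t - g t) \<le>
          sqrt (16 * (s + 1) / real (Suc n)) + norm_L2 M (\<lambda>t. x n t - g t)"
      proof (intro always_eventually allI)
        fix n
        show "norm_L2 M (\<lambda>t. y n t - g t) \<le>
            sqrt (16 * (s + 1) / real (Suc n)) + norm_L2 M (\<lambda>t. x n t - g t)"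
          using norm_L2_triangle3[OF yL2[of n] x_L2[of n] g(1)] xy[of n] by linarith
      qed
      show "(\<lambda>n. sqrt (16 * (s + 1) / real (Suc n)) + norm_L2 M (\<lambda>t. x n t - g t)) \<longlonglongrightarrow> 0"
        using tendsto_add[OF lim0 g(2)] by simp
    qed simp
    then show ?thesis
      by (rule closed[OF i yK g(1)])
  qed
  then show ?thesis
    by blast
qed

section \<open>Maximal orthonormal systems and density of their span\<close>

definition orthonormal :: "'a measure \<Rightarrow> ('a \<Rightarrow> real) set \<Rightarrow> bool" where
  "orthonormal M B \<longleftrightarrow>
    B \<subseteq> L2 M \<and> (\<forall>b\<in>B. \<forall>c\<in>B. ip M b c = (if b = c then 1 else 0))"

lemma orthonormal_extend_maximal:
  assumes "orthonormal M B0"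
  obtains B where "orthonormal M B" "B0 \<subseteq> B" "\<And>B'. orthonormal M B' \<Longrightarrow> B \<subseteq> B' \<Longrightarrow> B' = B"
proof -
  define \<A> where "\<A> = {B. orthonormal M B \<and> B0 \<subseteq> B}"
  have "\<exists>B\<in>\<A>. \<forall>X\<in>\<A>. B \<subseteq> X \<longrightarrow> X = B"
  proof (rule subset_Zorn_nonempty)
    show "\<A> \<noteq> {}"
      using assms by (auto simp: \<A>_def)
    fix C assume C: "C \<noteq> {}" "subset.chain \<A> C"
    have ex: "\<exists>X\<in>C. b \<in> X \<and> c \<in> X" if bc: "b \<in> \<Union>C" "c \<in> \<Union>C" for b c
    proof -
      obtain X Y where XY: "X \<in> C" "b \<in> X" "Y \<in> C" "c \<in> Y"
        using bc by blast
      then have "X \<subseteq> Y \<or> Y \<subseteq> X"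
        using C(2) unfolding subset_chain_def by blast
      then show ?thesis
        using XY by blast
    qed
    have C': "orthonormal M X" "B0 \<subseteq> X" if "X \<in> C" for X
      using subsetD[OF conjunct1[OF C(2)[unfolded subset.chain_def]] that] by (simp_all add: \<A>_def)
    have "orthonormal M (\<Union>C)"
      unfolding orthonormal_def
    proof (intro conjI ballI)
      show "\<Union>C \<subseteq> L2 M"
        using C'(1) by (auto simp: orthonormal_def)
      fix b c assume "b \<in> \<Union>C" "c \<in> \<Union>C"
      then obtain X where "X \<in> C" "b \<in> X" "c \<in> X"
        using ex by blast
      then show "ip M b c = (if b = c then 1 else 0)"
        using C'(1) unfolding orthonormal_def by blast
    qed
    moreover have "B0 \<subseteq> \<Union>C"
      using C'(2) C(1) by blast
    ultimately show "\<Union>C \<in> \<A>"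
      by (simp add: \<A>_def)
  qed
  then show thesis
    using that by (auto simp: \<A>_def)
qed

text \<open>The quadratic has slope \<open>2 * p\<close> at 0, so it stays nonnegative only if
  \<open>p = 0\<close>; the test value \<open>- p / (n + 1)\<close> also covers
  \<open>n = 0\<close>.\<close>

lemma affine_quadratic_nonneg_imp_zero:
  fixes p n :: real
  assumes "\<And>c. 0 \<le> 2 * c * p + c\<^sup>2 * n" "0 \<le> n"
  shows "p = 0"
proof -
  have "0 \<le> 2 * (- p / (n + 1)) * p + (- p / (n + 1))\<^sup>2 * n"
    by (rule assms)
  also have "\<dots> = p\<^sup>2 * (- n - 2) / (n + 1)\<^sup>2"
  proof -
    have "n + 1 \<noteq> 0"
      using assms(2) by simp
    then show ?thesis
      by (simp add: divide_simps) (simp add: power2_eq_square algebra_simps)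
  qed
  finally have "0 \<le> p\<^sup>2 * (- n - 2)"
    using assms(2) by (simp add: zero_le_divide_iff)
  then show ?thesis
    using assms(2) by (simp add: zero_le_mult_iff)
qed

text \<open>If \<open>x\<close> kept a positive distance from the span, the closure of
  \<open>x\<close> minus the span would contain a nonzero vector of least norm. It is orthogonal to
  \<open>B\<close> and, once normalised, would enlarge \<open>B\<close>.\<close>

lemma maximal_orthonormal_dense:
  assumes B: "orthonormal M B" and max: "\<And>B'. orthonormal M B' \<Longrightarrow> B \<subseteq> B' \<Longrightarrow> B' = B"
    and x: "x \<in> L2 M" and e: "e > 0"
  shows "\<exists>S a. finite S \<and> S \<subseteq> B \<and> norm_L2 M (\<lambda>t. x t - (\<Sum>b\<in>S. a b * b t)) < e"
proof (rule ccontr)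
  assume far: "\<not> ?thesis"
  define V where "V = {\<lambda>t. \<Sum>b\<in>S. a b * b t | S a. finite S \<and> S \<subseteq> B}"
  have B_L2: "b \<in> L2 M" if "b \<in> B" for b
    using B that by (auto simp: orthonormal_def)
  have V_L2: "v \<in> L2 M" if "v \<in> V" for v
    using that B_L2 unfolding V_def by (auto intro!: L2_sum L2_cmult)
  have V_add: "(\<lambda>t. c * v t + d * w t) \<in> V" if v: "v \<in> V" and w: "w \<in> V" for v w c d
  proof -
    obtain S a where v: "finite S" "S \<subseteq> B" "v = (\<lambda>t. \<Sum>b\<in>S. a b * b t)"
      using v by (auto simp: V_def)
    obtain S' a' where w: "finite S'" "S' \<subseteq> B" "w = (\<lambda>t. \<Sum>b\<in>S'. a' b * b t)"
      using w by (auto simp: V_def)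
    define c' where "c' b = c * (if b \<in> S then a b else 0) + d * (if b \<in> S' then a' b else 0)" for b
    have "c * v t + d * w t = (\<Sum>b\<in>S \<union> S'. c' b * b t)" for t
    proof -
      have "(\<Sum>b\<in>S \<union> S'. c' b * b t) =
          c * (\<Sum>b\<in>S \<union> S'. (if b \<in> S then a b * b t else 0)) +
          d * (\<Sum>b\<in>S \<union> S'. (if b \<in> S' then a' b * b t else 0))"
        unfolding c'_def sum_distrib_left
        by (subst sum.distrib[symmetric], rule sum.cong) (auto simp: algebra_simps)
      then show ?thesis
        using v w by (simp add: sum.inter_restrict[symmetric] Int_absorb1 Int_commute)
    qed
    then show ?thesis
      unfolding V_def using v(1,2) w(1,2) by (auto intro!: exI[of _ "S \<union> S'"] exI[of _ c'])
  qed
  have V_B: "b \<in> V" if "b \<in> B" for b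
    unfolding V_def using that by (auto intro!: exI[of _ "{b}"] exI[of _ "\<lambda>_. 1"])
  \<comment> \<open>\<open>W\<close> is the closure of \<open>x - V\<close>; without taking the
    closure the sets \<open>K r\<close> below would not be closed.\<close>
  define W where "W = {w \<in> L2 M. \<forall>\<epsilon>>0. \<exists>v\<in>V. norm_L2 M (\<lambda>t. w t - (x t - v t)) < \<epsilon>}"
  have W_D: "\<exists>v\<in>V. norm_L2 M (\<lambda>t. w t - (x t - v t)) < \<epsilon>" if "w \<in> W" "\<epsilon> > 0" for w \<epsilon>
    using that by (simp add: W_def)
  have V_ne: "(\<lambda>t. 0) \<in> V"
    unfolding V_def by (auto intro!: exI[of _ "{}"])
  have W_V: "(\<lambda>t. x t - v t) \<in> W" if "v \<in> V" for v
    using that x V_L2 by (auto simp: W_def intro!: bexI[of _ v])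
  have far': "e \<le> norm_L2 M w" if w: "w \<in> W" for w
  proof (rule field_le_epsilon)
    fix \<epsilon> :: real assume "\<epsilon> > 0"
    then obtain v where v: "v \<in> V" "norm_L2 M (\<lambda>t. w t - (x t - v t)) < \<epsilon>"
      using w by (auto simp: W_def)
    have "e \<le> norm_L2 M (\<lambda>t. x t - v t)"
      using far v(1) unfolding V_def by (auto simp: not_less)
    also have "\<dots> \<le> norm_L2 M w + norm_L2 M (\<lambda>t. w t - (x t - v t))"
      using norm_L2_dist[of w M "\<lambda>t. x t - v t"] L2_diff[OF x V_L2[OF v(1)]] w by (auto simp: W_def)
    finally show "e \<le> norm_L2 M w + \<epsilon>"
      using v(2) by linarith
  qed
  define d where "d = Inf (norm_L2 M ` W)"
  have bb: "bdd_below (norm_L2 M ` W)"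
    by (rule bdd_belowI[of _ 0]) auto
  have W_ne: "W \<noteq> {}"
    using W_V[OF V_ne] by blast
  have d_le: "d \<le> norm_L2 M w" if "w \<in> W" for w
    unfolding d_def using that by (intro cInf_lower bb) auto
  have d_e: "e \<le> d"
    unfolding d_def using W_ne far' by (intro cInf_greatest) auto
  have d_ex: "\<exists>w\<in>W. norm_L2 M w < r" if "d < r" for r
    using that W_ne bb unfolding d_def by (subst (asm) cInf_less_iff) auto
  \<comment> \<open>A common point of all \<open>K r\<close> with \<open>r > 0\<close> has norm at
    most \<open>d\<close> and is therefore a minimiser.\<close>
  define K where "K r = {w \<in> W. norm_L2 M w \<le> d + r}" for r
  have "\<exists>w. \<forall>r\<in>{0<..}. w \<in> K r"
  proof (rule L2_convex_finite_intersection[where \<iota> = 1 and b = "d + 1" and M = M])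
    show "K r \<subseteq> L2 M" if "r \<in> {0<..}" for r
      by (auto simp: K_def W_def)
    show "norm_L2 M w \<le> d + 1" if "w \<in> K 1" for w
      using that by (simp add: K_def)
    show "\<exists>w. \<forall>r\<in>J. w \<in> K r" if J: "finite J" "J \<subseteq> {0<..}" for J
    proof (cases "J = {}")
      case False
      then have "Min J > 0"
        using J by auto
      then obtain w where w: "w \<in> W" "norm_L2 M w < d + Min J"
        using d_ex[of "d + Min J"] by auto
      have "w \<in> K r" if "r \<in> J" for r
        using w Min_le[OF J(1) that] by (simp add: K_def)
      then show ?thesis
        by blast
    qed simp
    show "(\<lambda>t. (w t + w' t) / 2) \<in> K r" if w: "w \<in> K r" "w' \<in> K r" and r: "r \<in> {0<..}" for r w w'
    proof -
      have L: "w \<in> L2 M" "w' \<in> L2 M"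
        using w by (auto simp: K_def W_def)
      have eq: "norm_L2 M (\<lambda>t. (f t + g t) / 2) = norm_L2 M (\<lambda>t. f t + g t) / 2" for f g
        using norm_L2_cmult[of M "1/2" "\<lambda>t. f t + g t"] by simp
      have "norm_L2 M (\<lambda>t. (w t + w' t) / 2) \<le> d + r"
        using norm_L2_triangle[OF L] w by (simp add: eq K_def)
      moreover have "(\<lambda>t. (w t + w' t) / 2) \<in> W"
        unfolding W_def
      proof (intro CollectI conjI allI impI)
        show "(\<lambda>t. (w t + w' t) / 2) \<in> L2 M"
          using L2_cmult[OF L2_add[OF L], of "1/2"] by simp
        fix \<epsilon> :: real assume "\<epsilon> > 0"
        then obtain v v' where v: "v \<in> V" "norm_L2 M (\<lambda>t. w t - (x t - v t)) < \<epsilon>"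
          and v': "v' \<in> V" "norm_L2 M (\<lambda>t. w' t - (x t - v' t)) < \<epsilon>"
          using W_D[of w \<epsilon>] W_D[of w' \<epsilon>] w unfolding K_def by blast
        have "norm_L2 M (\<lambda>t. ((w t - (x t - v t)) + (w' t - (x t - v' t))) / 2) < \<epsilon>"
          unfolding eq using norm_L2_triangle[of "\<lambda>t. w t - (x t - v t)" M "\<lambda>t. w' t - (x t - v' t)"]
            L2_diff[OF L(1) L2_diff[OF x V_L2[OF v(1)]]] L2_diff[OF L(2) L2_diff[OF x V_L2[OF v'(1)]]] v(2) v'(2)
          by simp
        moreover have "(\<lambda>t. ((w t - (x t - v t)) + (w' t - (x t - v' t))) / 2) =
            (\<lambda>t. (w t + w' t) / 2 - (x t - (1/2 * v t + 1/2 * v' t)))"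
          by (simp add: fun_eq_iff field_simps)
        ultimately show "\<exists>v\<in>V. norm_L2 M (\<lambda>t. (w t + w' t) / 2 - (x t - v t)) < \<epsilon>"
          by (intro bexI[OF _ V_add[OF v(1) v'(1), of "1/2" "1/2"]]) (simp only:)
      qed
      ultimately show ?thesis
        by (simp add: K_def)
    qed
    show "g \<in> K r"
      if f: "\<And>n::nat. f n \<in> K r" and g: "g \<in> L2 M" and lim: "(\<lambda>n. norm_L2 M (\<lambda>t. f n t - g t)) \<longlonglongrightarrow> 0"
        and r: "r \<in> {0<..}" for r f g
    proof -
      have fL: "f n \<in> L2 M" for n
        using f[of n] by (simp add: K_def W_def)
      have "norm_L2 M g \<le> d + r"
      proof (rule LIMSEQ_le_const[OF tendsto_add[OF tendsto_const[of "d + r"] lim, simplified]])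
        show "\<exists>N. \<forall>n\<ge>N. norm_L2 M g \<le> d + r + norm_L2 M (\<lambda>t. f n t - g t)"
        proof (intro exI allI impI)
          fix n
          have "norm_L2 M (f n) \<le> d + r"
            using f[of n] by (simp add: K_def)
          then show "norm_L2 M g \<le> d + r + norm_L2 M (\<lambda>t. f n t - g t)"
            using norm_L2_dist[OF fL[of n] g] by linarith
        qed
      qed
      moreover have "g \<in> W"
        unfolding W_def
      proof (intro CollectI conjI allI impI g)
        fix \<epsilon> :: real assume "\<epsilon> > 0"
        then obtain n where n: "norm_L2 M (\<lambda>t. f n t - g t) < \<epsilon> / 2"
          using eventually_happens[OF order_tendstoD(2)[OF lim, of "\<epsilon> / 2"]] by auto
        obtain v where v: "v \<in> V" "norm_L2 M (\<lambda>t. f n t - (x t - v t)) < \<epsilon> / 2"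
          using W_D[of "f n" "\<epsilon> / 2"] f[of n] \<open>\<epsilon> > 0\<close> unfolding K_def by auto
        have "norm_L2 M (\<lambda>t. g t - (x t - v t)) < \<epsilon>"
          using norm_L2_triangle3[OF g fL[of n] L2_diff[OF x V_L2[OF v(1)]]] n v(2)
            norm_L2_minus_commute[of M g "f n"] by simp
        then show "\<exists>v\<in>V. norm_L2 M (\<lambda>t. g t - (x t - v t)) < \<epsilon>"
          using v(1) by blast
      qed
      ultimately show ?thesis
        by (simp add: K_def)
    qed
  qed simp
  then obtain w where w: "\<And>r. r > 0 \<Longrightarrow> w \<in> K r"
    by auto
  have wW: "w \<in> W"
    using w[of 1] by (simp add: K_def)
  then have wL: "w \<in> L2 M"
    by (simp add: W_def)
  have w_d: "norm_L2 M w \<le> d"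
  proof (rule field_le_epsilon)
    fix r :: real assume "0 < r"
    from w[OF this] show "norm_L2 M w \<le> d + r"
      by (simp add: K_def)
  qed
  have perp: "ip M w b = 0" if b: "b \<in> B" for b
  proof (rule affine_quadratic_nonneg_imp_zero)
    fix c :: real
    have "(\<lambda>t. w t + c * b t) \<in> W"
      unfolding W_def
    proof (intro CollectI conjI allI impI)
      show "(\<lambda>t. w t + c * b t) \<in> L2 M"
        by (intro L2_add L2_cmult wL B_L2 b)
      fix \<epsilon> :: real assume "\<epsilon> > 0"
      then obtain v where v: "v \<in> V" "norm_L2 M (\<lambda>t. w t - (x t - v t)) < \<epsilon>"
        using wW by (auto simp: W_def)
      have "(\<lambda>t. w t + c * b t - (x t - (1 * v t + - c * b t))) = (\<lambda>t. w t - (x t - v t))"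
        by (simp add: fun_eq_iff)
      then show "\<exists>v\<in>V. norm_L2 M (\<lambda>t. w t + c * b t - (x t - v t)) < \<epsilon>"
        using v(2) by (intro bexI[OF _ V_add[OF v(1) V_B[OF b], of 1 "- c"]]) simp
    qed
    then have "norm_L2 M w \<le> norm_L2 M (\<lambda>t. w t + c * b t)"
      by (rule order_trans[OF w_d d_le])
    then have "(norm_L2 M w)\<^sup>2 \<le> (norm_L2 M (\<lambda>t. w t + c * b t))\<^sup>2"
      by (intro power_mono) auto
    then show "0 \<le> 2 * c * ip M w b + c\<^sup>2 * (norm_L2 M b)\<^sup>2"
      using wL B_L2[OF b]
      by (simp add: norm_L2_add_power2 L2_cmult ip_cmult_right norm_L2_cmult power_mult_distrib)
  qed simp
  have w_pos: "norm_L2 M w > 0"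
    using d_e e d_le[OF wW] by linarith
  define b where "b = (\<lambda>t. (1 / norm_L2 M w) * w t)"
  have ipb: "ip M b b = 1"
    using w_pos unfolding b_def ip_cmult_left ip_cmult_right
    by (simp flip: norm_L2_power2 add: power2_eq_square)
  have perp': "ip M b c = 0" "ip M c b = 0" if "c \<in> B" for c
    using perp[OF that] unfolding b_def ip_cmult_left ip_cmult_right by (auto simp: ip_commute)
  have bL: "b \<in> L2 M"
    unfolding b_def by (intro L2_cmult wL)
  have "orthonormal M (insert b B)"
    using B bL ipb perp' unfolding orthonormal_def by auto
  then have "b \<in> B"
    using max[of "insert b B"] by blast
  then show False
    using perp'(1)[of b] ipb by simp
qed

section \<open>Centralizers and families of cells\<close>

lemma L2_indicator_mult:
  assumes "x \<in> L2 M" "A \<in> sets M"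
  shows "(\<lambda>t. indicator A t * x t) \<in> L2 M" "norm_L2 M (\<lambda>t. indicator A t * x t) \<le> norm_L2 M x"
  using L2_mult_bounded[OF assms(1), of "indicator A" 1] assms(2) by (simp_all add: indicator_def)

text \<open>Over a null space the essential supremum is \<open>- \<infinity>\<close>, which
  \<open>real_of_ereal\<close> sends to 0; otherwise it lies between 0 and \<open>c\<close>.\<close>

lemma Linf_bounded:
  assumes f: "f \<in> borel_measurable M" and le: "\<And>t. t \<in> space M \<Longrightarrow> \<bar>f t\<bar> \<le> c" and c: "0 \<le> c"
  shows "f \<in> Linf M" "\<bar>norm_Linf M f\<bar> \<le> c"
proof -
  let ?e = "esssup M (\<lambda>t. ereal \<bar>f t\<bar>)"
  have up: "?e \<le> ereal c"
    by (rule esssup_I) (use f le in auto)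
  then show "f \<in> Linf M"
    using f le_less_trans[OF up, of \<infinity>] by (simp add: Linf_def)
  show "\<bar>norm_Linf M f\<bar> \<le> c"
  proof (cases "emeasure M (space M) = 0")
    case True
    then have "?e = - \<infinity>"
      using f by (intro esssup_zero_space) auto
    then show ?thesis
      using c by (simp add: norm_Linf_def)
  next
    case False
    have "esssup M (\<lambda>t. ereal 0) \<le> ?e"
      by (rule esssup_mono) auto
    then have "0 \<le> ?e"
      using False by (simp add: esssup_const flip: zero_ereal_def)
    then show ?thesis
      using up c unfolding norm_Linf_def by (cases ?e) auto
  qed
qed

text \<open>One constant \<open>C\<close> serves quasi-linearity and the module estimate, and
  multipliers are bounded pointwise instead of essentially, which suits the explicit multipliers
  used below.\<close>

locale L2_centralizer = sigma_finite_measure M for M :: "'a measure" +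
  fixes \<Omega> :: "('a \<Rightarrow> real) \<Rightarrow> ('a \<Rightarrow> real)" and C :: real
  assumes C_nonneg: "0 \<le> C"
    and measurable_\<Omega> [measurable]: "x \<in> L2 M \<Longrightarrow> \<Omega> x \<in> borel_measurable M"
    and \<Omega>_cong: "x \<in> L2 M \<Longrightarrow> y \<in> L2 M \<Longrightarrow> AE t in M. x t = y t \<Longrightarrow> AE t in M. \<Omega> x t = \<Omega> y t"
    and \<Omega>_cmult: "x \<in> L2 M \<Longrightarrow> AE t in M. \<Omega> (\<lambda>s. c * x s) t = c * \<Omega> x t"
    and \<Omega>_add: "x \<in> L2 M \<Longrightarrow> y \<in> L2 M \<Longrightarrow> (\<lambda>t. \<Omega> (\<lambda>s. x s + y s) t - \<Omega> x t - \<Omega> y t) \<in> L2 M"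
      "x \<in> L2 M \<Longrightarrow> y \<in> L2 M \<Longrightarrow> norm_L2 M (\<lambda>t. \<Omega> (\<lambda>s. x s + y s) t - \<Omega> x t - \<Omega> y t)
        \<le> C * (norm_L2 M x + norm_L2 M y)"
    and \<Omega>_mult: "x \<in> L2 M \<Longrightarrow> f \<in> borel_measurable M \<Longrightarrow> (\<And>t. t \<in> space M \<Longrightarrow> \<bar>f t\<bar> \<le> c) \<Longrightarrow> 0 \<le> c \<Longrightarrow>
        (\<lambda>t. \<Omega> (\<lambda>s. f s * x s) t - f t * \<Omega> x t) \<in> L2 M"
      "x \<in> L2 M \<Longrightarrow> f \<in> borel_measurable M \<Longrightarrow> (\<And>t. t \<in> space M \<Longrightarrow> \<bar>f t\<bar> \<le> c) \<Longrightarrow> 0 \<le> c \<Longrightarrow>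
        norm_L2 M (\<lambda>t. \<Omega> (\<lambda>s. f s * x s) t - f t * \<Omega> x t) \<le> C * c * norm_L2 M x"

lemma centralizer_imp_L2_centralizer:
  assumes "sigma_finite_measure M" and cent: "centralizer M \<Omega>"
  obtains C where "L2_centralizer M \<Omega> C"
proof -
  obtain C1 where C1: "\<And>x y. x \<in> L2 M \<Longrightarrow> y \<in> L2 M \<Longrightarrow>
      (\<lambda>t. \<Omega> (\<lambda>s. x s + y s) t - \<Omega> x t - \<Omega> y t) \<in> L2 M"
      "\<And>x y. x \<in> L2 M \<Longrightarrow> y \<in> L2 M \<Longrightarrow> norm_L2 M (\<lambda>t. \<Omega> (\<lambda>s. x s + y s) t - \<Omega> x t - \<Omega> y t)
        \<le> C1 * (norm_L2 M x + norm_L2 M y)"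
    using cent unfolding centralizer_def quasi_linear_def by blast
  obtain C2 where C2: "\<And>f x. f \<in> Linf M \<Longrightarrow> x \<in> L2 M \<Longrightarrow>
        (\<lambda>t. \<Omega> (\<lambda>s. f s * x s) t - f t * \<Omega> x t) \<in> L2 M"
      "\<And>f x. f \<in> Linf M \<Longrightarrow> x \<in> L2 M \<Longrightarrow>
        norm_L2 M (\<lambda>t. \<Omega> (\<lambda>s. f s * x s) t - f t * \<Omega> x t) \<le> C2 * norm_Linf M f * norm_L2 M x"
    using cent unfolding centralizer_def by blast
  interpret sigma_finite_measure M by fact
  define C where "C = max \<bar>C1\<bar> \<bar>C2\<bar>"
  have "L2_centralizer M \<Omega> C"
  proof
    show "0 \<le> C"
      by (simp add: C_def)
    show "x \<in> L2 M \<Longrightarrow> \<Omega> x \<in> borel_measurable M" for x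
      using cent by (auto simp: centralizer_def L2_to_def)
    show "AE t in M. \<Omega> x t = \<Omega> y t" if "x \<in> L2 M" "y \<in> L2 M" "AE t in M. x t = y t" for x y
      using cent that by (auto simp: centralizer_def L2_to_def ae_eq_def)
    show "AE t in M. \<Omega> (\<lambda>s. c * x s) t = c * \<Omega> x t" if "x \<in> L2 M" for x c
      using cent that by (auto simp: centralizer_def L2_homogeneous_def ae_eq_def)
    fix x assume x: "x \<in> L2 M"
    {
      fix y assume y: "y \<in> L2 M"
      show "(\<lambda>t. \<Omega> (\<lambda>s. x s + y s) t - \<Omega> x t - \<Omega> y t) \<in> L2 M"
        by (rule C1(1)[OF x y])
      have "C1 * (norm_L2 M x + norm_L2 M y) \<le> C * (norm_L2 M x + norm_L2 M y)"
        by (intro mult_right_mono) (auto simp: C_def)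
      then show "norm_L2 M (\<lambda>t. \<Omega> (\<lambda>s. x s + y s) t - \<Omega> x t - \<Omega> y t)
          \<le> C * (norm_L2 M x + norm_L2 M y)"
        using C1(2)[OF x y] by linarith
    }
    fix f :: "'a \<Rightarrow> real" and c assume f: "f \<in> borel_measurable M" "\<And>t. t \<in> space M \<Longrightarrow> \<bar>f t\<bar> \<le> c" "0 \<le> c"
    note Li = Linf_bounded[OF f]
    show "(\<lambda>t. \<Omega> (\<lambda>s. f s * x s) t - f t * \<Omega> x t) \<in> L2 M"
      by (rule C2(1)[OF Li(1) x])
    have "C2 * norm_Linf M f \<le> \<bar>C2\<bar> * \<bar>norm_Linf M f\<bar>"
      by (simp flip: abs_mult)
    also have "\<dots> \<le> C * c"
      by (intro mult_mono Li f) (auto simp: C_def)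
    finally have "C2 * norm_Linf M f * norm_L2 M x \<le> C * c * norm_L2 M x"
      by (intro mult_right_mono) auto
    then show "norm_L2 M (\<lambda>t. \<Omega> (\<lambda>s. f s * x s) t - f t * \<Omega> x t) \<le> C * c * norm_L2 M x"
      using C2(2)[OF Li(1) x] by linarith
  qed
  then show thesis
    by (rule that)
qed

text \<open>Positive measure guarantees that a cell is nonempty and that its indicator can be
  normalised.\<close>

definition cell :: "'a measure \<Rightarrow> 'a set \<Rightarrow> bool" where
  "cell M A \<longleftrightarrow> A \<in> sets M \<and> 0 < measure M A \<and> emeasure M A < \<infinity>"

definition family :: "'a measure \<Rightarrow> 'a set set \<Rightarrow> bool" where
  "family M F \<longleftrightarrow> finite F \<and> disjoint F \<and> (\<forall>A\<in>F. cell M A)"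

definition simple_on :: "'a set set \<Rightarrow> ('a \<Rightarrow> real) \<Rightarrow> bool" where
  "simple_on F x \<longleftrightarrow> (\<forall>A\<in>F. \<forall>s\<in>A. \<forall>t\<in>A. x s = x t) \<and> (\<forall>t. t \<notin> \<Union>F \<longrightarrow> x t = 0)"

lemma family_cell: "family M F \<Longrightarrow> A \<in> F \<Longrightarrow> cell M A"
  by (simp add: family_def)

lemma family_finite: "family M F \<Longrightarrow> finite F"
  by (simp add: family_def)

lemma cell_sets [measurable_dest]: "cell M A \<Longrightarrow> A \<in> sets M"
  by (simp add: cell_def)

lemma family_subset: "family M F \<Longrightarrow> F' \<subseteq> F \<Longrightarrow> family M F'"
  unfolding family_def by (auto intro: finite_subset pairwise_subset)

lemma family_Union_sets: "family M F \<Longrightarrow> \<Union>F \<in> sets M"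
  by (auto simp: family_def cell_def)

lemma family_sum_indicator:
  assumes "family M F" "A \<in> F" "t \<in> A"
  shows "(\<Sum>B\<in>F. indicator B t * g B) = (g A :: real)"
proof -
  have "(\<Sum>B\<in>F. indicator B t * g B) = (\<Sum>B\<in>{A}. indicator B t * g B)"
  proof (rule sum.mono_neutral_right)
    show "\<forall>B\<in>F - {A}. indicator B t * g B = 0"
      using assms unfolding family_def by (auto simp: indicator_def dest: disjointD)
  qed (use assms in \<open>auto simp: family_def\<close>)
  then show ?thesis
    using assms(3) by simp
qed

lemma family_sum_indicator':
  assumes "t \<notin> \<Union>F"
  shows "(\<Sum>B\<in>F. indicator B t * g B) = (0 :: real)"
  using assms by (intro sum.neutral) (auto simp: indicator_def)

lemma simple_on_indicator:
  assumes x: "simple_on F x" and F': "F' \<subseteq> F"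
  shows "simple_on F' (\<lambda>t. indicator (\<Union>F') t * x t)"
  unfolding simple_on_def
proof (intro conjI ballI allI impI)
  fix A s t assume "A \<in> F'" "s \<in> A" "t \<in> A"
  moreover from this have "s \<in> \<Union>F'" "t \<in> \<Union>F'" "x s = x t"
    using x F' unfolding simple_on_def by blast+
  ultimately show "indicator (\<Union>F') s * x s = indicator (\<Union>F') t * x t"
    by simp
qed simp

definition cell_value :: "('a \<Rightarrow> real) \<Rightarrow> 'a set \<Rightarrow> real" where
  "cell_value x A = x (SOME t. t \<in> A)"

lemma cell_value_eq:
  assumes "simple_on F x" "A \<in> F" "t \<in> A"
  shows "x t = cell_value x A"
  using assms someI[of "\<lambda>t. t \<in> A" t] unfolding simple_on_def cell_value_def by blast

lemma simple_on_expand: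
  assumes "family M F" "simple_on F x"
  shows "x = (\<lambda>t. \<Sum>A\<in>F. indicator A t * cell_value x A)"
proof
  fix t
  show "x t = (\<Sum>A\<in>F. indicator A t * cell_value x A)"
  proof (cases "t \<in> \<Union>F")
    case True
    then obtain A where "A \<in> F" "t \<in> A"
      by auto
    then show ?thesis
      using family_sum_indicator[OF assms(1)] cell_value_eq[OF assms(2)] by metis
  next
    case False
    then show ?thesis
      using assms(2) family_sum_indicator'[OF False] by (simp add: simple_on_def)
  qed
qed

lemma cell_indicator_L2: "cell M A \<Longrightarrow> indicator A \<in> L2 M"
  by (auto simp: cell_def L2_def power2_eq_square simp flip: indicator_inter_arith)

lemma norm_L2_indicator: "A \<in> sets M \<Longrightarrow> norm_L2 M (indicator A) = sqrt (measure M A)"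
  by (simp add: norm_L2_def power2_eq_square flip: indicator_inter_arith)

lemma simple_on_L2:
  assumes "family M F" "simple_on F x"
  shows "x \<in> L2 M"
proof -
  have "(\<lambda>t. \<Sum>A\<in>F. cell_value x A * indicator A t) \<in> L2 M"
    by (intro L2_sum L2_cmult cell_indicator_L2 family_cell[OF assms(1)])
  then show ?thesis
    by (subst simple_on_expand[OF assms]) (simp add: mult.commute)
qed

context L2_centralizer
begin

lemma \<Omega>_indicator:
  assumes "x \<in> L2 M" "A \<in> sets M"
  shows "(\<lambda>t. \<Omega> (\<lambda>s. indicator A s * x s) t - indicator A t * \<Omega> x t) \<in> L2 M"
    "norm_L2 M (\<lambda>t. \<Omega> (\<lambda>s. indicator A s * x s) t - indicator A t * \<Omega> x t) \<le> C * norm_L2 M x"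
  using \<Omega>_mult[OF assms(1), of "indicator A" 1] assms(2) by (simp_all add: indicator_def)

text \<open>For \<open>x\<close> constant on the cells, homogeneity suggests
  \<open>\<Omega> (indicator A)\<close> as the multiplier on \<open>A\<close>; \<open>dev\<close> is
  what multiplication by it leaves of \<open>\<Omega> x\<close>.\<close>

definition dev :: "'a set set \<Rightarrow> ('a \<Rightarrow> real) \<Rightarrow> 'a \<Rightarrow> real" where
  "dev F x t = (\<Sum>A\<in>F. indicator A t * (\<Omega> x t - x t * \<Omega> (indicator A) t))"

definition dev_bound :: "'a set set \<Rightarrow> real \<Rightarrow> bool" where
  "dev_bound F a \<longleftrightarrow> (\<forall>x. simple_on F x \<longrightarrow> norm_L2 M (dev F x) \<le> a * norm_L2 M x)"

text \<open>On \<open>A\<close> the function \<open>x\<close> is a constant multiple of the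
  indicator, so by homogeneity this term is, up to sign, the centralizer defect of multiplying
  \<open>x\<close> by \<open>indicator A\<close>, seen on \<open>A\<close> only.\<close>

lemma dev_cell:
  assumes F: "family M F" "simple_on F x" "A \<in> F"
  shows "(\<lambda>t. indicator A t * (\<Omega> x t - x t * \<Omega> (indicator A) t)) \<in> L2 M"
    "norm_L2 M (\<lambda>t. indicator A t * (\<Omega> x t - x t * \<Omega> (indicator A) t)) \<le> C * norm_L2 M x"
proof -
  note x = simple_on_L2[OF F(1,2)]
  note A = family_cell[OF F(1,3)]
  note [measurable] = cell_sets[OF A] measurable_\<Omega>[OF x] measurable_\<Omega>[OF cell_indicator_L2[OF A]] L2_measurable[OF x]
  let ?c = "cell_value x A"
  have eq: "(\<lambda>s. indicator A s * x s) = (\<lambda>s. ?c * indicator A s)"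
    using cell_value_eq[OF F(2,3)] by (auto simp: fun_eq_iff indicator_def)
  have h: "AE t in M. \<Omega> (\<lambda>s. indicator A s * x s) t = ?c * \<Omega> (indicator A) t"
    unfolding eq by (rule \<Omega>_cmult) (rule cell_indicator_L2[OF A])
  have le: "AE t in M. \<bar>indicator A t * (\<Omega> x t - x t * \<Omega> (indicator A) t)\<bar> \<le>
      \<bar>\<Omega> (\<lambda>s. indicator A s * x s) t - indicator A t * \<Omega> x t\<bar>"
    using h
  proof eventually_elim
    case (elim t)
    then show ?case
      using cell_value_eq[OF F(2,3), of t] by (cases "t \<in> A") (auto simp: abs_minus_commute)
  qed
  show "(\<lambda>t. indicator A t * (\<Omega> x t - x t * \<Omega> (indicator A) t)) \<in> L2 M"
    by (rule L2_dominated(1)[OF \<Omega>_indicator(1)[OF x cell_sets[OF A]] _ le]) measurable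
  show "norm_L2 M (\<lambda>t. indicator A t * (\<Omega> x t - x t * \<Omega> (indicator A) t)) \<le> C * norm_L2 M x"
    by (rule order_trans[OF L2_dominated(2)[OF \<Omega>_indicator(1)[OF x cell_sets[OF A]] _ le]
          \<Omega>_indicator(2)[OF x cell_sets[OF A]]]) measurable
qed

lemma dev_L2:
  assumes "family M F" "simple_on F x"
  shows "dev F x \<in> L2 M"
  unfolding dev_def[abs_def] by (intro L2_sum dev_cell(1)[OF assms])

lemma norm_L2_sum:
  assumes "\<And>i. i \<in> I \<Longrightarrow> f i \<in> L2 M"
  shows "norm_L2 M (\<lambda>t. \<Sum>i\<in>I. f i t) \<le> (\<Sum>i\<in>I. norm_L2 M (f i))"
  using assms
proof (induction I rule: infinite_finite_induct)
  case (insert i I)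
  have "norm_L2 M (\<lambda>t. f i t + (\<Sum>i\<in>I. f i t)) \<le> norm_L2 M (f i) + norm_L2 M (\<lambda>t. \<Sum>i\<in>I. f i t)"
    by (intro norm_L2_triangle L2_sum insert.prems) auto
  then show ?case
    using insert by (simp add: insert.IH order_trans)
qed auto

text \<open>This crude bound is the finite starting value for the iteration in
  \<open>dev_bound_uniform\<close>.\<close>

lemma dev_bound_card:
  assumes "family M F"
  shows "dev_bound F (real (card F) * C)"
  unfolding dev_bound_def
proof (intro allI impI)
  fix x assume x: "simple_on F x"
  have "norm_L2 M (dev F x) \<le> (\<Sum>A\<in>F. norm_L2 M (\<lambda>t. indicator A t * (\<Omega> x t - x t * \<Omega> (indicator A) t)))"
    unfolding dev_def[abs_def] by (intro norm_L2_sum dev_cell(1)[OF assms x])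
  also have "\<dots> \<le> (\<Sum>A\<in>F. C * norm_L2 M x)"
    by (intro sum_mono dev_cell(2)[OF assms x])
  finally show "norm_L2 M (dev F x) \<le> real (card F) * C * norm_L2 M x"
    by simp
qed

lemma dev_eq:
  assumes "family M F" "A \<in> F" "t \<in> A"
  shows "dev F x t = \<Omega> x t - x t * \<Omega> (indicator A) t"
  unfolding dev_def by (rule family_sum_indicator[OF assms])

lemma dev_eq_0: "t \<notin> \<Union>F \<Longrightarrow> dev F x t = 0"
  unfolding dev_def by (rule family_sum_indicator')

text \<open>One \<open>C\<close> pays for the part of the deviation on \<open>P\<close>, the other
  for replacing \<open>x\<close> by its restriction to the remaining cells, which is a centralizer
  defect.\<close>

lemma dev_bound_remove:
  assumes F: "family M F" and P: "P \<in> F" and b: "dev_bound (F - {P}) a" and a: "0 \<le> a"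
  shows "dev_bound F (a + 2 * C)"
  unfolding dev_bound_def
proof (intro allI impI)
  fix x assume x: "simple_on F x"
  let ?F = "F - {P}"
  define U where "U = \<Union>?F"
  have F': "family M ?F"
    using F by (rule family_subset) auto
  have U: "U \<in> sets M"
    unfolding U_def by (rule family_Union_sets[OF F'])
  define y where "y = (\<lambda>t. indicator U t * x t)"
  have y: "simple_on ?F y"
    unfolding y_def U_def by (rule simple_on_indicator[OF x]) auto
  note xL = simple_on_L2[OF F x]
  have y_le: "norm_L2 M y \<le> norm_L2 M x"
    unfolding y_def by (rule L2_indicator_mult(2)[OF xL U])
  define g1 where "g1 = (\<lambda>t. indicator P t * (\<Omega> x t - x t * \<Omega> (indicator P) t))"
  define g2 where "g2 = (\<lambda>t. indicator U t * (\<Omega> y t - indicator U t * \<Omega> x t))"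
  have g1: "g1 \<in> L2 M" "norm_L2 M g1 \<le> C * norm_L2 M x"
    using dev_cell[OF F x P] by (auto simp: g1_def)
  have g2: "g2 \<in> L2 M" "norm_L2 M g2 \<le> C * norm_L2 M x"
    using L2_indicator_mult[OF \<Omega>_indicator(1)[OF xL U] U] \<Omega>_indicator(2)[OF xL U]
    unfolding g2_def y_def by auto
  have "dev F x = (\<lambda>t. dev ?F y t + (g1 t - g2 t))"
  proof
    fix t
    have "dev F x t = g1 t + dev ?F x t"
      unfolding dev_def g1_def using F P by (subst sum.remove[of _ P]) (auto simp: family_def)
    moreover have "dev ?F x t = dev ?F y t - g2 t"
    proof (cases "t \<in> U")
      case True
      then obtain A where A: "A \<in> ?F" "t \<in> A"
        by (auto simp: U_def)
      show ?thesis
        using True by (simp add: dev_eq[OF F' A] g2_def y_def)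
    next
      case False
      then show ?thesis
        by (simp add: dev_eq_0 U_def[symmetric] g2_def)
    qed
    ultimately show "dev F x t = dev ?F y t + (g1 t - g2 t)"
      by simp
  qed
  then have "norm_L2 M (dev F x) \<le> norm_L2 M (dev ?F y) + norm_L2 M (\<lambda>t. g1 t - g2 t)"
    using norm_L2_triangle[OF dev_L2[OF F' y] L2_diff[OF g1(1) g2(1)]] by simp
  also have "norm_L2 M (dev ?F y) \<le> a * norm_L2 M y"
    using b y by (auto simp: dev_bound_def)
  also have "a * norm_L2 M y \<le> a * norm_L2 M x"
    using a y_le by (rule mult_left_mono[rotated])
  also have "norm_L2 M (\<lambda>t. g1 t - g2 t) \<le> 2 * C * norm_L2 M x"
    using norm_L2_triangle_diff[OF g1(1) g2(1)] g1(2) g2(2) by simp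
  finally show "norm_L2 M (dev F x) \<le> (a + 2 * C) * norm_L2 M x"
    by (simp add: algebra_simps)
qed

end

section \<open>Local triviality\<close>

lemma L2_tendsto_AE_subseq:
  assumes f: "\<And>n. f n \<in> L2 M" and g: "g \<in> L2 M"
    and lim: "(\<lambda>n. norm_L2 M (\<lambda>t. f n t - g t)) \<longlonglongrightarrow> 0"
  obtains r where "AE t in M. (\<lambda>n. f (r n) t) \<longlonglongrightarrow> g t"
proof -
  have Cauchy: "\<exists>N. \<forall>m\<ge>N. \<forall>n\<ge>N. norm_L2 M (\<lambda>t. f m t - f n t) \<le> e" if e: "e > 0" for e
  proof -
    obtain N where N: "\<And>n. n \<ge> N \<Longrightarrow> norm_L2 M (\<lambda>t. f n t - g t) < e / 2"
      using order_tendstoD(2)[OF lim, of "e / 2"] e unfolding eventually_sequentially by auto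
    have "norm_L2 M (\<lambda>t. f m t - f n t) \<le> e" if "m \<ge> N" "n \<ge> N" for m n
      using norm_L2_triangle3[OF f[of m] g f[of n]] N[OF that(1)] N[OF that(2)]
        norm_L2_minus_commute[of M g "f n"] by simp
    then show ?thesis
      by blast
  qed
  obtain h r where h: "h \<in> L2 M" "(\<lambda>n. norm_L2 M (\<lambda>t. f n t - h t)) \<longlonglongrightarrow> 0"
    and r: "AE t in M. (\<lambda>n. f (r n) t) \<longlonglongrightarrow> h t"
    using L2_complete[OF f Cauchy] by blast
  have "norm_L2 M (\<lambda>t. g t - h t) \<le> 0"
  proof (rule LIMSEQ_le_const)
    show "(\<lambda>n. norm_L2 M (\<lambda>t. f n t - g t) + norm_L2 M (\<lambda>t. f n t - h t)) \<longlonglongrightarrow> 0"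
      using tendsto_add[OF lim h(2)] by simp
    show "\<exists>N. \<forall>n\<ge>N. norm_L2 M (\<lambda>t. g t - h t) \<le> norm_L2 M (\<lambda>t. f n t - g t) + norm_L2 M (\<lambda>t. f n t - h t)"
      using norm_L2_triangle3[OF g f h(1)] norm_L2_minus_commute[of M g "f _"] by auto
  qed
  then have "norm_L2 M (\<lambda>t. g t - h t) = 0"
    by (rule antisym) simp
  then have "AE t in M. g t - h t = 0"
    using norm_L2_eq_0_iff[OF L2_diff[OF g h(1)]] by simp
  with r have "AE t in M. (\<lambda>n. f (r n) t) \<longlonglongrightarrow> g t"
    by eventually_elim simp
  then show thesis
    by (rule that)
qed

section \<open>Rounding to powers of two and countable partitions\<close>

definition dyadic_level :: "real \<Rightarrow> nat" where
  "dyadic_level r = (if r = 0 then 0 else Suc (to_nat \<lfloor>log 2 \<bar>r\<bar>\<rfloor>))"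

definition dyadic_step :: "nat \<Rightarrow> real" where
  "dyadic_step n = (case n of 0 \<Rightarrow> 0 | Suc m \<Rightarrow> 2 powr (real_of_int (from_nat m)))"

lemma measurable_dyadic_level [measurable]: "dyadic_level \<in> borel \<rightarrow>\<^sub>M count_space UNIV"
  unfolding dyadic_level_def[abs_def] by measurable

lemma dyadic_step_nonneg: "0 \<le> dyadic_step n"
  by (simp add: dyadic_step_def split: nat.split)

lemma dyadic_step_bounds:
  "dyadic_step (dyadic_level r) \<le> \<bar>r\<bar>" "\<bar>r\<bar> \<le> 2 * dyadic_step (dyadic_level r)"
  "r \<noteq> 0 \<Longrightarrow> 0 < dyadic_step (dyadic_level r)"
proof -
  have "2 powr (of_int \<lfloor>log 2 \<bar>r\<bar>\<rfloor>) \<le> \<bar>r\<bar> \<and> \<bar>r\<bar> \<le> 2 * 2 powr (of_int \<lfloor>log 2 \<bar>r\<bar>\<rfloor>)" if "r \<noteq> 0"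
  proof
    have r: "2 powr (log 2 \<bar>r\<bar>) = \<bar>r\<bar>"
      using that by simp
    have "2 powr (of_int \<lfloor>log 2 \<bar>r\<bar>\<rfloor>) \<le> 2 powr (log 2 \<bar>r\<bar>)"
      by (intro powr_mono) auto
    then show "2 powr (of_int \<lfloor>log 2 \<bar>r\<bar>\<rfloor>) \<le> \<bar>r\<bar>"
      using r by simp
    have "2 powr (log 2 \<bar>r\<bar>) \<le> 2 powr (1 + of_int \<lfloor>log 2 \<bar>r\<bar>\<rfloor>)"
      by (intro powr_mono) linarith+
    then show "\<bar>r\<bar> \<le> 2 * 2 powr (of_int \<lfloor>log 2 \<bar>r\<bar>\<rfloor>)"
      using r by (simp add: powr_add)
  qed
  then show "dyadic_step (dyadic_level r) \<le> \<bar>r\<bar>" "\<bar>r\<bar> \<le> 2 * dyadic_step (dyadic_level r)"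
    "r \<noteq> 0 \<Longrightarrow> 0 < dyadic_step (dyadic_level r)"
    by (auto simp: dyadic_step_def dyadic_level_def)
qed

text \<open>Pairing the level of a new function with the label already present, by
  \<open>prod_encode\<close>, refines the partition and keeps it indexed by
  \<open>nat\<close>.\<close>

lemma common_dyadic_partition:
  assumes "finite X" "X \<subseteq> borel_measurable M"
  shows "\<exists>q \<in> M \<rightarrow>\<^sub>M count_space UNIV. \<forall>x\<in>X. \<exists>l. \<forall>t. dyadic_level (x t) = l (q t :: nat)"
  using assms
proof (induction X rule: finite_induct)
  case empty
  then show ?case
    by (intro bexI[of _ "\<lambda>_. 0"]) auto
next
  case (insert x X)
  then obtain q where q: "q \<in> M \<rightarrow>\<^sub>M count_space UNIV" "\<And>y. y \<in> X \<Longrightarrow> \<exists>l. \<forall>t. dyadic_level (y t) = l (q t :: nat)"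
    by auto
  have [measurable]: "x \<in> borel_measurable M"
    using insert.prems by auto
  define q' where "q' t = prod_encode (q t, dyadic_level (x t))" for t
  have r: "(\<lambda>t. dyadic_level (x t)) \<in> M \<rightarrow>\<^sub>M count_space UNIV"
    by measurable
  have "q' \<in> M \<rightarrow>\<^sub>M count_space UNIV"
    unfolding q'_def[abs_def]
    by (rule measurable_compose_countable[OF _ q(1)],
        rule measurable_compose_countable[OF _ r]) simp
  moreover have "\<exists>l. \<forall>t. dyadic_level (y t) = l (q' t)" if y: "y \<in> insert x X" for y
  proof (cases "y = x")
    case True
    then show ?thesis
      by (intro exI[of _ "\<lambda>n. snd (prod_decode n)"]) (simp add: q'_def)
  next
    case False
    then obtain l where "\<forall>t. dyadic_level (y t) = l (q t)"
      using q(2) y by auto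
    then show ?thesis
      by (intro exI[of _ "\<lambda>n. l (fst (prod_decode n))"]) (simp add: q'_def)
  qed
  ultimately show ?case
    by blast
qed

text \<open>Dividing by such a weight recovers a multiplier from its product with an
  \<open>L2\<close> function, also when constants are not square-integrable.\<close>

lemma (in sigma_finite_measure) L2_positive:
  obtains \<phi> where "\<phi> \<in> L2 M" "\<And>t. t \<in> space M \<Longrightarrow> \<phi> t > 0"
proof -
  obtain h where h: "h \<in> borel_measurable M" "integral\<^sup>N M h \<noteq> \<infinity>" "\<And>t. t \<in> space M \<Longrightarrow> 0 < h t \<and> h t < \<infinity>"
    using Ex_finite_integrable_function by blast
  note [measurable] = h(1)
  define \<phi> where "\<phi> t = sqrt (enn2real (h t))" for t
  have "integrable M (\<lambda>t. (\<phi> t)\<^sup>2)"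
  proof (rule integrableI_nonneg)
    have "(\<integral>\<^sup>+t. ennreal ((\<phi> t)\<^sup>2) \<partial>M) = integral\<^sup>N M h"
      by (intro nn_integral_cong) (use h(3) in \<open>simp add: \<phi>_def\<close>)
    then show "(\<integral>\<^sup>+t. ennreal ((\<phi> t)\<^sup>2) \<partial>M) < \<infinity>"
      using h(2) by (simp add: less_top)
  qed (auto simp: \<phi>_def)
  then have "\<phi> \<in> L2 M"
    by (simp add: L2_def \<phi>_def[abs_def])
  moreover have "\<phi> t > 0" if "t \<in> space M" for t
    using h(3)[OF that] by (simp add: \<phi>_def enn2real_positive_iff)
  ultimately show thesis
    by (rule that)
qed

context L2_centralizer
begin

text \<open>Here \<open>k\<close> is \<open>\<Omega>(1\<^sub>A) / 1\<^sub>A\<close> on every fibre \<open>A\<close> of \<open>q\<close> in \<open>E\<close>.\<close>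

lemma multiplier_of_partition:
  assumes E: "E \<in> sets M" and a: "0 \<le> a"
    and bound: "\<And>F. family M F \<Longrightarrow> \<Union>F \<subseteq> E \<Longrightarrow> dev_bound F a"
    and q: "q \<in> M \<rightarrow>\<^sub>M count_space (UNIV :: nat set)"
    and fin: "\<And>i. emeasure M {t\<in>space M. q t = i} < \<infinity>"
  obtains k where "k \<in> borel_measurable M"
    "\<And>\<sigma>. (\<lambda>t. \<sigma> (q t)) \<in> L2 M \<Longrightarrow>
      (\<lambda>t. indicator E t * (\<Omega> (\<lambda>t. \<sigma> (q t)) t - k t * \<sigma> (q t))) \<in> L2 M \<and>
      norm_L2 M (\<lambda>t. indicator E t * (\<Omega> (\<lambda>t. \<sigma> (q t)) t - k t * \<sigma> (q t))) \<le> (a + C) * norm_L2 M (\<lambda>t. \<sigma> (q t))"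
proof -
  note [measurable] = E q
  define A where "A i = {t\<in>E. q t = i}" for i
  have A_sets [measurable]: "A i \<in> sets M" for i
  proof -
    have "A i = E \<inter> {t\<in>space M. q t = i}"
      using sets.sets_into_space[OF E] by (auto simp: A_def)
    then show ?thesis by simp
  qed
  have A_fin: "emeasure M (A i) < \<infinity>" for i
    using sets.sets_into_space[OF E]
    by (intro le_less_trans[OF emeasure_mono fin[of i]]) (auto simp: A_def)
  have A_L2: "indicator (A i) \<in> L2 M" for i
    using A_fin by (auto simp: L2_def power2_eq_square simp flip: indicator_inter_arith)
  define k where "k t = \<Omega> (indicator (A (q t))) t" for t
  have k [measurable]: "k \<in> borel_measurable M"
    unfolding k_def[abs_def]
    by (rule measurable_compose_countable[OF measurable_\<Omega>[OF A_L2] q])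
  \<comment> \<open>A family is finite and its cells have positive measure, so the fibres enter in
    finite stages and null fibres are omitted; almost every point of \<open>E\<close> is reached,
    and Fatou passes to the limit.\<close>
  define F where "F n = A ` {i. i < n \<and> 0 < measure M (A i)}" for n
  have F: "family M (F n)" for n
    unfolding family_def
  proof (intro conjI ballI)
    show "finite (F n)"
      by (simp add: F_def)
    show "disjoint (F n)"
      by (rule disjointI) (auto simp: F_def A_def)
    show "cell M B" if "B \<in> F n" for B
      using that A_sets A_fin by (auto simp: F_def cell_def)
  qed
  have FE: "\<Union>(F n) \<subseteq> E" for n
    by (auto simp: F_def A_def)
  have F_A: "A (q t) \<in> F n \<and> t \<in> A (q t)" if "t \<in> \<Union>(F n)" for t n
    using that by (auto simp: F_def A_def)
  have exhaust: "AE t in M. t \<in> E \<longrightarrow> (\<forall>\<^sub>F n in sequentially. t \<in> \<Union>(F n))"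
  proof -
    have "AE t in M. t \<notin> A i" if "measure M (A i) = 0" for i
      using that A_fin[of i] by (intro AE_not_in) (auto simp: null_sets_def measure_def enn2real_eq_0_iff)
    then have "AE t in M. \<forall>i. measure M (A i) = 0 \<longrightarrow> t \<notin> A i"
      by (subst AE_all_countable) auto
    then show ?thesis
    proof eventually_elim
      case (elim t)
      show ?case
      proof
        assume "t \<in> E"
        then have t: "t \<in> A (q t)"
          by (simp add: A_def)
        then have "0 < measure M (A (q t))"
          using elim by (auto simp: less_le)
        then have "t \<in> \<Union>(F n)" if "q t < n" for n
          using t that by (auto simp: F_def)
        then show "\<forall>\<^sub>F n in sequentially. t \<in> \<Union>(F n)"
          using eventually_gt_at_top[of "q t"] by (rule eventually_mono[rotated])
      qed
    qed
  qed
  show thesis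
  proof (rule that[OF k])
    fix \<sigma> assume s: "(\<lambda>t. \<sigma> (q t)) \<in> L2 M"
    define s where "s = (\<lambda>t. \<sigma> (q t))"
    have sL: "s \<in> L2 M"
      using s by (simp add: s_def)
    note [measurable] = L2_measurable[OF sL] measurable_\<Omega>[OF sL]
    define g where "g n t = indicator (\<Union>(F n)) t * (\<Omega> s t - k t * s t)" for n t
    have g: "g n \<in> L2 M \<and> norm_L2 M (g n) \<le> (a + C) * norm_L2 M s" for n
    proof -
      let ?U = "\<Union>(F n)"
      have U: "?U \<in> sets M"
        by (rule family_Union_sets[OF F])
      define y where "y = (\<lambda>t. indicator ?U t * s t)"
      have y: "simple_on (F n) y"
        unfolding simple_on_def y_def s_def by (auto simp: F_def A_def indicator_def)
      define e where "e t = indicator ?U t * (\<Omega> y t - indicator ?U t * \<Omega> s t)" for t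
      have e: "e \<in> L2 M" "norm_L2 M e \<le> C * norm_L2 M s"
        using L2_indicator_mult[OF \<Omega>_indicator(1)[OF sL U] U] \<Omega>_indicator(2)[OF sL U]
        unfolding e_def[abs_def] y_def by auto
      have gd: "g n = (\<lambda>t. dev (F n) y t - e t)"
      proof
        fix t
        show "g n t = dev (F n) y t - e t"
        proof (cases "t \<in> ?U")
          case True
          then show ?thesis
            using dev_eq[OF F, of "A (q t)" n t y] F_A[OF True]
            by (simp add: g_def e_def y_def k_def)
        qed (simp add: g_def dev_eq_0 e_def)
      qed
      have "norm_L2 M (dev (F n) y) \<le> a * norm_L2 M y"
        using bound[OF F FE] y by (simp add: dev_bound_def)
      also have "\<dots> \<le> a * norm_L2 M s"
        unfolding y_def by (intro mult_left_mono L2_indicator_mult(2) sL U a)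
      finally show ?thesis
        using norm_L2_triangle_diff[OF dev_L2[OF F y] e(1)] L2_diff[OF dev_L2[OF F y] e(1)] e(2)
        by (simp add: gd distrib_right)
    qed
    have lim: "AE t in M. (\<lambda>n. g n t) \<longlonglongrightarrow> indicator E t * (\<Omega> s t - k t * s t)"
      using exhaust
    proof eventually_elim
      case (elim t)
      show ?case
      proof (cases "t \<in> E")
        case True
        then have "\<forall>\<^sub>F n in sequentially. t \<in> \<Union>(F n)"
          using elim by simp
        then have "\<forall>\<^sub>F n in sequentially. g n t = indicator E t * (\<Omega> s t - k t * s t)"
          by eventually_elim (use True in \<open>simp add: g_def\<close>)
        then show ?thesis
          by (rule tendsto_eventually)
      next
        case False
        then have "t \<notin> \<Union>(F n)" for n
          using FE by blast
        then show ?thesis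
          using False by (simp add: g_def)
      qed
    qed
    have m: "(\<lambda>t. indicator E t * (\<Omega> s t - k t * s t)) \<in> borel_measurable M"
      by measurable
    note Fatou = L2_Fatou[OF conjunct1[OF g] lim m conjunct2[OF g]]
    show "(\<lambda>t. indicator E t * (\<Omega> (\<lambda>t. \<sigma> (q t)) t - k t * \<sigma> (q t))) \<in> L2 M \<and>
      norm_L2 M (\<lambda>t. indicator E t * (\<Omega> (\<lambda>t. \<sigma> (q t)) t - k t * \<sigma> (q t))) \<le> (a + C) * norm_L2 M (\<lambda>t. \<sigma> (q t))"
      using Fatou unfolding s_def by (rule conjI)
  qed
qed

section \<open>Triviality on a subset of the space\<close>

definition trivial_on :: "'a set \<Rightarrow> bool" where
  "trivial_on E \<longleftrightarrow> (\<exists>k\<in>borel_measurable M. \<exists>c. \<forall>x\<in>L2 M.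
    (\<lambda>t. indicator E t * (\<Omega> x t - k t * x t)) \<in> L2 M \<and>
    norm_L2 M (\<lambda>t. indicator E t * (\<Omega> x t - k t * x t)) \<le> c * norm_L2 M x)"

text \<open>Multiplication by \<open>k\<close> is the required linear map.\<close>

lemma trivial_on_space_imp_trivial:
  assumes "trivial_on (space M)"
  shows "trivial_centralizer M \<Omega>"
proof -
  obtain k c where k: "k \<in> borel_measurable M" and
    kc: "\<And>x. x \<in> L2 M \<Longrightarrow> (\<lambda>t. indicator (space M) t * (\<Omega> x t - k t * x t)) \<in> L2 M"
    "\<And>x. x \<in> L2 M \<Longrightarrow> norm_L2 M (\<lambda>t. indicator (space M) t * (\<Omega> x t - k t * x t)) \<le> c * norm_L2 M x"
    using assms unfolding trivial_on_def by blast
  note [measurable] = k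
  have b: "(\<lambda>t. \<Omega> x t - k t * x t) \<in> L2 M \<and> norm_L2 M (\<lambda>t. \<Omega> x t - k t * x t) \<le> c * norm_L2 M x"
    if x: "x \<in> L2 M" for x
  proof -
    note [measurable] = L2_measurable[OF x] measurable_\<Omega>[OF x]
    have m: "(\<lambda>t. \<Omega> x t - k t * x t) \<in> borel_measurable M"
      by measurable
    have ae: "AE t in M. indicator (space M) t * (\<Omega> x t - k t * x t) = \<Omega> x t - k t * x t"
      by (rule AE_I2) simp
    show ?thesis
      using L2_AE_cong[OF kc(1)[OF x] m ae] norm_L2_AE_cong[OF L2_measurable[OF kc(1)[OF x]] m ae] kc(2)[OF x]
      by simp
  qed
  show ?thesis
    unfolding trivial_centralizer_def
  proof (intro exI[of _ "\<lambda>x t. k t * x t"] conjI exI[of _ c] ballI)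
    show "L2_to M (L0 M) (\<lambda>x t. k t * x t)"
      unfolding L2_to_def ae_eq_def by (auto intro!: borel_measurable_times k L2_measurable)
    show "L2_linear M (\<lambda>x t. k t * x t)"
      unfolding L2_linear_def L2_homogeneous_def ae_eq_def by (auto simp: algebra_simps)
  qed (use b in auto)
qed

lemma trivial_on_Un:
  assumes P: "P \<in> sets M" "trivial_on P" and Q: "Q \<in> sets M" "trivial_on Q" and disj: "P \<inter> Q = {}"
  shows "trivial_on (P \<union> Q)"
proof -
  obtain k c where k: "k \<in> borel_measurable M" and
    kc: "\<And>x. x \<in> L2 M \<Longrightarrow> (\<lambda>t. indicator P t * (\<Omega> x t - k t * x t)) \<in> L2 M"
    "\<And>x. x \<in> L2 M \<Longrightarrow> norm_L2 M (\<lambda>t. indicator P t * (\<Omega> x t - k t * x t)) \<le> c * norm_L2 M x"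
    using P(2) unfolding trivial_on_def by blast
  obtain l d where l: "l \<in> borel_measurable M" and
    ld: "\<And>x. x \<in> L2 M \<Longrightarrow> (\<lambda>t. indicator Q t * (\<Omega> x t - l t * x t)) \<in> L2 M"
    "\<And>x. x \<in> L2 M \<Longrightarrow> norm_L2 M (\<lambda>t. indicator Q t * (\<Omega> x t - l t * x t)) \<le> d * norm_L2 M x"
    using Q(2) unfolding trivial_on_def by blast
  define m where "m t = (if t \<in> P then k t else l t)" for t
  have m: "m \<in> borel_measurable M"
    unfolding m_def[abs_def] using P(1) k l by measurable
  have eq: "(\<lambda>t. indicator (P \<union> Q) t * (\<Omega> x t - m t * x t)) =
      (\<lambda>t. indicator P t * (\<Omega> x t - k t * x t) + indicator Q t * (\<Omega> x t - l t * x t))" for x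
    using disj by (auto simp: fun_eq_iff m_def indicator_def)
  show ?thesis
    unfolding trivial_on_def
  proof (intro bexI[OF _ m] exI[of _ "c + d"] ballI conjI)
    fix x assume x: "x \<in> L2 M"
    show "(\<lambda>t. indicator (P \<union> Q) t * (\<Omega> x t - m t * x t)) \<in> L2 M"
      unfolding eq by (intro L2_add kc ld x)
    show "norm_L2 M (\<lambda>t. indicator (P \<union> Q) t * (\<Omega> x t - m t * x t)) \<le> (c + d) * norm_L2 M x"
      unfolding eq using norm_L2_triangle[OF kc(1)[OF x] ld(1)[OF x]] kc(2)[OF x] ld(2)[OF x]
      by (simp add: distrib_right)
  qed
qed

lemma trivial_on_empty: "trivial_on {}"
  unfolding trivial_on_def by (intro bexI[of _ "\<lambda>_. 0"] exI[of _ 0]) auto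

lemma trivial_on_Union:
  assumes "finite \<P>" "disjoint \<P>" "\<And>P. P \<in> \<P> \<Longrightarrow> P \<in> sets M \<and> trivial_on P"
  shows "trivial_on (\<Union>\<P>)"
  using assms
proof (induction \<P> rule: finite_induct)
  case empty
  then show ?case by (simp add: trivial_on_empty)
next
  case (insert P \<P>)
  have "trivial_on (P \<union> \<Union>\<P>)"
  proof (rule trivial_on_Un)
    show "trivial_on (\<Union>\<P>)"
      using insert by (auto simp: pairwise_insert)
    show "\<Union>\<P> \<in> sets M"
      using insert by (intro sets.finite_Union) auto
    show "P \<inter> \<Union>\<P> = {}"
      using insert.hyps insert.prems(1) by (auto simp: pairwise_insert disjnt_def)
  qed (use insert in auto)
  then show ?case by simp
qed

end

context L2_centralizer
begin

text \<open>
  Rounding \<open>\<bar>x\<bar>\<close> down to powers of two gives \<open>x = f s\<close> with \<open>\<bar>f\<bar> \<le> 2\<close> and \<open>s\<close> constant on the cells of a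
  countable partition, so a multiplier \<open>k\<close> for a common refinement serves finitely many \<open>x\<close> at once. The
  multipliers are parametrised by \<open>h = k \<phi> - \<Omega> \<phi> \<in> L\<^sub>2\<close> for a fixed positive \<open>\<phi>\<close>, where the
  admissible \<open>h\<close> form closed bounded convex sets.
\<close>

lemma trivial_on_if_dev_bounded:
  assumes E: "E \<in> sets M" and a: "0 \<le> a"
    and bound: "\<And>F. family M F \<Longrightarrow> \<Union>F \<subseteq> E \<Longrightarrow> dev_bound F a"
  shows "trivial_on E"
proof -
  note [measurable] = E
  obtain \<phi> where \<phi>: "\<phi> \<in> L2 M" and \<phi>_pos: "\<And>t. t \<in> space M \<Longrightarrow> \<phi> t > 0"
    using L2_positive by blast
  note [measurable] = L2_measurable[OF \<phi>] measurable_\<Omega>[OF \<phi>]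
  \<comment> \<open>With \<open>x = f s\<close> and \<open>\<bar>f\<bar> \<le> 2\<close>, the module
    estimate contributes \<open>2 * C\<close> and the multiplier estimate for \<open>s\<close>,
    scaled by \<open>f\<close>, contributes \<open>2 * (a + C)\<close>.\<close>
  define c where "c = 2 * a + 4 * C"
  define D where "D x h t = indicator E t * (\<Omega> x t - (h t + \<Omega> \<phi> t) / \<phi> t * x t)" for x h t
  \<comment> \<open>Every \<open>K x\<close> carries the same bound on the norm of \<open>h\<close>,
    since the intersection argument needs a bounded member.\<close>
  define K where "K x = {h \<in> L2 M. norm_L2 M h \<le> c * norm_L2 M \<phi> \<and> D x h \<in> L2 M \<and>
    norm_L2 M (D x h) \<le> c * norm_L2 M x}" for x
  have D_measurable: "D x h \<in> borel_measurable M" if "x \<in> L2 M" "h \<in> L2 M" for x h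
  proof -
    note [measurable] = L2_measurable[OF that(1)] measurable_\<Omega>[OF that(1)] L2_measurable[OF that(2)]
    show ?thesis
      unfolding D_def[abs_def] by measurable
  qed
  have FIP: "\<exists>h. \<forall>x\<in>J. h \<in> K x" if J: "finite J" "J \<subseteq> L2 M" for J
  proof -
    have "finite (insert \<phi> J)" "insert \<phi> J \<subseteq> borel_measurable M"
      using J \<phi> L2_measurable by auto
    then obtain q where q: "q \<in> M \<rightarrow>\<^sub>M count_space UNIV"
      and l: "\<And>x. x \<in> insert \<phi> J \<Longrightarrow> \<exists>l. \<forall>t. dyadic_level (x t) = l (q t :: nat)"
      using common_dyadic_partition[of "insert \<phi> J" M] by blast
    \<comment> \<open>This is the reason for adding \<open>\<phi>\<close> to \<open>J\<close>: a
      fibre of \<open>q\<close> lies in one dyadic level of \<open>\<phi>\<close>, where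
      \<open>\<phi>\<close> is at least a positive constant, so the fibre has finite
      measure.\<close>
    have fin: "emeasure M {t\<in>space M. q t = i} < \<infinity>" for i
    proof -
      obtain l where l: "\<And>t. dyadic_level (\<phi> t) = l (q t)"
        using l[of \<phi>] by auto
      let ?A = "{t\<in>space M. q t = i}"
      have A: "?A \<in> sets M"
        using q by measurable
      let ?c = "dyadic_step (l i)"
      show ?thesis
      proof (cases "?c = 0")
        case True
        have "?A = {}"
        proof (rule ccontr)
          assume "?A \<noteq> {}"
          then obtain t where t: "t \<in> space M" "q t = i"
            by auto
          then show False
            using dyadic_step_bounds(3)[of "\<phi> t"] \<phi>_pos[OF t(1)] l[of t] True by simp
        qed
        then have "emeasure M ?A = 0"
          by (simp only: emeasure_empty)
        then show ?thesis
          by simp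
      next
        case False
        then have c: "?c > 0"
          using dyadic_step_nonneg[of "l i"] by simp
        have "indicator ?A \<in> L2 M"
        proof (rule L2_dominated(1)[OF L2_cmult[OF \<phi>, of "1 / ?c"]])
          show "AE t in M. \<bar>indicat_real ?A t\<bar> \<le> \<bar>1 / ?c * \<phi> t\<bar>"
          proof (rule AE_I2)
            fix t assume t: "t \<in> space M"
            show "\<bar>indicat_real ?A t\<bar> \<le> \<bar>1 / ?c * \<phi> t\<bar>"
            proof (cases "q t = i")
              case True
              then have "?c \<le> \<bar>\<phi> t\<bar>"
                using dyadic_step_bounds(1)[of "\<phi> t"] l[of t] by simp
              then show ?thesis
                using c by (simp add: indicator_def abs_mult field_simps)
            qed (simp add: indicator_def)
          qed
        qed (use A in measurable)
        then have "integrable M (indicat_real ?A)"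
          by (simp add: L2_def power2_eq_square flip: indicator_inter_arith)
        then show ?thesis
          using A sets.sets_into_space[OF A] by (simp add: integrable_indicator_iff Int_absorb2)
      qed
    qed
    obtain k where k: "k \<in> borel_measurable M" and
      ks: "\<And>\<sigma>. (\<lambda>t. \<sigma> (q t)) \<in> L2 M \<Longrightarrow>
        (\<lambda>t. indicator E t * (\<Omega> (\<lambda>t. \<sigma> (q t)) t - k t * \<sigma> (q t))) \<in> L2 M \<and>
        norm_L2 M (\<lambda>t. indicator E t * (\<Omega> (\<lambda>t. \<sigma> (q t)) t - k t * \<sigma> (q t))) \<le> (a + C) * norm_L2 M (\<lambda>t. \<sigma> (q t))"
      using multiplier_of_partition[OF E a bound q fin] by blast
    have kx: "(\<lambda>t. indicator E t * (\<Omega> x t - k t * x t)) \<in> L2 M \<and>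
        norm_L2 M (\<lambda>t. indicator E t * (\<Omega> x t - k t * x t)) \<le> c * norm_L2 M x" if x: "x \<in> insert \<phi> J" for x
    proof -
      have xL: "x \<in> L2 M"
        using x \<phi> J by auto
      note [measurable] = L2_measurable[OF xL]
      obtain l where l: "\<And>t. dyadic_level (x t) = l (q t)"
        using l[OF x] by auto
      define s where "s = (\<lambda>t. dyadic_step (l (q t)))"
      have s_le: "s t \<le> \<bar>x t\<bar>" "\<bar>x t\<bar> \<le> 2 * s t" "0 \<le> s t" "x t \<noteq> 0 \<Longrightarrow> 0 < s t" for t
        using dyadic_step_bounds[of "x t"] dyadic_step_nonneg by (auto simp: s_def l)
      have [measurable]: "s \<in> borel_measurable M"
      proof -
        have "(\<lambda>t. dyadic_step (dyadic_level (x t))) \<in> borel_measurable M"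
          by measurable
        then show ?thesis
          by (simp add: s_def l)
      qed
      have s_ae: "AE t in M. \<bar>s t\<bar> \<le> \<bar>x t\<bar>"
        using s_le(1,3) by (intro AE_I2) simp
      have sL: "s \<in> L2 M" "norm_L2 M s \<le> norm_L2 M x"
        by (rule L2_dominated[OF xL _ s_ae]; measurable)+
      have ks: "(\<lambda>t. indicator E t * (\<Omega> s t - k t * s t)) \<in> L2 M"
          "norm_L2 M (\<lambda>t. indicator E t * (\<Omega> s t - k t * s t)) \<le> (a + C) * norm_L2 M s"
        using ks[of "\<lambda>n. dyadic_step (l n)"] sL(1) by (auto simp: s_def)
      define f where "f t = x t / s t" for t
      have f: "f \<in> borel_measurable M"
        unfolding f_def[abs_def] by measurable
      have f_le: "\<bar>f t\<bar> \<le> 2" for t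
        using s_le(2,3)[of t] by (cases "s t = 0") (auto simp: f_def field_simps)
      have fs: "(\<lambda>t. f t * s t) = x"
      proof
        fix t
        show "f t * s t = x t"
          using s_le(4)[of t] by (cases "x t = 0") (auto simp: f_def)
      qed
      have m: "(\<lambda>t. \<Omega> x t - f t * \<Omega> s t) \<in> L2 M" "norm_L2 M (\<lambda>t. \<Omega> x t - f t * \<Omega> s t) \<le> C * 2 * norm_L2 M s"
        using \<Omega>_mult[OF sL(1) f f_le, simplified] unfolding fs by auto
      note m' = L2_indicator_mult[OF m(1) E]
      note n = L2_mult_bounded[OF ks(1) f f_le]
      have eq: "(\<lambda>t. indicator E t * (\<Omega> x t - k t * x t)) =
          (\<lambda>t. indicator E t * (\<Omega> x t - f t * \<Omega> s t) + f t * (indicator E t * (\<Omega> s t - k t * s t)))"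
      proof
        fix t
        have "x t = f t * s t"
          using fun_cong[OF fs, of t] by simp
        then show "indicator E t * (\<Omega> x t - k t * x t) =
          indicator E t * (\<Omega> x t - f t * \<Omega> s t) + f t * (indicator E t * (\<Omega> s t - k t * s t))"
          by (cases "t \<in> E") (simp_all add: algebra_simps)
      qed
      have "norm_L2 M (\<lambda>t. indicator E t * (\<Omega> x t - k t * x t)) \<le> C * 2 * norm_L2 M s + 2 * ((a + C) * norm_L2 M s)"
        unfolding eq using norm_L2_triangle[OF m'(1) n(1)] m'(2) m(2) n(2) ks(2) by linarith
      also have "\<dots> = c * norm_L2 M s"
        by (simp add: c_def algebra_simps)
      also have "\<dots> \<le> c * norm_L2 M x"
        using a C_nonneg by (intro mult_left_mono sL) (auto simp: c_def)
      finally show ?thesis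
        using L2_add[OF m'(1) n(1)] unfolding eq by blast
    qed
    \<comment> \<open>On \<open>E\<close> this makes \<open>(h + \<Omega> \<phi>) / \<phi>\<close>
      equal to \<open>k\<close>; the norm of \<open>h\<close> is controlled because \<open>k\<close>
      serves \<open>\<phi>\<close> as well.\<close>
    define h where "h t = - (indicator E t * (\<Omega> \<phi> t - k t * \<phi> t))" for t
    have hL: "h \<in> L2 M" "norm_L2 M h \<le> c * norm_L2 M \<phi>"
      using kx[of \<phi>] unfolding h_def[abs_def] by auto
    have "D x h = (\<lambda>t. indicator E t * (\<Omega> x t - k t * x t))" for x
    proof
      fix t
      show "D x h t = indicator E t * (\<Omega> x t - k t * x t)"
      proof (cases "t \<in> E")
        case True
        then have "\<phi> t \<noteq> 0"
          using \<phi>_pos[of t] sets.sets_into_space[OF E] by auto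
        then show ?thesis
          using True by (simp add: D_def h_def)
      qed (simp add: D_def)
    qed
    then have "h \<in> K x" if "x \<in> J" for x
      using kx[of x] that hL by (simp add: K_def)
    then show ?thesis
      by blast
  qed
  have "\<exists>h. \<forall>x\<in>L2 M. h \<in> K x"
  proof (rule L2_convex_finite_intersection[where M = M and \<iota> = \<phi> and b = "c * norm_L2 M \<phi>"])
    show "K x \<subseteq> L2 M" for x
      by (auto simp: K_def)
    show "norm_L2 M h \<le> c * norm_L2 M \<phi>" if "h \<in> K \<phi>" for h
      using that by (simp add: K_def)
    have half: "norm_L2 M (\<lambda>t. (f t + g t) / 2) \<le> r \<and> (\<lambda>t. (f t + g t) / 2) \<in> L2 M"
      if "f \<in> L2 M" "g \<in> L2 M" "norm_L2 M f \<le> r" "norm_L2 M g \<le> r" for f g r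
      using norm_L2_cmult[of M "1/2" "\<lambda>t. f t + g t"] norm_L2_triangle[OF that(1,2)] that(3,4)
        L2_cmult[OF L2_add[OF that(1,2)], of "1/2"] by simp
    show "(\<lambda>t. (g t + h t) / 2) \<in> K x" if gh: "g \<in> K x" "h \<in> K x" for x g h
    proof -
      have "D x (\<lambda>t. (g t + h t) / 2) = (\<lambda>t. (D x g t + D x h t) / 2)"
        by (simp add: D_def fun_eq_iff add_divide_distrib algebra_simps)
      then show ?thesis
        using half[of g h "c * norm_L2 M \<phi>"] half[of "D x g" "D x h" "c * norm_L2 M x"] gh
        by (simp add: K_def)
    qed
    show "g \<in> K x" if x: "x \<in> L2 M" and f: "\<And>n::nat. f n \<in> K x" and g: "g \<in> L2 M"
      and lim: "(\<lambda>n. norm_L2 M (\<lambda>t. f n t - g t)) \<longlonglongrightarrow> 0" for x f g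
    proof -
      have fL: "f n \<in> L2 M" "norm_L2 M (f n) \<le> c * norm_L2 M \<phi>" "D x (f n) \<in> L2 M"
        "norm_L2 M (D x (f n)) \<le> c * norm_L2 M x" for n
        using f[of n] by (auto simp: K_def)
      obtain r where r: "AE t in M. (\<lambda>n. f (r n) t) \<longlonglongrightarrow> g t"
        using L2_tendsto_AE_subseq[OF fL(1) g lim] by blast
      \<comment> \<open>Dividing by \<open>\<phi>\<close> and multiplying by \<open>x\<close> may be
        unbounded on \<open>L2\<close>, so \<open>D x\<close> is only known to be continuous
        pointwise; closedness goes through almost everywhere convergence and Fatou.\<close>
      have "AE t in M. (\<lambda>n. D x (f (r n)) t) \<longlonglongrightarrow> D x g t"
        using r
      proof eventually_elim
        case (elim t)
        show ?case
          unfolding D_def divide_inverse by (intro tendsto_intros elim)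
      qed
      note 1 = L2_Fatou[OF fL(3) this D_measurable[OF x g] fL(4)]
      note 2 = L2_Fatou[OF fL(1) r L2_measurable[OF g] fL(2)]
      show ?thesis
        unfolding K_def using 1 2 by blast
    qed
  qed (use \<phi> FIP in auto)
  then obtain h where h: "\<And>x. x \<in> L2 M \<Longrightarrow> h \<in> K x"
    by blast
  have hL: "h \<in> L2 M"
    using h[OF \<phi>] by (simp add: K_def)
  show ?thesis
    unfolding trivial_on_def
  proof (intro bexI[of _ "\<lambda>t. (h t + \<Omega> \<phi> t) / \<phi> t"] exI[of _ c] ballI)
    show "(\<lambda>t. (h t + \<Omega> \<phi> t) / \<phi> t) \<in> borel_measurable M"
      using L2_measurable[OF hL] by measurable
    fix x assume "x \<in> L2 M"
    then show "(\<lambda>t. indicator E t * (\<Omega> x t - (h t + \<Omega> \<phi> t) / \<phi> t * x t)) \<in> L2 M \<and>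
      norm_L2 M (\<lambda>t. indicator E t * (\<Omega> x t - (h t + \<Omega> \<phi> t) / \<phi> t * x t)) \<le> c * norm_L2 M x"
      using h[of x] unfolding K_def D_def[abs_def] by blast
  qed
qed

section \<open>Splitting off families by a gliding hump\<close>

lemma dev_bound_empty: "0 \<le> a \<Longrightarrow> dev_bound {} a"
  by (simp add: dev_bound_def dev_def[abs_def])

lemma dev_bound_mono:
  assumes "dev_bound F a" "a \<le> b"
  shows "dev_bound F b"
  using assms unfolding dev_bound_def by (meson mult_right_mono norm_L2_nonneg order_trans)

text \<open>
  One of the finitely many pieces \<open>E - \<Union>F\<close>, \<open>A \<in> F\<close> is again not trivial; dropping it
  from \<open>F\<close>, and one or two more cells to reach even size, costs little.
\<close>

lemma nontrivial_split:
  fixes a :: real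
  assumes E: "E \<in> sets M" "\<not> trivial_on E" and a: "0 \<le> a"
  obtains E' F z where "E' \<in> sets M" "\<not> trivial_on E'" "E' \<subseteq> E" "family M F" "even (card F)"
    "\<not> dev_bound F a" "cell M z" "\<Union>F \<subseteq> E" "z \<subseteq> E" "E' \<inter> \<Union>F = {}" "E' \<inter> z = {}" "z \<inter> \<Union>F = {}"
proof -
  \<comment> \<open>\<open>6 * C\<close> pays for up to three removals at \<open>2 * C\<close> each:
    the surviving piece, the spare cell \<open>z\<close>, and one cell for parity.\<close>
  have "\<exists>F0. family M F0 \<and> \<Union>F0 \<subseteq> E \<and> \<not> dev_bound F0 (a + 6 * C)"
  proof (rule ccontr)
    assume "\<not> ?thesis"
    then have "dev_bound F (a + 6 * C)" if "family M F" "\<Union>F \<subseteq> E" for F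
      using that by blast
    moreover have "0 \<le> a + 6 * C"
      using a C_nonneg by linarith
    ultimately have "trivial_on E"
      using trivial_on_if_dev_bounded[OF E(1)] by blast
    then show False
      using E(2) by simp
  qed
  then obtain F0 where F0: "family M F0" "\<Union>F0 \<subseteq> E" "\<not> dev_bound F0 (a + 6 * C)"
    by (elim exE conjE) (rule that)
  have disj0: "disjoint F0"
    using F0(1) by (simp add: family_def)
  \<comment> \<open>Multipliers on finitely many disjoint pieces would glue to a multiplier on
    \<open>E\<close>.\<close>
  have "\<exists>P \<in> insert (E - \<Union>F0) F0. \<not> trivial_on P"
  proof (rule ccontr)
    assume "\<not> ?thesis"
    then have triv: "trivial_on P" if "P \<in> insert (E - \<Union>F0) F0" for P
      using that by blast
    have "trivial_on (\<Union>(insert (E - \<Union>F0) F0))"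
    proof (rule trivial_on_Union)
      show "finite (insert (E - \<Union>F0) F0)"
        using F0(1) by (simp add: family_def)
      show "disjoint (insert (E - \<Union>F0) F0)"
        using disj0 by (auto simp: pairwise_insert disjnt_def)
      show "P \<in> sets M \<and> trivial_on P" if "P \<in> insert (E - \<Union>F0) F0" for P
        using triv[OF that] that E(1) family_Union_sets[OF F0(1)] F0(1)
        by (auto simp: family_def cell_def)
    qed
    moreover have "\<Union>(insert (E - \<Union>F0) F0) = E"
      using F0(2) by auto
    ultimately show False
      using E(2) by simp
  qed
  then obtain P where P: "P \<in> insert (E - \<Union>F0) F0" "\<not> trivial_on P"
    by blast
  have P_sets: "P \<in> sets M" and PE: "P \<subseteq> E"
    using P(1) E(1) family_Union_sets[OF F0(1)] F0 by (auto simp: family_def cell_def)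
  define F1 where "F1 = F0 - {P}"
  have F1: "family M F1" "F1 \<subseteq> F0"
    using family_subset[OF F0(1)] by (auto simp: F1_def)
  have F1_b: "\<not> dev_bound F1 (a + 4 * C)"
  proof (cases "P \<in> F0")
    case True
    then show ?thesis
      using dev_bound_remove[OF F0(1) True, of "a + 4 * C"] F0(3) a C_nonneg
      by (auto simp: F1_def algebra_simps)
  next
    case False
    then show ?thesis
      using F0(3) dev_bound_mono[of F0 "a + 4 * C" "a + 6 * C"] C_nonneg by (auto simp: F1_def)
  qed
  have PF1: "P \<inter> A = {}" if "A \<in> F1" for A
  proof (cases "P \<in> F0")
    case True
    then show ?thesis
      using disj0 that by (auto simp: F1_def dest: disjointD)
  next
    case False
    then show ?thesis
      using P(1) that by (auto simp: F1_def)
  qed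
  have "F1 \<noteq> {}"
    using F1_b dev_bound_empty[of "a + 4 * C"] a C_nonneg by auto
  then obtain z where z: "z \<in> F1"
    by blast
  define F2 where "F2 = F1 - {z}"
  have F2: "family M F2" "F2 \<subseteq> F1"
    using family_subset[OF F1(1)] by (auto simp: F2_def)
  have F2_b: "\<not> dev_bound F2 (a + 2 * C)"
    using dev_bound_remove[OF F1(1) z, of "a + 2 * C"] F1_b a C_nonneg
    by (auto simp: F2_def algebra_simps)
  have "\<exists>F3 \<subseteq> F2. \<not> dev_bound F3 a \<and> even (card F3)"
  proof (cases "even (card F2)")
    case True
    then show ?thesis
      using F2_b dev_bound_mono[of F2 a "a + 2 * C"] C_nonneg by auto
  next
    case False
    have "F2 \<noteq> {}"
      using False by auto
    then obtain y where y: "y \<in> F2"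
      by blast
    have "\<not> dev_bound (F2 - {y}) a"
      using dev_bound_remove[OF F2(1) y, of a] F2_b a by auto
    moreover have "even (card (F2 - {y}))"
      using False y family_finite[OF F2(1)] by (simp add: card_Diff_singleton)
    ultimately show ?thesis
      by blast
  qed
  then obtain F3 where F3: "F3 \<subseteq> F2" "\<not> dev_bound F3 a" "even (card F3)"
    by blast
  show thesis
  proof (rule that[of P F3 z])
    show "family M F3"
      by (rule family_subset[OF F2(1) F3(1)])
    show "cell M z"
      by (rule family_cell[OF F1(1) z])
    show "\<Union>F3 \<subseteq> E" "z \<subseteq> E"
      using F3(1) F2(2) F1(2) F0(2) z by blast+
    show "P \<inter> \<Union>F3 = {}" "P \<inter> z = {}"
      using F3(1) F2(2) PF1 z by blast+
    show "z \<inter> \<Union>F3 = {}"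
    proof -
      have "z \<inter> A = {}" if "A \<in> F3" for A
        using that F3(1) F2(2) F1(2) z disj0 by (intro disjointD[OF disj0]) (auto simp: F2_def)
      then show ?thesis
        by blast
    qed
  qed (use P P_sets PE F3 in auto)
qed

text \<open>The split is repeated inside the surviving set \<open>E'\<close>, which misses
  everything chosen before, with threshold \<open>n\<close> at stage \<open>n\<close>. The cells
  \<open>z n\<close> reserve infinitely many basis vectors outside the families.\<close>

lemma nontrivial_families:
  assumes nontriv: "\<not> trivial_centralizer M \<Omega>"
  obtains F :: "nat \<Rightarrow> 'a set set" and z :: "nat \<Rightarrow> 'a set" where
    "\<And>n. family M (F n)" "\<And>n. even (card (F n))" "\<And>n. \<not> dev_bound (F n) (real n)"
    "\<And>n. cell M (z n)" "\<And>n. z n \<notin> F n"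
    "\<And>m n A B. m \<noteq> n \<Longrightarrow> A \<in> insert (z m) (F m) \<Longrightarrow> B \<in> insert (z n) (F n) \<Longrightarrow> A \<inter> B = {}"
    "\<And>n A. A \<in> F n \<Longrightarrow> A \<inter> z n = {}"
proof -
  define good where "good n p \<longleftrightarrow> (case p of (E, F, z, E') \<Rightarrow>
    E' \<in> sets M \<and> \<not> trivial_on E' \<and> E' \<subseteq> E \<and> family M F \<and> even (card F) \<and> \<not> dev_bound F (real n) \<and>
    cell M z \<and> \<Union>F \<subseteq> E \<and> z \<subseteq> E \<and> E' \<inter> \<Union>F = {} \<and> E' \<inter> z = {} \<and> z \<inter> \<Union>F = {})"
    for n :: nat and p :: "'a set \<times> 'a set set \<times> 'a set \<times> 'a set"
  have ex: "\<exists>p. good n p \<and> fst p = E" if E: "E \<in> sets M" "\<not> trivial_on E" for n E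
  proof -
    obtain E' F z where *: "E' \<in> sets M" "\<not> trivial_on E'" "E' \<subseteq> E" "family M F" "even (card F)"
        "\<not> dev_bound F (real n)" "cell M z" "\<Union>F \<subseteq> E" "z \<subseteq> E" "E' \<inter> \<Union>F = {}" "E' \<inter> z = {}" "z \<inter> \<Union>F = {}"
      by (rule nontrivial_split[OF E, of "real n"]) simp_all
    show ?thesis
      by (rule exI[of _ "(E, F, z, E')"]) (simp add: good_def *)
  qed
  have "\<exists>p. \<forall>n. good n (p n) \<and> fst (p (Suc n)) = snd (snd (snd (p n)))"
  proof (rule dependent_nat_choice)
    show "\<exists>p. good 0 p"
      using ex[of "space M" 0] nontriv trivial_on_space_imp_trivial by auto
    show "\<exists>p'. good (Suc n) p' \<and> fst p' = snd (snd (snd p))" if "good n p" for n p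
      using that ex[of "snd (snd (snd p))" "Suc n"] by (auto simp: good_def split: prod.splits)
  qed
  then obtain p where p: "\<And>n. good n (p n)" "\<And>n. fst (p (Suc n)) = snd (snd (snd (p n)))"
    by blast
  define E where "E n = fst (p n)" for n
  define F where "F n = fst (snd (p n))" for n
  define z where "z n = fst (snd (snd (p n)))" for n
  have props: "E (Suc n) \<subseteq> E n" "family M (F n)" "even (card (F n))" "\<not> dev_bound (F n) (real n)"
    "cell M (z n)" "\<Union>(F n) \<subseteq> E n" "z n \<subseteq> E n" "E (Suc n) \<inter> \<Union>(F n) = {}" "E (Suc n) \<inter> z n = {}"
    "z n \<inter> \<Union>(F n) = {}" for n
    using p(1)[of n] p(2)[of n] unfolding good_def E_def F_def z_def by (auto split: prod.splits)
  have dec: "E n \<subseteq> E m" if "m \<le> n" for m n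
    using that by (induction rule: dec_induct) (use props(1) in auto)
  have disj: "A \<inter> B = {}" if "m < n" "A \<in> insert (z m) (F m)" "B \<in> insert (z n) (F n)" for m n A B
  proof -
    have "B \<subseteq> E (Suc m)"
      using that(3) props(6,7)[of n] dec[of "Suc m" n] that(1) by auto
    moreover have "A \<inter> E (Suc m) = {}"
      using that(2) props(8,9)[of m] by auto
    ultimately show ?thesis
      by blast
  qed
  show thesis
  proof (rule that[of F z])
    show "A \<inter> B = {}" if "m \<noteq> n" "A \<in> insert (z m) (F m)" "B \<in> insert (z n) (F n)" for m n A B
      using that disj[of m n A B] disj[of n m B A] by (cases "m < n") auto
    show "z n \<notin> F n" for n
    proof
      assume "z n \<in> F n"
      then have "z n = {}"
        using props(10)[of n] by blast
      then show False
        using props(5)[of n] by (simp add: cell_def)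
    qed
    show "A \<inter> z n = {}" if "A \<in> F n" for n A
      using props(10)[of n] that by auto
  qed (use props in auto)
qed

end

section \<open>Flat skew orthogonal matrices and random signs\<close>

lemma sum_cis_root_of_unity:
  fixes m :: int
  assumes n: "n > 0"
  shows "(\<Sum>k<n. cis (2 * pi * real_of_int m * real k / real n)) = (if int n dvd m then of_nat n else 0)"
proof -
  define z where "z = cis (2 * pi * real_of_int m / real n)"
  have z: "z ^ k = cis (2 * pi * real_of_int m * real k / real n)" for k
  proof -
    have "real k * (2 * pi * real_of_int m / real n) = 2 * pi * real_of_int m * real k / real n"
      by simp
    then show ?thesis
      unfolding z_def by (subst Complex.DeMoivre) (rule arg_cong)
  qed
  have zn: "z ^ n = 1"
    using n cis_multiple_2pi[of "real_of_int m"] by (simp add: z mult_ac)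
  have z1: "z = 1 \<longleftrightarrow> int n dvd m"
  proof
    assume "z = 1"
    then have "cos (2 * pi * real_of_int m / real n) = 1"
      by (simp add: z_def complex_eq_iff)
    then obtain k :: int where "2 * pi * real_of_int m / real n = real_of_int k * 2 * pi"
      unfolding cos_one_2pi_int by blast
    then have "real_of_int m = real_of_int (int n * k)"
      using n by (simp add: field_simps)
    then show "int n dvd m"
      by (simp only: of_int_eq_iff) simp
  next
    assume "int n dvd m"
    then obtain k where "m = int n * k" ..
    then show "z = 1"
      using n cis_multiple_2pi[of "real_of_int k"] by (simp add: z_def mult_ac)
  qed
  have "(\<Sum>k<n. z ^ k) = (if int n dvd m then of_nat n else 0)"
  proof (cases "z = 1")
    case True
    then show ?thesis
      using z1 by simp
  next
    case False
    then show ?thesis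
      using z1 zn by (simp add: geometric_sum)
  qed
  then show ?thesis
    by (simp add: z)
qed

text \<open>The kernel of the discrete Hartley transform, a real and symmetric substitute for the
  Fourier matrix.\<close>

definition hartley :: "nat \<Rightarrow> nat \<Rightarrow> nat \<Rightarrow> real" where
  "hartley n j k = (cos (2 * pi * real j * real k / real n) + sin (2 * pi * real j * real k / real n)) / sqrt (real n)"

lemma hartley_sym: "hartley n j k = hartley n k j"
  by (simp add: hartley_def mult_ac)

lemma abs_hartley_le: "\<bar>hartley n j k\<bar> \<le> 2 / sqrt (real n)"
proof -
  have "\<bar>cos x + sin x\<bar> \<le> 2" for x :: real
    using abs_cos_le_one[of x] abs_sin_le_one[of x] by linarith
  then show ?thesis
    unfolding hartley_def by (simp add: abs_divide divide_right_mono)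
qed

text \<open>A product of two kernels is \<open>cos (a - b) + sin (a + b)\<close> up to the factor
  \<open>1 / n\<close>. Summed over \<open>k\<close>, the cosines and the sines are real and
  imaginary parts of sums of roots of unity, and such sums are real.\<close>

lemma hartley_orthogonal:
  assumes "j < n" "l < n"
  shows "(\<Sum>k<n. hartley n k j * hartley n k l) = (if j = l then 1 else 0)"
proof -
  define d where "d = int j - int l"
  define s where "s = int j + int l"
  have n: "n > 0"
    using assms by simp
  have cas: "(cos a + sin a) * (cos b + sin b) = cos (a - b) + sin (a + b)" for a b :: real
    by (simp add: cos_diff sin_add algebra_simps)
  have eq: "hartley n k j * hartley n k l = (cos (2 * pi * real_of_int d * real k / real n) +
      sin (2 * pi * real_of_int s * real k / real n)) / real n" for k
  proof -
    have a: "2 * pi * real k * real j / real n - 2 * pi * real k * real l / real n =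
        2 * pi * real_of_int d * real k / real n"
      by (simp add: d_def algebra_simps diff_divide_distrib)
    have b: "2 * pi * real k * real j / real n + 2 * pi * real k * real l / real n =
        2 * pi * real_of_int s * real k / real n"
      by (simp add: s_def algebra_simps add_divide_distrib)
    show ?thesis
      unfolding hartley_def times_divide_times_eq cas a b using n by simp
  qed
  have "(\<Sum>k<n. cos (2 * pi * real_of_int d * real k / real n)) =
      Re (\<Sum>k<n. cis (2 * pi * real_of_int d * real k / real n))"
    by simp
  also have "\<dots> = (if int n dvd d then real n else 0)"
    unfolding sum_cis_root_of_unity[OF n] by simp
  also have "int n dvd d \<longleftrightarrow> j = l"
  proof
    assume "int n dvd d"
    then show "j = l"
      using zdvd_imp_le[of "int n" "\<bar>d\<bar>"] assms by (cases "d = 0") (auto simp: d_def)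
  qed (simp add: d_def)
  finally have 1: "(\<Sum>k<n. cos (2 * pi * real_of_int d * real k / real n)) = (if j = l then real n else 0)" .
  have "(\<Sum>k<n. sin (2 * pi * real_of_int s * real k / real n)) =
      Im (\<Sum>k<n. cis (2 * pi * real_of_int s * real k / real n))"
    by simp
  also have "\<dots> = 0"
    unfolding sum_cis_root_of_unity[OF n] by simp
  finally have 2: "(\<Sum>k<n. sin (2 * pi * real_of_int s * real k / real n)) = 0" .
  show ?thesis
    unfolding eq sum_divide_distrib[symmetric] sum.distrib 1 2 using n by simp
qed

text \<open>\<open>F\<close> is split into two halves of size \<open>n\<close>, and a Hartley matrix
  is placed off the diagonal with opposite signs; its symmetry gives skewness. Since
  \<open>card F = 2 * n\<close>, the entry bound \<open>2 / sqrt n\<close> is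
  \<open>2 * sqrt 2 / sqrt (card F)\<close>, and \<open>2 * sqrt 2 \<le> 3\<close>.\<close>

lemma flat_skew_orthogonal_matrix:
  fixes F :: "'i set"
  assumes F: "finite F" "even (card F)"
  obtains U :: "'i \<Rightarrow> 'i \<Rightarrow> real" where
    "\<And>A B. A \<in> F \<Longrightarrow> B \<in> F \<Longrightarrow> U A B = - U B A"
    "\<And>A B. A \<in> F \<Longrightarrow> B \<in> F \<Longrightarrow> \<bar>U A B\<bar> \<le> 3 / sqrt (real (card F))"
    "\<And>B D. B \<in> F \<Longrightarrow> D \<in> F \<Longrightarrow> (\<Sum>A\<in>F. U A B * U A D) = (if B = D then 1 else 0)"
proof -
  obtain n where n: "card F = 2 * n"
    using F(2) by blast
  have "card F = card ({..<n} \<times> (UNIV :: bool set))"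
    by (simp add: n)
  then have "\<exists>f. bij_betw f F ({..<n} \<times> (UNIV :: bool set))"
    by (intro finite_same_card_bij F) simp_all
  then obtain f where f: "bij_betw f F ({..<n} \<times> (UNIV :: bool set))" ..
  define V where "V p q = (if snd p = snd q then 0 else if snd p then hartley n (fst p) (fst q)
    else - hartley n (fst p) (fst q))" for p q :: "nat \<times> bool"
  have f_lt: "fst (f A) < n" if "A \<in> F" for A
  proof -
    have "f A \<in> {..<n} \<times> UNIV"
      using bij_betw_apply[OF f that] .
    then show ?thesis
      by (cases "f A") simp
  qed
  have V_le: "\<bar>V p q\<bar> \<le> 3 / sqrt (real (card F))" for p q
  proof -
    have "\<bar>V p q\<bar> \<le> 2 / sqrt (real n)"
      using abs_hartley_le[of n "fst p" "fst q"] by (auto simp: V_def)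
    also have "\<dots> \<le> 3 / sqrt (real (card F))"
    proof (cases "n = 0")
      case False
      have "2 * sqrt (real (card F)) \<le> 3 * sqrt (real n)"
        by (rule power2_le_imp_le) (simp_all add: n power_mult_distrib)
      then show ?thesis
        using False by (simp add: n field_simps)
    qed (simp add: n)
    finally show ?thesis .
  qed
  show thesis
  proof (rule that[of "\<lambda>A B. V (f A) (f B)"])
    show "V (f A) (f B) = - V (f B) (f A)" for A B
      using hartley_sym[of n "fst (f A)" "fst (f B)"] by (auto simp: V_def)
    show "\<bar>V (f A) (f B)\<bar> \<le> 3 / sqrt (real (card F))" for A B
      by (rule V_le)
    fix B D assume BD: "B \<in> F" "D \<in> F"
    have "(\<Sum>A\<in>F. V (f A) (f B) * V (f A) (f D)) = (\<Sum>p\<in>{..<n} \<times> UNIV. V p (f B) * V p (f D))"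
      by (rule sum.reindex_bij_betw[OF f])
    also have "\<dots> = (\<Sum>i<n. \<Sum>b\<in>UNIV. V (i, b) (f B) * V (i, b) (f D))"
      by (simp add: sum.cartesian_product)
    also have "\<dots> = (\<Sum>i<n. if snd (f B) = snd (f D) then hartley n i (fst (f B)) * hartley n i (fst (f D)) else 0)"
      by (intro sum.cong refl) (auto simp: V_def UNIV_bool)
    also have "\<dots> = (if f B = f D then 1 else 0)"
      using hartley_orthogonal[OF f_lt[OF BD(1)] f_lt[OF BD(2)]]
      by (cases "snd (f B) = snd (f D)") (auto simp: prod_eq_iff)
    also have "f B = f D \<longleftrightarrow> B = D"
      using bij_betw_imp_inj_on[OF f] BD by (auto dest: inj_onD)
    finally show "(\<Sum>A\<in>F. V (f A) (f B) * V (f A) (f D)) = (if B = D then 1 else 0)" .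
  qed
qed

section \<open>Averages over random signs\<close>

definition sign_of :: "'i set \<Rightarrow> 'i \<Rightarrow> real" where
  "sign_of S i = (if i \<in> S then 1 else - 1)"

text \<open>A sign pattern is coded by the subset of \<open>F\<close> where it is positive, so
  expectations over independent signs are finite sums.\<close>

definition sign_avg :: "'i set \<Rightarrow> (('i \<Rightarrow> real) \<Rightarrow> real) \<Rightarrow> real" where
  "sign_avg F f = (\<Sum>S\<in>Pow F. f (sign_of S)) / 2 ^ card F"

lemma abs_sign_of [simp]: "\<bar>sign_of S i\<bar> = 1"
  by (simp add: sign_of_def)

lemma sign_of_square [simp]: "sign_of S i * sign_of S i = 1"
  by (simp add: sign_of_def)

lemma sign_avg_const: "finite F \<Longrightarrow> sign_avg F (\<lambda>_. c) = c"
  by (simp add: sign_avg_def card_Pow)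

lemma sign_avg_add: "sign_avg F (\<lambda>\<epsilon>. f \<epsilon> + g \<epsilon>) = sign_avg F f + sign_avg F g"
  by (simp add: sign_avg_def sum.distrib add_divide_distrib)

lemma sign_avg_diff: "sign_avg F (\<lambda>\<epsilon>. f \<epsilon> - g \<epsilon>) = sign_avg F f - sign_avg F g"
  by (simp add: sign_avg_def sum_subtractf diff_divide_distrib)

lemma sign_avg_cmult: "sign_avg F (\<lambda>\<epsilon>. c * f \<epsilon>) = c * sign_avg F f"
  by (simp add: sign_avg_def sum_distrib_left)

lemma sign_avg_sum: "sign_avg F (\<lambda>\<epsilon>. \<Sum>i\<in>I. f i \<epsilon>) = (\<Sum>i\<in>I. sign_avg F (f i))"
  unfolding sign_avg_def by (subst sum.swap) (simp add: sum_divide_distrib)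

lemma sign_avg_mono: "(\<And>S. S \<subseteq> F \<Longrightarrow> f (sign_of S) \<le> g (sign_of S)) \<Longrightarrow> sign_avg F f \<le> sign_avg F g"
  unfolding sign_avg_def by (intro divide_right_mono sum_mono) auto

lemma sign_avg_cong: "(\<And>S. S \<subseteq> F \<Longrightarrow> f (sign_of S) = g (sign_of S)) \<Longrightarrow> sign_avg F f = sign_avg F g"
  unfolding sign_avg_def by (intro arg_cong2[where f = "(/)"] sum.cong) auto

text \<open>Toggling the membership of \<open>i\<close> reverses the sign at \<open>i\<close> and no
  other, so for \<open>i \<noteq> j\<close> the sum equals its own negative.\<close>

lemma sign_avg_pair:
  assumes F: "finite F" "i \<in> F"
  shows "sign_avg F (\<lambda>\<epsilon>. \<epsilon> i * \<epsilon> j) = (if i = j then 1 else 0)"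
proof (cases "i = j")
  case True
  have "sign_avg F (\<lambda>\<epsilon>. \<epsilon> i * \<epsilon> j) = sign_avg F (\<lambda>_. 1)"
    using True by (intro sign_avg_cong) simp
  then show ?thesis
    using True sign_avg_const[OF F(1)] by simp
next
  case False
  let ?flip = "\<lambda>S. if i \<in> S then S - {i} else insert i S"
  have "(\<Sum>S\<in>Pow F. sign_of S i * sign_of S j) = (\<Sum>S\<in>Pow F. - (sign_of S i * sign_of S j))"
    by (rule sum.reindex_bij_witness[of _ ?flip ?flip])
      (use F(2) False in \<open>auto simp: sign_of_def split: if_splits\<close>)
  then have "(\<Sum>S\<in>Pow F. sign_of S i * sign_of S j) = 0"
    by (simp add: sum_negf)
  then show ?thesis
    using False by (simp add: sign_avg_def)
qed

lemma sign_avg_bilinear: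
  assumes F: "finite F"
  shows "sign_avg F (\<lambda>\<epsilon>. \<Sum>i\<in>F. \<Sum>j\<in>F. \<epsilon> i * \<epsilon> j * a i j) = (\<Sum>i\<in>F. a i i)"
proof -
  have "sign_avg F (\<lambda>\<epsilon>. \<Sum>i\<in>F. \<Sum>j\<in>F. \<epsilon> i * \<epsilon> j * a i j) =
      (\<Sum>i\<in>F. \<Sum>j\<in>F. a i j * sign_avg F (\<lambda>\<epsilon>. \<epsilon> i * \<epsilon> j))"
    unfolding sign_avg_sum by (intro sum.cong refl) (simp add: mult.commute[of _ "a _ _"] sign_avg_cmult)
  also have "\<dots> = (\<Sum>i\<in>F. \<Sum>j\<in>F. if i = j then a i j else 0)"
    by (intro sum.cong refl) (simp add: sign_avg_pair F)
  finally show ?thesis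
    using F by simp
qed

lemma sign_avg_square:
  assumes F: "finite F"
  shows "sign_avg F (\<lambda>\<epsilon>. (\<Sum>i\<in>F. \<epsilon> i * a i)\<^sup>2) = (\<Sum>i\<in>F. (a i)\<^sup>2)"
proof -
  have "sign_avg F (\<lambda>\<epsilon>. (\<Sum>i\<in>F. \<epsilon> i * a i)\<^sup>2) = sign_avg F (\<lambda>\<epsilon>. \<Sum>i\<in>F. \<Sum>j\<in>F. \<epsilon> i * \<epsilon> j * (a i * a j))"
    by (simp add: power2_eq_square sum_product mult_ac)
  then show ?thesis
    using sign_avg_bilinear[OF F, of "\<lambda>i j. a i * a j"] by (simp add: power2_eq_square)
qed

text \<open>Nonnegativity of the variance.\<close>

lemma sign_avg_Jensen:
  assumes F: "finite F"
  shows "(sign_avg F f)\<^sup>2 \<le> sign_avg F (\<lambda>\<epsilon>. (f \<epsilon>)\<^sup>2)"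
proof -
  define m where "m = sign_avg F f"
  have "sign_avg F (\<lambda>_. 0) \<le> sign_avg F (\<lambda>\<epsilon>. (f \<epsilon>)\<^sup>2 - 2 * m * f \<epsilon> + m\<^sup>2)"
  proof (rule sign_avg_mono)
    fix S
    have "0 \<le> (f (sign_of S) - m)\<^sup>2"
      by simp
    then show "0 \<le> (f (sign_of S))\<^sup>2 - 2 * m * f (sign_of S) + m\<^sup>2"
      by (simp add: power2_diff algebra_simps)
  qed
  also have "\<dots> = sign_avg F (\<lambda>\<epsilon>. (f \<epsilon>)\<^sup>2) - m\<^sup>2"
    unfolding sign_avg_add sign_avg_diff sign_avg_cmult
    by (simp add: sign_avg_const F m_def power2_eq_square)
  finally show ?thesis
    by (simp add: m_def sign_avg_const F)
qed

lemma sign_avg_le_sqrt: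
  assumes "finite F" "sign_avg F (\<lambda>\<epsilon>. (f \<epsilon>)\<^sup>2) \<le> c\<^sup>2" "0 \<le> c"
  shows "sign_avg F f \<le> c"
  by (rule power2_le_imp_le[OF order_trans[OF sign_avg_Jensen[OF assms(1)] assms(2)] assms(3)])

text \<open>Khintchine's inequality for the fourth moment. Averaging over the sign of the new
  element leaves \<open>s ^ 4 + 6 * (a i)\<^sup>2 * s\<^sup>2 + (a i) ^ 4\<close>, and with the
  constant 3 the bound completes to the square
  \<open>3 * ((a i)\<^sup>2 + Q)\<^sup>2\<close>.\<close>

lemma sign_avg_fourth_power:
  assumes F: "finite F"
  shows "sign_avg F (\<lambda>\<epsilon>. (\<Sum>i\<in>F. \<epsilon> i * a i) ^ 4) \<le> 3 * (\<Sum>i\<in>F. (a i)\<^sup>2)\<^sup>2"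
  using F
proof (induction F rule: finite_induct)
  case (insert i F)
  define s where "s S = (\<Sum>j\<in>F. sign_of S j * a j)" for S
  define Q where "Q = (\<Sum>j\<in>F. (a j)\<^sup>2)"
  have eq: "(\<Sum>j\<in>insert i F. sign_of S j * a j) = s S - a i"
    "(\<Sum>j\<in>insert i F. sign_of (insert i S) j * a j) = s S + a i" if "S \<in> Pow F" for S
  proof -
    have "(\<Sum>j\<in>F. sign_of (insert i S) j * a j) = s S"
      unfolding s_def using insert.hyps(2) by (intro sum.cong) (auto simp: sign_of_def)
    then show "(\<Sum>j\<in>insert i F. sign_of S j * a j) = s S - a i"
      "(\<Sum>j\<in>insert i F. sign_of (insert i S) j * a j) = s S + a i"
      using insert.hyps that by (auto simp: sign_of_def s_def)
  qed
  have inj: "inj_on (insert i) (Pow F)"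
    using insert.hyps(2) by (auto simp: inj_on_def)
  have "(\<Sum>S\<in>Pow (insert i F). (\<Sum>j\<in>insert i F. sign_of S j * a j) ^ 4) =
      (\<Sum>S\<in>Pow F. (\<Sum>j\<in>insert i F. sign_of S j * a j) ^ 4) +
      (\<Sum>S\<in>insert i ` Pow F. (\<Sum>j\<in>insert i F. sign_of S j * a j) ^ 4)"
    unfolding Pow_insert using insert.hyps by (intro sum.union_disjoint) auto
  also have "\<dots> = (\<Sum>S\<in>Pow F. (s S - a i) ^ 4 + (s S + a i) ^ 4)"
    unfolding sum.reindex[OF inj] sum.distrib by (intro arg_cong2[where f = "(+)"] sum.cong) (simp_all only: eq o_def)
  also have "\<dots> = (\<Sum>S\<in>Pow F. 2 * ((s S) ^ 4 + 6 * (a i)\<^sup>2 * (s S)\<^sup>2 + (a i) ^ 4))"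
    by (intro sum.cong refl) (simp add: power2_eq_square power4_eq_xxxx algebra_simps)
  finally have "sign_avg (insert i F) (\<lambda>\<epsilon>. (\<Sum>j\<in>insert i F. \<epsilon> j * a j) ^ 4) =
      sign_avg F (\<lambda>\<epsilon>. (\<Sum>j\<in>F. \<epsilon> j * a j) ^ 4 + 6 * (a i)\<^sup>2 * (\<Sum>j\<in>F. \<epsilon> j * a j)\<^sup>2 + (a i) ^ 4)"
    unfolding sign_avg_def s_def sum_distrib_left[symmetric] using insert.hyps by simp
  also have "\<dots> = sign_avg F (\<lambda>\<epsilon>. (\<Sum>j\<in>F. \<epsilon> j * a j) ^ 4) + 6 * (a i)\<^sup>2 * Q + (a i) ^ 4"
    unfolding sign_avg_add sign_avg_cmult sign_avg_square[OF insert.hyps(1)] Q_def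
    by (simp add: sign_avg_const insert.hyps)
  also have "\<dots> \<le> 3 * Q\<^sup>2 + 6 * (a i)\<^sup>2 * Q + 3 * (a i) ^ 4"
  proof -
    have "0 \<le> (a i) ^ 4"
      by (rule zero_le_even_power) simp
    then show ?thesis
      using insert.IH unfolding Q_def by linarith
  qed
  also have "\<dots> = 3 * ((a i)\<^sup>2 + Q)\<^sup>2"
    by (simp add: power2_eq_square power4_eq_xxxx algebra_simps)
  finally show ?case
    using insert.hyps by (simp add: Q_def)
qed (simp add: sign_avg_def)

lemma sign_avg_integral:
  assumes "\<And>S. S \<subseteq> F \<Longrightarrow> integrable M (g (sign_of S))"
  shows "sign_avg F (\<lambda>\<epsilon>. \<integral>t. g \<epsilon> t \<partial>M) = (\<integral>t. sign_avg F (\<lambda>\<epsilon>. g \<epsilon> t) \<partial>M)"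
proof -
  have "(\<integral>t. (\<Sum>S\<in>Pow F. g (sign_of S) t) \<partial>M) = (\<Sum>S\<in>Pow F. \<integral>t. g (sign_of S) t \<partial>M)"
    by (rule Bochner_Integration.integral_sum) (rule assms, blast)
  then show ?thesis
    unfolding sign_avg_def by (simp only: integral_divide_zero)
qed

lemma sign_avg_integrable:
  assumes "\<And>S. S \<subseteq> F \<Longrightarrow> integrable M (g (sign_of S))"
  shows "integrable M (\<lambda>t. sign_avg F (\<lambda>\<epsilon>. g \<epsilon> t))"
proof -
  have "integrable M (\<lambda>t. \<Sum>S\<in>Pow F. g (sign_of S) t)"
    by (rule Bochner_Integration.integrable_sum) (rule assms, blast)
  then show ?thesis
    unfolding sign_avg_def by (rule integrable_divide_zero)
qed

section \<open>Complex structures from orthonormal bases\<close>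

text \<open>\<open>G\<close> acts as the graph of an isometry with square \<open>-1\<close> on a
  dense subspace, and \<open>P\<close> is its closure. Isometry yields both the existence of limits
  and uniqueness almost everywhere, so any choice of representatives for \<open>u\<close> is
  compatible with equality almost everywhere.\<close>

lemma complex_structure_from_dense_graph:
  fixes M :: "'a measure" and G :: "(('a \<Rightarrow> real) \<times> ('a \<Rightarrow> real)) set"
  assumes L: "\<And>x y. (x, y) \<in> G \<Longrightarrow> x \<in> L2 M \<and> y \<in> L2 M"
    and add: "\<And>x y x' y'. (x, y) \<in> G \<Longrightarrow> (x', y') \<in> G \<Longrightarrow> (\<lambda>t. x t + x' t, \<lambda>t. y t + y' t) \<in> G"
    and scale: "\<And>x y c. (x, y) \<in> G \<Longrightarrow> (\<lambda>t. c * x t, \<lambda>t. c * y t) \<in> G"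
    and iso: "\<And>x y. (x, y) \<in> G \<Longrightarrow> norm_L2 M y = norm_L2 M x"
    and rot: "\<And>x y. (x, y) \<in> G \<Longrightarrow> (y, \<lambda>t. - x t) \<in> G"
    and dense: "\<And>x e. x \<in> L2 M \<Longrightarrow> e > 0 \<Longrightarrow> \<exists>(v, w)\<in>G. norm_L2 M (\<lambda>t. x t - v t) < e"
  obtains u where "complex_structure M u" "\<And>x. x \<in> L2 M \<Longrightarrow> norm_L2 M (u x) = norm_L2 M x"
    "\<And>x y. (x, y) \<in> G \<Longrightarrow> AE t in M. u x t = y t"
proof -
  define P where "P x y \<longleftrightarrow> x \<in> L2 M \<and> y \<in> L2 M \<and>
    (\<forall>e>0. \<exists>v w. (v, w) \<in> G \<and> norm_L2 M (\<lambda>t. x t - v t) < e \<and> norm_L2 M (\<lambda>t. y t - w t) < e)" for x y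
  have P_L2: "x \<in> L2 M" "y \<in> L2 M" if "P x y" for x y
    using that by (auto simp: P_def)
  have P_D: "\<exists>v w. (v, w) \<in> G \<and> norm_L2 M (\<lambda>t. x t - v t) < e \<and> norm_L2 M (\<lambda>t. y t - w t) < e"
    if "P x y" "e > 0" for x y e
    using that by (simp add: P_def)
  have G_P: "P x y" if "(x, y) \<in> G" for x y
    using that L[OF that] unfolding P_def by (intro conjI allI impI exI[of _ x] exI[of _ y]) auto
  have P_add: "P (\<lambda>t. x t + x' t) (\<lambda>t. y t + y' t)" if P: "P x y" and P': "P x' y'" for x y x' y'
    unfolding P_def
  proof (intro conjI allI impI L2_add P_L2[OF P] P_L2[OF P'])
    fix e :: real assume "e > 0"
    then have e: "e / 2 > 0"
      by simp
    obtain v w where vw: "(v, w) \<in> G" "norm_L2 M (\<lambda>t. x t - v t) < e / 2" "norm_L2 M (\<lambda>t. y t - w t) < e / 2"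
      using P_D[OF P e] by blast
    obtain v' w' where vw': "(v', w') \<in> G" "norm_L2 M (\<lambda>t. x' t - v' t) < e / 2" "norm_L2 M (\<lambda>t. y' t - w' t) < e / 2"
      using P_D[OF P' e] by blast
    have le: "norm_L2 M (\<lambda>t. f t + f' t - (g t + g' t)) < e"
      if "f \<in> L2 M" "f' \<in> L2 M" "g \<in> L2 M" "g' \<in> L2 M"
        "norm_L2 M (\<lambda>t. f t - g t) < e / 2" "norm_L2 M (\<lambda>t. f' t - g' t) < e / 2" for f f' g g'
    proof -
      have "(\<lambda>t. f t + f' t - (g t + g' t)) = (\<lambda>t. (f t - g t) + (f' t - g' t))"
        by (simp add: fun_eq_iff)
      then show ?thesis
        using norm_L2_triangle[OF L2_diff[OF that(1,3)] L2_diff[OF that(2,4)]] that(5,6) by simp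
    qed
    show "\<exists>v w. (v, w) \<in> G \<and> norm_L2 M (\<lambda>t. x t + x' t - v t) < e \<and> norm_L2 M (\<lambda>t. y t + y' t - w t) < e"
      using add[OF vw(1) vw'(1)] L[OF vw(1)] L[OF vw'(1)] vw vw' P_L2[OF P] P_L2[OF P']
      by (intro exI[of _ "\<lambda>t. v t + v' t"] exI[of _ "\<lambda>t. w t + w' t"] conjI le) auto
  qed
  have P_scale: "P (\<lambda>t. c * x t) (\<lambda>t. c * y t)" if P: "P x y" for x y c
    unfolding P_def
  proof (intro conjI allI impI L2_cmult P_L2[OF P])
    fix e :: real assume e: "e > 0"
    have e': "e / (\<bar>c\<bar> + 1) > 0"
      using e by simp
    obtain v w where vw: "(v, w) \<in> G" "norm_L2 M (\<lambda>t. x t - v t) < e / (\<bar>c\<bar> + 1)"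
        "norm_L2 M (\<lambda>t. y t - w t) < e / (\<bar>c\<bar> + 1)"
      using P_D[OF P e'] by blast
    have le: "norm_L2 M (\<lambda>t. c * f t - c * g t) < e" if "norm_L2 M (\<lambda>t. f t - g t) < e / (\<bar>c\<bar> + 1)" for f g
    proof -
      have "norm_L2 M (\<lambda>t. c * f t - c * g t) = \<bar>c\<bar> * norm_L2 M (\<lambda>t. f t - g t)"
        using norm_L2_cmult[of M c "\<lambda>t. f t - g t"] by (simp add: right_diff_distrib)
      also have "\<dots> \<le> (\<bar>c\<bar> + 1) * norm_L2 M (\<lambda>t. f t - g t)"
        by (intro mult_right_mono) auto
      also have "\<dots> < e"
        using that by (simp add: field_simps)
      finally show ?thesis .
    qed
    show "\<exists>v w. (v, w) \<in> G \<and> norm_L2 M (\<lambda>t. c * x t - v t) < e \<and> norm_L2 M (\<lambda>t. c * y t - w t) < e"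
      by (intro exI conjI) (rule scale[OF vw(1)] le vw)+
  qed
  have P_rot: "P y (\<lambda>t. - x t)" if P: "P x y" for x y
    unfolding P_def
  proof (intro conjI allI impI L2_uminus P_L2[OF P])
    fix e :: real assume "e > 0"
    then obtain v w where vw: "(v, w) \<in> G" "norm_L2 M (\<lambda>t. x t - v t) < e" "norm_L2 M (\<lambda>t. y t - w t) < e"
      using P_D[OF P] by blast
    have "norm_L2 M (\<lambda>t. - x t - - v t) = norm_L2 M (\<lambda>t. x t - v t)"
      using norm_L2_minus_commute[of M v x] by simp
    then show "\<exists>v w. (v, w) \<in> G \<and> norm_L2 M (\<lambda>t. y t - v t) < e \<and> norm_L2 M (\<lambda>t. - x t - w t) < e"
      using rot[OF vw(1)] vw(2,3) by (intro exI[of _ w] exI[of _ "\<lambda>t. - v t"]) simp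
  qed
  have P_iso: "norm_L2 M y = norm_L2 M x" if P: "P x y" for x y
  proof -
    have "\<bar>norm_L2 M y - norm_L2 M x\<bar> \<le> 0"
    proof (rule field_le_epsilon)
      fix e :: real assume "e > 0"
      then have e: "e / 2 > 0"
        by simp
      obtain v w where vw: "(v, w) \<in> G" "norm_L2 M (\<lambda>t. x t - v t) < e / 2" "norm_L2 M (\<lambda>t. y t - w t) < e / 2"
        using P_D[OF P e] by blast
      have "\<bar>norm_L2 M x - norm_L2 M v\<bar> < e / 2" "\<bar>norm_L2 M y - norm_L2 M w\<bar> < e / 2"
        using norm_L2_dist[OF P_L2(1)[OF P] conjunct1[OF L[OF vw(1)]]] vw(2)
          norm_L2_dist[OF P_L2(2)[OF P] conjunct2[OF L[OF vw(1)]]] vw(3) by linarith+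
      then show "\<bar>norm_L2 M y - norm_L2 M x\<bar> \<le> 0 + e"
        using iso[OF vw(1)] by linarith
    qed
    then show ?thesis
      by simp
  qed
  have P_unique: "AE t in M. y t = y' t" if P: "P x y" and P': "P x' y'" and ae: "AE t in M. x t = x' t" for x y x' y'
  proof -
    have Pd: "P (\<lambda>t. x t + - 1 * x' t) (\<lambda>t. y t + - 1 * y' t)"
      by (rule P_add[OF P P_scale[OF P']])
    have "norm_L2 M (\<lambda>t. x t + - 1 * x' t) = 0"
      using ae by (subst norm_L2_eq_0_iff[OF P_L2(1)[OF Pd]]) auto
    then have "norm_L2 M (\<lambda>t. y t + - 1 * y' t) = 0"
      using P_iso[OF Pd] by simp
    then have "AE t in M. y t + - 1 * y' t = 0"
      by (subst (asm) norm_L2_eq_0_iff[OF P_L2(2)[OF Pd]])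
    then show ?thesis
      by eventually_elim simp
  qed
  have P_ex: "\<exists>y. P x y" if x: "x \<in> L2 M" for x
  proof -
    have "\<forall>n. \<exists>p. p \<in> G \<and> norm_L2 M (\<lambda>t. x t - fst p t) < 1 / real (Suc n)"
    proof
      fix n
      have "(0::real) < 1 / real (Suc n)"
        by simp
      from dense[OF x this] show "\<exists>p. p \<in> G \<and> norm_L2 M (\<lambda>t. x t - fst p t) < 1 / real (Suc n)"
        by auto
    qed
    then obtain p where p: "\<And>n. p n \<in> G" "\<And>n. norm_L2 M (\<lambda>t. x t - fst (p n) t) < 1 / real (Suc n)"
      by metis
    define v where "v n = fst (p n)" for n
    define w where "w n = snd (p n)" for n
    have vw: "(v n, w n) \<in> G" "norm_L2 M (\<lambda>t. x t - v n t) < 1 / real (Suc n)" for n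
      using p[of n] by (auto simp: v_def w_def)
    have vL: "v n \<in> L2 M" and wL: "w n \<in> L2 M" for n
      using L[OF vw(1)] by auto
    have small: "\<exists>N. \<forall>n\<ge>N. 1 / real (Suc n) \<le> e" if e: "e > 0" for e
    proof -
      obtain N where N: "inverse (real (Suc N)) < e"
        using reals_Archimedean[OF e] by blast
      have "1 / real (Suc n) \<le> e" if "n \<ge> N" for n
      proof -
        have "1 / real (Suc n) \<le> 1 / real (Suc N)"
          using that by (simp add: frac_le)
        then show ?thesis
          using N by (simp add: inverse_eq_divide)
      qed
      then show ?thesis
        by blast
    qed
    have w_diff: "norm_L2 M (\<lambda>t. w m t - w n t) = norm_L2 M (\<lambda>t. v m t - v n t)" for m n
      using iso[OF add[OF vw(1)[of m] scale[OF vw(1)[of n], of "- 1"]]] by simp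
    have "\<exists>N. \<forall>m\<ge>N. \<forall>n\<ge>N. norm_L2 M (\<lambda>t. w m t - w n t) \<le> e" if e: "e > 0" for e
    proof -
      obtain N where N: "\<And>n. n \<ge> N \<Longrightarrow> 1 / real (Suc n) \<le> e / 2"
        using small[of "e / 2"] e by auto
      have "norm_L2 M (\<lambda>t. w m t - w n t) \<le> e" if "m \<ge> N" "n \<ge> N" for m n
        using norm_L2_triangle3[OF vL[of m] x vL[of n]] vw(2)[of m] vw(2)[of n] N[OF that(1)] N[OF that(2)]
          norm_L2_minus_commute[of M x "v m"] w_diff[of m n] by linarith
      then show ?thesis
        by blast
    qed
    then obtain y where y: "y \<in> L2 M" "(\<lambda>n. norm_L2 M (\<lambda>t. w n t - y t)) \<longlonglongrightarrow> 0"
      using L2_complete[of w M, OF wL] by blast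
    have "P x y"
      unfolding P_def
    proof (intro conjI allI impI x y(1))
      fix e :: real assume e: "e > 0"
      obtain N where N: "\<And>n. n \<ge> N \<Longrightarrow> 1 / real (Suc n) \<le> e"
        using small[OF e] by blast
      obtain N' where N': "\<And>n. n \<ge> N' \<Longrightarrow> norm_L2 M (\<lambda>t. w n t - y t) < e"
        using order_tendstoD(2)[OF y(2) e] unfolding eventually_sequentially by blast
      let ?n = "max N N'"
      have "norm_L2 M (\<lambda>t. x t - v ?n t) < e"
        using vw(2)[of ?n] N[of ?n] by simp
      moreover have "norm_L2 M (\<lambda>t. y t - w ?n t) < e"
        using N'[of ?n] norm_L2_minus_commute[of M y "w ?n"] by simp
      ultimately show "\<exists>v w. (v, w) \<in> G \<and> norm_L2 M (\<lambda>t. x t - v t) < e \<and> norm_L2 M (\<lambda>t. y t - w t) < e"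
        using vw(1)[of ?n] by blast
    qed
    then show ?thesis
      by blast
  qed
  define u where "u x = (SOME y. P x y)" for x
  have u: "P x (u x)" if "x \<in> L2 M" for x
    unfolding u_def using P_ex[OF that] by (rule someI_ex)
  show thesis
  proof (rule that[of u])
    show norm_u: "norm_L2 M (u x) = norm_L2 M x" if "x \<in> L2 M" for x
      by (rule P_iso[OF u[OF that]])
    show "AE t in M. u x t = y t" if "(x, y) \<in> G" for x y
      using P_unique[OF u G_P[OF that]] L[OF that] by auto
    show "complex_structure M u"
      unfolding complex_structure_def L2_to_def L2_linear_def L2_homogeneous_def ae_eq_def
    proof (intro conjI ballI allI impI)
      show uL: "u x \<in> L2 M" if "x \<in> L2 M" for x
        using P_L2(2)[OF u[OF that]] .
      show "AE t in M. u x t = u y t" if "x \<in> L2 M" "y \<in> L2 M" "AE t in M. x t = y t" for x y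
        by (rule P_unique[OF u[OF that(1)] u[OF that(2)] that(3)])
      show "AE t in M. u (\<lambda>t. x t + y t) t = u x t + u y t" if "x \<in> L2 M" "y \<in> L2 M" for x y
        by (rule P_unique[OF u[OF L2_add[OF that]] P_add[OF u[OF that(1)] u[OF that(2)]]]) simp
      show "AE t in M. u (\<lambda>t. c * x t) t = c * u x t" if "x \<in> L2 M" for c x
        by (rule P_unique[OF u[OF L2_cmult[OF that]] P_scale[OF u[OF that]]]) simp
      show "AE t in M. u (u x) t = - x t" if "x \<in> L2 M" for x
        by (rule P_unique[OF u[OF uL[OF that]] P_rot[OF u[OF that]]]) simp
      show "\<exists>C. \<forall>x\<in>L2 M. norm_L2 M (u x) \<le> C * norm_L2 M x"
        using norm_u by (intro exI[of _ 1]) simp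
    qed
  qed
qed

text \<open>A relation instead of a function, so that uniqueness of coefficients need not be
  established; up to null sets, isometry makes it single-valued.\<close>

definition basis_graph :: "('a \<Rightarrow> real) set \<Rightarrow> (('a \<Rightarrow> real) \<Rightarrow> ('a \<Rightarrow> real)) \<Rightarrow> (('a \<Rightarrow> real) \<times> ('a \<Rightarrow> real)) set" where
  "basis_graph B T = {(\<lambda>t. \<Sum>b\<in>S. a b * b t, \<lambda>t. \<Sum>b\<in>S. a b * T b t) | S a. finite S \<and> S \<subseteq> B}"

lemma basis_graphI:
  assumes "finite S" "S \<subseteq> B" "x = (\<lambda>t. \<Sum>b\<in>S. a b * b t)" "y = (\<lambda>t. \<Sum>b\<in>S. a b * T b t)"
  shows "(x, y) \<in> basis_graph B T"
  unfolding basis_graph_def using assms by blast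

lemma basis_graphE:
  assumes "(x, y) \<in> basis_graph B T"
  obtains S a where "finite S" "S \<subseteq> B" "x = (\<lambda>t. \<Sum>b\<in>S. a b * b t)" "y = (\<lambda>t. \<Sum>b\<in>S. a b * T b t)"
  using assms unfolding basis_graph_def by auto

lemma basis_graph_scale:
  assumes "(x, y) \<in> basis_graph B T"
  shows "(\<lambda>t. c * x t, \<lambda>t. c * y t) \<in> basis_graph B T"
  using assms
proof (rule basis_graphE)
  fix S a assume "finite S" "S \<subseteq> B" "x = (\<lambda>t. \<Sum>b\<in>S. a b * b t)" "y = (\<lambda>t. \<Sum>b\<in>S. a b * T b t)"
  then show ?thesis
    by (intro basis_graphI[of S _ _ "\<lambda>b. c * a b"]) (auto simp: sum_distrib_left mult.assoc)
qed

lemma basis_graph_add: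
  assumes "(x, y) \<in> basis_graph B T" "(x', y') \<in> basis_graph B T"
  shows "(\<lambda>t. x t + x' t, \<lambda>t. y t + y' t) \<in> basis_graph B T"
proof -
  obtain S a where S: "finite S" "S \<subseteq> B" "x = (\<lambda>t. \<Sum>b\<in>S. a b * b t)" "y = (\<lambda>t. \<Sum>b\<in>S. a b * T b t)"
    using assms(1) by (rule basis_graphE)
  obtain S' a' where S': "finite S'" "S' \<subseteq> B" "x' = (\<lambda>t. \<Sum>b\<in>S'. a' b * b t)" "y' = (\<lambda>t. \<Sum>b\<in>S'. a' b * T b t)"
    using assms(2) by (rule basis_graphE)
  define c where "c b = (if b \<in> S then a b else 0) + (if b \<in> S' then a' b else 0)" for b
  have sum: "(\<Sum>b\<in>S. a b * g b) + (\<Sum>b\<in>S'. a' b * g b) = (\<Sum>b\<in>S \<union> S'. c b * g b)" for g :: "_ \<Rightarrow> real"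
  proof -
    have "(\<Sum>b\<in>S. a b * g b) = (\<Sum>b\<in>S \<union> S'. (if b \<in> S then a b else 0) * g b)"
      using S(1) S'(1) by (intro sum.mono_neutral_cong_left) auto
    moreover have "(\<Sum>b\<in>S'. a' b * g b) = (\<Sum>b\<in>S \<union> S'. (if b \<in> S' then a' b else 0) * g b)"
      using S(1) S'(1) by (intro sum.mono_neutral_cong_left) auto
    ultimately show ?thesis
      by (simp add: c_def distrib_right sum.distrib)
  qed
  show ?thesis
    by (rule basis_graphI[of "S \<union> S'" _ _ c]) (use S S' in \<open>auto simp: sum\<close>)
qed

lemma basis_graph_sum:
  assumes "finite I" "\<And>i. i \<in> I \<Longrightarrow> (x i, y i) \<in> basis_graph B T"
  shows "(\<lambda>t. \<Sum>i\<in>I. x i t, \<lambda>t. \<Sum>i\<in>I. y i t) \<in> basis_graph B T"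
  using assms
proof (induction I rule: finite_induct)
  case empty
  then show ?case
    by (intro basis_graphI[of "{}"]) auto
next
  case (insert i I)
  then show ?case
    using basis_graph_add[of "x i" "y i" B T "\<lambda>t. \<Sum>i\<in>I. x i t" "\<lambda>t. \<Sum>i\<in>I. y i t"] by simp
qed

lemma norm_L2_orthonormal_sum:
  assumes L: "\<And>b. b \<in> S \<Longrightarrow> f b \<in> L2 M" and S: "finite S"
    and orth: "\<And>b c. b \<in> S \<Longrightarrow> c \<in> S \<Longrightarrow> ip M (f b) (f c) = (if b = c then 1 else 0)"
  shows "(norm_L2 M (\<lambda>t. \<Sum>b\<in>S. a b * f b t))\<^sup>2 = (\<Sum>b\<in>S. (a b)\<^sup>2)"
proof -
  have sL: "(\<lambda>t. \<Sum>c\<in>S. a c * f c t) \<in> L2 M"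
    by (intro L2_sum L2_cmult L)
  have "(norm_L2 M (\<lambda>t. \<Sum>b\<in>S. a b * f b t))\<^sup>2 = (\<Sum>b\<in>S. a b * (\<Sum>c\<in>S. a c * ip M (f b) (f c)))"
    unfolding norm_L2_power2
    by (subst ip_sum_left[OF _ sL]) (auto simp: L L2_cmult ip_cmult_left ip_cmult_right ip_sum_right intro!: sum.cong)
  also have "\<dots> = (\<Sum>b\<in>S. a b * (\<Sum>c\<in>S. if b = c then a c else 0))"
    by (intro sum.cong refl arg_cong2[where f = "(*)"]) (simp add: orth)
  finally show ?thesis
    using S by (simp add: power2_eq_square)
qed

text \<open>The infinite set \<open>R = B - N\<close> is in bijection with two copies of itself,
  which pairs off its elements; \<open>T'\<close> sends the first member of a pair to the second and
  the second to minus the first. By \<open>T_perp\<close> this part stays orthogonal to the images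
  of \<open>N\<close>.\<close>

lemma complex_structure_extend_basis:
  assumes B: "orthonormal M B" and max: "\<And>B'. orthonormal M B' \<Longrightarrow> B \<subseteq> B' \<Longrightarrow> B' = B"
    and N: "N \<subseteq> B" "infinite (B - N)"
    and T_L2: "\<And>b. b \<in> N \<Longrightarrow> T b \<in> L2 M"
    and T_orth: "\<And>b c. b \<in> N \<Longrightarrow> c \<in> N \<Longrightarrow> ip M (T b) (T c) = (if b = c then 1 else 0)"
    and T_perp: "\<And>b c. b \<in> N \<Longrightarrow> c \<in> B - N \<Longrightarrow> ip M (T b) c = 0"
    and T_rot: "\<And>b. b \<in> N \<Longrightarrow> (T b, \<lambda>t. - b t) \<in> basis_graph N T"
  obtains u where "complex_structure M u" "\<And>x. x \<in> L2 M \<Longrightarrow> norm_L2 M (u x) = norm_L2 M x"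
    "\<And>b. b \<in> N \<Longrightarrow> AE t in M. u b t = T b t"
proof -
  have B_L2: "b \<in> L2 M" if "b \<in> B" for b
    using B that by (auto simp: orthonormal_def)
  have B_orth: "ip M b c = (if b = c then 1 else 0)" if "b \<in> B" "c \<in> B" for b c
    using B that by (auto simp: orthonormal_def)
  define R where "R = B - N"
  have "(card_of (R <+> R), card_of R) \<in> ordIso"
    by (rule card_of_Plus_infinite1) (use N(2) in \<open>simp_all add: R_def card_of_refl[THEN ordIso_imp_ordLeq]\<close>)
  then have "\<exists>f. bij_betw f (R <+> R) R"
    by (simp only: card_of_ordIso)
  then obtain f where f: "bij_betw f (R <+> R) R" ..
  define g where "g = inv_into (R <+> R) f"
  have g: "g c \<in> R <+> R" "f (g c) = c" if "c \<in> R" for c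
    using that f by (auto simp: g_def bij_betw_def inv_into_into f_inv_into_f)
  have gf: "g (f s) = s" if "s \<in> R <+> R" for s
    using that f by (simp add: g_def bij_betw_inv_into_left)
  have fR: "f s \<in> R" if "s \<in> R <+> R" for s
    using that f by (auto simp: bij_betw_def)
  define T' where "T' b = (if b \<in> N then T b else case g b of Inl c \<Rightarrow> f (Inr c) | Inr c \<Rightarrow> (\<lambda>t. - f (Inl c) t))" for b
  have T'_N: "T' b = T b" if "b \<in> N" for b
    using that by (simp add: T'_def)
  have T'_R: "\<exists>c\<in>R. (T' b = c \<and> T' c = (\<lambda>t. - b t)) \<or> (T' b = (\<lambda>t. - c t) \<and> T' c = b)" if b: "b \<in> R" for b
  proof (cases "g b")
    case (Inl c)
    then have c: "c \<in> R"
      using g(1)[OF b] by auto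
    have fc: "f (Inr c) \<in> R" "g (f (Inr c)) = Inr c"
      using fR gf c by auto
    have "f (Inl c) = b"
      using g(2)[OF b] Inl by simp
    then show ?thesis
      using fc Inl b by (intro bexI[of _ "f (Inr c)"]) (auto simp: T'_def R_def)
  next
    case (Inr c)
    then have c: "c \<in> R"
      using g(1)[OF b] by auto
    have fc: "f (Inl c) \<in> R" "g (f (Inl c)) = Inl c"
      using fR gf c by auto
    have "f (Inr c) = b"
      using g(2)[OF b] Inr by simp
    then show ?thesis
      using fc Inr b by (intro bexI[of _ "f (Inl c)"]) (auto simp: T'_def R_def)
  qed
  have ip_minus: "ip M (\<lambda>t. - x t) y = - ip M x y" "ip M x (\<lambda>t. - y t) = - ip M x y" for x y
    by (simp_all add: ip_def)
  have R_B: "c \<in> B" if "c \<in> R" for c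
    using that by (simp add: R_def)
  have T'_L2: "T' b \<in> L2 M" if bB: "b \<in> B" for b
  proof (cases "b \<in> N")
    case False
    then have "b \<in> R"
      using bB by (simp add: R_def)
    then obtain c where "c \<in> R" "T' b = c \<or> T' b = (\<lambda>t. - c t)"
      using T'_R by blast
    then show ?thesis
      using B_L2[OF R_B] L2_uminus[OF B_L2[OF R_B]] by metis
  qed (simp add: T'_N T_L2)
  have T'_orth_RR: "ip M (T' b) (T' c) = (if b = c then 1 else 0)" if bc: "b \<in> R" "c \<in> R" for b c
  proof -
    obtain b' where b': "b' \<in> R" "(T' b = b' \<and> T' b' = (\<lambda>t. - b t)) \<or> (T' b = (\<lambda>t. - b' t) \<and> T' b' = b)"
      using T'_R[OF bc(1)] by blast
    obtain c' where c': "c' \<in> R" "(T' c = c' \<and> T' c' = (\<lambda>t. - c t)) \<or> (T' c = (\<lambda>t. - c' t) \<and> T' c' = c)"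
      using T'_R[OF bc(2)] by blast
    \<comment> \<open>This tells apart the two positions within a pair: a basis vector that is minus
      a basis vector would have inner product \<open>-1\<close> with it.\<close>
    have nz: "d \<noteq> (\<lambda>t. - e t)" if "d \<in> R" "e \<in> R" for d e
    proof
      assume de: "d = (\<lambda>t. - e t)"
      then have "ip M d e = - 1"
        using B_orth[of e e] R_B that by (simp add: ip_minus)
      then show False
        using B_orth[of d e] R_B that by (auto split: if_splits)
    qed
    have cancel: "d = e" if "(\<lambda>t. - d t) = (\<lambda>t. - e t)" for d e :: "'a \<Rightarrow> real"
      using fun_cong[OF that] by auto
    show ?thesis
    proof (cases "b' = c'")
      case True
      have "b = c"
        using b'(2) c'(2) True nz[OF bc] nz[OF bc(2,1)] cancel by metis
      then show ?thesis
        using b' B_orth[of b' b'] R_B[OF b'(1)] by (auto simp: ip_minus)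
    next
      case False
      then have "b \<noteq> c"
        using b' c' nz cancel by metis
      then show ?thesis
        using b'(2) c'(2) False B_orth[OF R_B[OF b'(1)] R_B[OF c'(1)]] by (auto simp: ip_minus)
    qed
  qed
  have T'_orth_NR: "ip M (T' b) (T' c) = 0" if bc: "b \<in> N" "c \<in> R" for b c
  proof -
    obtain c' where "c' \<in> R" "T' c = c' \<or> T' c = (\<lambda>t. - c' t)"
      using T'_R[OF bc(2)] by blast
    then show ?thesis
      using T_perp[OF bc(1), of c'] by (auto simp: T'_N[OF bc(1)] R_def ip_minus)
  qed
  have T'_orth: "ip M (T' b) (T' c) = (if b = c then 1 else 0)" if bc: "b \<in> B" "c \<in> B" for b c
  proof -
    consider "b \<in> N" "c \<in> N" | "b \<in> N" "c \<in> R" | "b \<in> R" "c \<in> N" | "b \<in> R" "c \<in> R"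
      using bc by (auto simp: R_def)
    then show ?thesis
    proof cases
      case 2
      then show ?thesis
        using T'_orth_NR[OF 2] by (auto simp: R_def)
    next
      case 3
      then show ?thesis
        using T'_orth_NR[OF 3(2,1)] by (auto simp: R_def ip_commute)
    qed (simp_all add: T'_N T_orth T'_orth_RR)
  qed
  let ?G = "basis_graph B T'"
  have rot1: "(T' b, \<lambda>t. - b t) \<in> ?G" if b: "b \<in> B" for b
  proof (cases "b \<in> N")
    case True
    obtain S a where S: "finite S" "S \<subseteq> N" "T b = (\<lambda>t. \<Sum>c\<in>S. a c * c t)"
        "(\<lambda>t. - b t) = (\<lambda>t. \<Sum>c\<in>S. a c * T c t)"
      using T_rot[OF True] by (rule basis_graphE)
    have "(\<lambda>t. \<Sum>c\<in>S. a c * T c t) = (\<lambda>t. \<Sum>c\<in>S. a c * T' c t)"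
      using S(2) by (intro ext sum.cong) (auto simp: T'_N)
    then show ?thesis
      using S N(1) True by (intro basis_graphI[of S _ _ a]) (auto simp: T'_N)
  next
    case False
    then have "b \<in> R"
      using b by (simp add: R_def)
    then obtain c where c: "c \<in> R" "(T' b = c \<and> T' c = (\<lambda>t. - b t)) \<or> (T' b = (\<lambda>t. - c t) \<and> T' c = b)"
      using T'_R by blast
    from c(2) show ?thesis
    proof (elim disjE conjE)
      assume "T' b = c" "T' c = (\<lambda>t. - b t)"
      then show ?thesis
        using R_B[OF c(1)] by (intro basis_graphI[of "{c}" _ _ "\<lambda>_. 1"]) auto
    next
      assume "T' b = (\<lambda>t. - c t)" "T' c = b"
      then show ?thesis
        using R_B[OF c(1)] by (intro basis_graphI[of "{c}" _ _ "\<lambda>_. - 1"]) auto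
    qed
  qed
  obtain u where u: "complex_structure M u" "\<And>x. x \<in> L2 M \<Longrightarrow> norm_L2 M (u x) = norm_L2 M x"
    "\<And>x y. (x, y) \<in> ?G \<Longrightarrow> AE t in M. u x t = y t"
  proof (rule complex_structure_from_dense_graph[of ?G M])
    show "x \<in> L2 M \<and> y \<in> L2 M" if "(x, y) \<in> ?G" for x y
      using that
    proof (rule basis_graphE)
      fix S a assume "finite S" "S \<subseteq> B" "x = (\<lambda>t. \<Sum>b\<in>S. a b * b t)" "y = (\<lambda>t. \<Sum>b\<in>S. a b * T' b t)"
      moreover from this have "(\<lambda>t. \<Sum>b\<in>S. a b * b t) \<in> L2 M" "(\<lambda>t. \<Sum>b\<in>S. a b * T' b t) \<in> L2 M"
        using B_L2 T'_L2 by (intro L2_sum L2_cmult; blast)+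
      ultimately show ?thesis
        by simp
    qed
    show "norm_L2 M y = norm_L2 M x" if "(x, y) \<in> ?G" for x y
      using that
    proof (rule basis_graphE)
      fix S a assume S: "finite S" "S \<subseteq> B" "x = (\<lambda>t. \<Sum>b\<in>S. a b * b t)" "y = (\<lambda>t. \<Sum>b\<in>S. a b * T' b t)"
      have "(norm_L2 M x)\<^sup>2 = (\<Sum>b\<in>S. (a b)\<^sup>2)"
        unfolding S(3) by (rule norm_L2_orthonormal_sum) (use S(1) B_L2[OF subsetD[OF S(2)]] B_orth[OF subsetD[OF S(2)] subsetD[OF S(2)]] in simp_all)
      moreover have "(norm_L2 M y)\<^sup>2 = (\<Sum>b\<in>S. (a b)\<^sup>2)"
        unfolding S(4) by (rule norm_L2_orthonormal_sum) (use S(1) T'_L2[OF subsetD[OF S(2)]] T'_orth[OF subsetD[OF S(2)] subsetD[OF S(2)]] in simp_all)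
      ultimately show ?thesis
        by (metis norm_L2_nonneg power2_eq_imp_eq)
    qed
    show "(y, \<lambda>t. - x t) \<in> ?G" if "(x, y) \<in> ?G" for x y
      using that
    proof (rule basis_graphE)
      fix S a assume S: "finite S" "S \<subseteq> B" "x = (\<lambda>t. \<Sum>b\<in>S. a b * b t)" "y = (\<lambda>t. \<Sum>b\<in>S. a b * T' b t)"
      have "(\<lambda>t. \<Sum>b\<in>S. a b * T' b t, \<lambda>t. \<Sum>b\<in>S. a b * - b t) \<in> ?G"
        using S(2) by (intro basis_graph_sum[OF S(1)] basis_graph_scale rot1) auto
      then show ?thesis
        by (simp add: S sum_negf)
    qed
    show "\<exists>(v, w)\<in>?G. norm_L2 M (\<lambda>t. x t - v t) < e" if "x \<in> L2 M" "e > 0" for x e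
    proof -
      obtain S a where S: "finite S" "S \<subseteq> B" "norm_L2 M (\<lambda>t. x t - (\<Sum>b\<in>S. a b * b t)) < e"
        using maximal_orthonormal_dense[OF B max \<open>x \<in> L2 M\<close> \<open>e > 0\<close>] by blast
      then show ?thesis
        by (intro bexI[OF _ basis_graphI[OF S(1,2) refl refl, of a]]) simp
    qed
  qed (auto intro: basis_graph_add basis_graph_scale)
  show thesis
  proof (rule that[OF u(1,2)])
    fix b assume b: "b \<in> N"
    have "(b, T b) \<in> ?G"
      using b N(1) by (intro basis_graphI[of "{b}" _ _ "\<lambda>_. 1"]) (auto simp: T'_N)
    then show "AE t in M. u b t = T b t"
      by (rule u(3))
  qed
qed

section \<open>Unit vectors of cells and the adapted complex structure\<close>

definition unit_cell :: "'a measure \<Rightarrow> 'a set \<Rightarrow> 'a \<Rightarrow> real" where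
  "unit_cell M A t = 1 / sqrt (measure M A) * indicator A t"

lemma unit_cell_L2: "cell M A \<Longrightarrow> unit_cell M A \<in> L2 M"
  unfolding unit_cell_def[abs_def] by (intro L2_cmult cell_indicator_L2)

text \<open>Lets a cell be read off from its unit vector, as the complex structure is prescribed on
  basis functions and not on cells.\<close>

lemma unit_cell_support: "cell M A \<Longrightarrow> {t. unit_cell M A t \<noteq> 0} = A"
  by (auto simp: unit_cell_def cell_def indicator_def)

lemma unit_cell_inj: "cell M A \<Longrightarrow> cell M B \<Longrightarrow> unit_cell M A = unit_cell M B \<Longrightarrow> A = B"
  using unit_cell_support by metis

lemma ip_unit_cell_disjoint: "A \<inter> B = {} \<Longrightarrow> ip M (unit_cell M A) (unit_cell M B) = 0"
  unfolding ip_def by (intro integral_eq_zero_AE AE_I2) (auto simp: unit_cell_def indicator_def)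

lemma norm_L2_unit_cell:
  assumes "cell M A"
  shows "norm_L2 M (unit_cell M A) = 1"
  using assms norm_L2_indicator[of A M] unfolding unit_cell_def[abs_def] norm_L2_cmult
  by (simp add: cell_def)

lemma ip_unit_cell_self: "cell M A \<Longrightarrow> ip M (unit_cell M A) (unit_cell M A) = 1"
  using norm_L2_unit_cell[of M A] norm_L2_power2[of M "unit_cell M A"] by simp

lemma ip_linear_combinations:
  assumes "\<And>i. i \<in> I \<Longrightarrow> f i \<in> L2 M" "\<And>j. j \<in> J \<Longrightarrow> g j \<in> L2 M"
  shows "ip M (\<lambda>t. \<Sum>i\<in>I. a i * f i t) (\<lambda>t. \<Sum>j\<in>J. b j * g j t) = (\<Sum>i\<in>I. \<Sum>j\<in>J. a i * b j * ip M (f i) (g j))"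
proof -
  have g: "(\<lambda>t. \<Sum>j\<in>J. b j * g j t) \<in> L2 M"
    by (intro L2_sum L2_cmult assms)
  have "ip M (\<lambda>t. \<Sum>i\<in>I. a i * f i t) (\<lambda>t. \<Sum>j\<in>J. b j * g j t) =
      (\<Sum>i\<in>I. a i * ip M (f i) (\<lambda>t. \<Sum>j\<in>J. b j * g j t))"
    by (subst ip_sum_left[OF _ g]) (auto simp: assms L2_cmult ip_cmult_left)
  also have "\<dots> = (\<Sum>i\<in>I. a i * (\<Sum>j\<in>J. b j * ip M (f i) (g j)))"
  proof (intro sum.cong refl)
    fix i assume "i \<in> I"
    then have "ip M (f i) (\<lambda>t. \<Sum>j\<in>J. b j * g j t) = (\<Sum>j\<in>J. b j * ip M (f i) (g j))"
      by (subst ip_sum_right) (auto simp: assms L2_cmult ip_cmult_right)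
    then show "a i * ip M (f i) (\<lambda>t. \<Sum>j\<in>J. b j * g j t) = a i * (\<Sum>j\<in>J. b j * ip M (f i) (g j))"
      by simp
  qed
  finally show ?thesis
    by (simp add: sum_distrib_left mult.assoc)
qed

text \<open>Skewness and orthogonality of a matrix together give square \<open>-1\<close> on the
  span of one family. Spans of different families are orthogonal, so the blocks fit together on
  \<open>N\<close>.\<close>

lemma adapted_complex_structure:
  fixes M :: "'a measure" and F :: "nat \<Rightarrow> 'a set set" and z :: "nat \<Rightarrow> 'a set"
  assumes F: "\<And>n. family M (F n)" "\<And>n. even (card (F n))"
    and z: "\<And>n. cell M (z n)" "\<And>n. z n \<notin> F n"
    and disj: "\<And>m n A B. m \<noteq> n \<Longrightarrow> A \<in> insert (z m) (F m) \<Longrightarrow> B \<in> insert (z n) (F n) \<Longrightarrow> A \<inter> B = {}"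
    and disj_z: "\<And>n A. A \<in> F n \<Longrightarrow> A \<inter> z n = {}"
  obtains u where "complex_structure M u" "\<And>x. x \<in> L2 M \<Longrightarrow> norm_L2 M (u x) = norm_L2 M x"
    "\<And>n. \<exists>U. (\<forall>A\<in>F n. \<forall>B\<in>F n. \<bar>U A B\<bar> \<le> 3 / sqrt (real (card (F n)))) \<and>
      (\<forall>A\<in>F n. AE t in M. u (unit_cell M A) t = (\<Sum>B\<in>F n. U B A * unit_cell M B t))"
proof -
  let ?e = "unit_cell M"
  define \<C> where "\<C> = (\<Union>n. insert (z n) (F n))"
  have cell: "cell M A" if "A \<in> \<C>" for A
    using that z(1) F(1) by (auto simp: \<C>_def family_def)
  have ne: "A \<noteq> {}" if "A \<in> \<C>" for A
    using cell[OF that] by (auto simp: cell_def)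
  have same: "m = n" if "A \<in> insert (z m) (F m)" "A \<in> insert (z n) (F n)" for A m n
    using disj[of m n A A] that ne[of A] by (auto simp: \<C>_def)
  have disjC: "A \<inter> B = {}" if AB: "A \<in> \<C>" "B \<in> \<C>" "A \<noteq> B" for A B
  proof -
    obtain m n where mn: "A \<in> insert (z m) (F m)" "B \<in> insert (z n) (F n)"
      using AB by (auto simp: \<C>_def)
    show ?thesis
    proof (cases "m = n")
      case True
      have "disjoint (F n)"
        using F(1)[of n] by (simp add: family_def)
      then show ?thesis
        using mn AB(3) True disj_z[of A n] disj_z[of B n] by (auto dest: disjointD)
    next
      case False
      then show ?thesis
        by (rule disj) (rule mn)+
    qed
  qed
  have F_C: "A \<in> \<C>" if "A \<in> F n" for A n
    using that by (auto simp: \<C>_def)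
  have z_C: "z n \<in> \<C>" for n
    by (auto simp: \<C>_def)
  have e_orth: "ip M (?e A) (?e B) = (if A = B then 1 else 0)" if "A \<in> \<C>" "B \<in> \<C>" for A B
    using that ip_unit_cell_self[OF cell] ip_unit_cell_disjoint[OF disjC] by auto
  have e_eq: "?e A = ?e B \<longleftrightarrow> A = B" if "A \<in> \<C>" "B \<in> \<C>" for A B
    using unit_cell_inj[OF cell[OF that(1)] cell[OF that(2)]] by auto
  have e_L2: "?e A \<in> L2 M" if "A \<in> \<C>" for A
    by (rule unit_cell_L2[OF cell[OF that]])
  have supp: "{t. ?e A t \<noteq> 0} = A" if "A \<in> \<C>" for A
    by (rule unit_cell_support[OF cell[OF that]])
  have "orthonormal M (?e ` \<C>)"
    unfolding orthonormal_def using e_L2 e_orth e_eq by auto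
  then obtain B where B: "orthonormal M B" "?e ` \<C> \<subseteq> B" and max: "\<And>B'. orthonormal M B' \<Longrightarrow> B \<subseteq> B' \<Longrightarrow> B' = B"
    by (rule orthonormal_extend_maximal) blast
  define N where "N = ?e ` (\<Union>n. F n)"
  have NB: "N \<subseteq> B"
    using B(2) F_C by (auto simp: N_def)
  \<comment> \<open>The unit vectors of the spare cells are pairwise distinct members of
    \<open>B\<close> outside \<open>N\<close>.\<close>
  have inf: "infinite (B - N)"
  proof -
    have zF: "z n \<notin> F m" for m n
      using z(2)[of n] same[of "z n" n m] by auto
    have "?e (z n) \<in> B - N" for n
      using B(2) z_C zF e_eq[OF z_C F_C] by (auto simp: N_def)
    moreover have "inj (\<lambda>n. ?e (z n))"
      using e_eq[OF z_C z_C] same by (intro injI) (metis insertI1)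
    ultimately show ?thesis
      using range_inj_infinite[of "\<lambda>n. ?e (z n)"] infinite_super[of "range (\<lambda>n. ?e (z n))" "B - N"] by blast
  qed
  have "\<exists>U. \<forall>n. (\<forall>A\<in>F n. \<forall>B\<in>F n. U n A B = - U n B A) \<and>
      (\<forall>A\<in>F n. \<forall>B\<in>F n. \<bar>U n A B\<bar> \<le> 3 / sqrt (real (card (F n)))) \<and>
      (\<forall>B\<in>F n. \<forall>D\<in>F n. (\<Sum>A\<in>F n. U n A B * U n A D) = (if B = D then 1 else 0))"
  proof (intro choice allI)
    fix n
    obtain U where "\<And>A B. A \<in> F n \<Longrightarrow> B \<in> F n \<Longrightarrow> U A B = - U B A"
      "\<And>A B. A \<in> F n \<Longrightarrow> B \<in> F n \<Longrightarrow> \<bar>U A B\<bar> \<le> 3 / sqrt (real (card (F n)))"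
      "\<And>B D. B \<in> F n \<Longrightarrow> D \<in> F n \<Longrightarrow> (\<Sum>A\<in>F n. U A B * U A D) = (if B = D then 1 else 0 :: real)"
      using flat_skew_orthogonal_matrix[OF family_finite[OF F(1)[of n]] F(2)[of n]] by blast
    then show "\<exists>U. (\<forall>A\<in>F n. \<forall>B\<in>F n. U A B = - U B A) \<and>
      (\<forall>A\<in>F n. \<forall>B\<in>F n. \<bar>U A B\<bar> \<le> 3 / sqrt (real (card (F n)))) \<and>
      (\<forall>B\<in>F n. \<forall>D\<in>F n. (\<Sum>A\<in>F n. U A B * U A D) = (if B = D then 1 else 0 :: real))"
      by (intro exI[of _ U]) blast
  qed
  then obtain U :: "nat \<Rightarrow> 'a set \<Rightarrow> 'a set \<Rightarrow> real" where
    skew: "\<And>n A B. A \<in> F n \<Longrightarrow> B \<in> F n \<Longrightarrow> U n A B = - U n B A" and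
    flat: "\<And>n A B. A \<in> F n \<Longrightarrow> B \<in> F n \<Longrightarrow> \<bar>U n A B\<bar> \<le> 3 / sqrt (real (card (F n)))" and
    orth: "\<And>n B D. B \<in> F n \<Longrightarrow> D \<in> F n \<Longrightarrow> (\<Sum>A\<in>F n. U n A B * U n A D) = (if B = D then 1 else 0)"
    by blast
  define idx where "idx A = (THE n. A \<in> F n)" for A
  have idx: "idx A = n" if "A \<in> F n" for A n
    unfolding idx_def using that same by (intro the_equality) auto
  \<comment> \<open>The support of a basis function recovers its cell, and \<open>idx\<close> the
    only family that contains this cell.\<close>
  define T where "T b t = (\<Sum>B\<in>F (idx {t. b t \<noteq> 0}). U (idx {t. b t \<noteq> 0}) B {t. b t \<noteq> 0} * ?e B t)"
    for b :: "'a \<Rightarrow> real" and t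
  have T: "T (?e A) = (\<lambda>t. \<Sum>B\<in>F n. U n B A * ?e B t)" if A: "A \<in> F n" for A n
    unfolding T_def supp[OF F_C[OF A]] idx[OF A] ..
  have inj: "inj_on ?e (F n)" for n
    using e_eq[OF F_C F_C] by (auto simp: inj_on_def)
  obtain u where u: "complex_structure M u" "\<And>x. x \<in> L2 M \<Longrightarrow> norm_L2 M (u x) = norm_L2 M x"
    "\<And>b. b \<in> N \<Longrightarrow> AE t in M. u b t = T b t"
  proof (rule complex_structure_extend_basis[OF B(1) max NB inf, of T])
    show "T b \<in> L2 M" if b: "b \<in> N" for b
    proof -
      obtain A n where A: "A \<in> F n" "b = ?e A"
        using b by (auto simp: N_def)
      show ?thesis
        unfolding A(2) T[OF A(1)] by (intro L2_sum L2_cmult e_L2 F_C)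
    qed
    show "ip M (T b) (T c) = (if b = c then 1 else 0)" if bc: "b \<in> N" "c \<in> N" for b c
    proof -
      obtain A n where A: "A \<in> F n" "b = ?e A"
        using bc by (auto simp: N_def)
      obtain A' n' where A': "A' \<in> F n'" "c = ?e A'"
        using bc by (auto simp: N_def)
      have "ip M (T b) (T c) = (\<Sum>B\<in>F n. \<Sum>D\<in>F n'. U n B A * U n' D A' * ip M (?e B) (?e D))"
        unfolding A(2) A'(2) T[OF A(1)] T[OF A'(1)] by (intro ip_linear_combinations e_L2 F_C)
      also have "\<dots> = (\<Sum>B\<in>F n. \<Sum>D\<in>F n'. if B = D then U n B A * U n' B A' else 0)"
        by (intro sum.cong refl) (simp add: e_orth F_C)
      also have "\<dots> = (if A = A' then 1 else 0)"
      proof (cases "n = n'")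
        case True
        then show ?thesis
          using orth[OF A(1), of A'] A'(1) family_finite[OF F(1)] by simp
      next
        case False
        have no: "B \<noteq> D" if "B \<in> F n" "D \<in> F n'" for B D
          using same[of B n n'] that False by auto
        have "(\<Sum>B\<in>F n. \<Sum>D\<in>F n'. if B = D then U n B A * U n' B A' else 0) = 0"
          by (intro sum.neutral ballI) (simp add: no)
        then show ?thesis
          using no[OF A(1) A'(1)] by simp
      qed
      finally show ?thesis
        using e_eq[OF F_C[OF A(1)] F_C[OF A'(1)]] A(2) A'(2) by simp
    qed
    show "ip M (T b) c = 0" if bc: "b \<in> N" "c \<in> B - N" for b c
    proof -
      obtain A n where A: "A \<in> F n" "b = ?e A"
        using bc by (auto simp: N_def)
      have c: "c \<in> L2 M"
        using bc B(1) by (auto simp: orthonormal_def)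
      have "ip M (?e D) c = 0" if "D \<in> F n" for D
      proof -
        have "?e D \<in> N"
          using that by (auto simp: N_def)
        then have "?e D \<in> B" "?e D \<noteq> c"
          using NB bc by auto
        then show ?thesis
          using B(1) bc unfolding orthonormal_def by simp
      qed
      then show ?thesis
        unfolding A(2) T[OF A(1)]
        by (subst ip_sum_left) (auto simp: ip_cmult_left c intro!: L2_cmult e_L2 F_C)
    qed
    show "(T b, \<lambda>t. - b t) \<in> basis_graph N T" if b: "b \<in> N" for b
    proof -
      obtain A n where A: "A \<in> F n" "b = ?e A"
        using b by (auto simp: N_def)
      show ?thesis
      proof (rule basis_graphI[of "?e ` F n" _ _ "\<lambda>b. U n {t. b t \<noteq> 0} A"])
        show "finite (?e ` F n)"
          using family_finite[OF F(1)] by simp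
        show "?e ` F n \<subseteq> N"
          by (auto simp: N_def)
        show "T b = (\<lambda>t. \<Sum>b\<in>?e ` F n. U n {t. b t \<noteq> 0} A * b t)"
          unfolding A(2) T[OF A(1)] sum.reindex[OF inj] by (intro ext sum.cong refl) (simp add: supp[OF F_C])
        \<comment> \<open>Applying \<open>T\<close> twice squares the matrix;
          \<open>U n B D = - U n D B\<close> turns this square into minus the Gram matrix of the
          columns.\<close>
        have "- ?e A t = (\<Sum>D\<in>F n. U n D A * T (?e D) t)" for t
        proof -
          have "(\<Sum>D\<in>F n. U n D A * T (?e D) t) = (\<Sum>D\<in>F n. \<Sum>B\<in>F n. U n D A * (U n B D * ?e B t))"
            by (intro sum.cong refl) (simp add: T sum_distrib_left)
          also have "\<dots> = (\<Sum>B\<in>F n. \<Sum>D\<in>F n. U n D A * (U n B D * ?e B t))"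
            by (rule sum.swap)
          also have "\<dots> = (\<Sum>B\<in>F n. - ?e B t * (\<Sum>D\<in>F n. U n D A * U n D B))"
          proof (intro sum.cong refl)
            fix B assume B: "B \<in> F n"
            show "(\<Sum>D\<in>F n. U n D A * (U n B D * ?e B t)) = - ?e B t * (\<Sum>D\<in>F n. U n D A * U n D B)"
              unfolding sum_distrib_left by (intro sum.cong refl) (simp add: skew[OF B])
          qed
          also have "\<dots> = (\<Sum>B\<in>F n. if A = B then - ?e B t else 0)"
            by (intro sum.cong refl) (simp add: orth[OF A(1)])
          also have "\<dots> = - ?e A t"
            using A(1) family_finite[OF F(1)] by simp
          finally show ?thesis ..
        qed
        then show "(\<lambda>t. - b t) = (\<lambda>t. \<Sum>b\<in>?e ` F n. U n {t. b t \<noteq> 0} A * T b t)"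
          unfolding A(2) sum.reindex[OF inj] by (intro ext) (simp add: supp[OF F_C] cong: sum.cong)
      qed
    qed
  qed (assumption | rule that)+
  show thesis
  proof (rule that[OF u(1,2)])
    fix n
    have "AE t in M. u (?e A) t = (\<Sum>B\<in>F n. U n B A * ?e B t)" if A: "A \<in> F n" for A
      using u(3)[of "?e A"] A unfolding T[OF A] by (auto simp: N_def)
    then show "\<exists>U. (\<forall>A\<in>F n. \<forall>B\<in>F n. \<bar>U A B\<bar> \<le> 3 / sqrt (real (card (F n)))) \<and>
      (\<forall>A\<in>F n. AE t in M. u (?e A) t = (\<Sum>B\<in>F n. U B A * ?e B t))"
      using flat by (intro exI[of _ "U n"]) blast
  qed
qed

section \<open>Extensions and their residual forms\<close>

context L2_centralizer
begin

definition skew_form :: "('a \<Rightarrow> real) \<Rightarrow> ('a \<Rightarrow> real) \<Rightarrow> 'a \<Rightarrow> real" where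
  "skew_form x z t = z t * \<Omega> x t - x t * \<Omega> z t"

text \<open>Neither \<open>z * \<Omega> x\<close> nor \<open>x * \<Omega> z\<close> need be
  integrable. Replacing \<open>\<Omega> x\<close> by \<open>f * \<Omega> w\<close> and
  \<open>\<Omega> z\<close> by \<open>g * \<Omega> w\<close> leaves errors in \<open>L2\<close>,
  while the two main terms agree pointwise and cancel.\<close>

lemma skew_form_bound_add:
  assumes x: "x \<in> L2 M" and z: "z \<in> L2 M"
  shows "integrable M (skew_form x z)" "\<bar>\<integral>t. skew_form x z t \<partial>M\<bar> \<le> C * (norm_L2 M x + norm_L2 M z)\<^sup>2"
proof -
  note [measurable] = L2_measurable[OF x] L2_measurable[OF z]
  define w where "w t = \<bar>x t\<bar> + \<bar>z t\<bar>" for t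
  have absL: "(\<lambda>t. \<bar>y t\<bar>) \<in> L2 M \<and> norm_L2 M (\<lambda>t. \<bar>y t\<bar>) \<le> norm_L2 M y" if y: "y \<in> L2 M" for y
  proof -
    have "(\<lambda>t. \<bar>y t\<bar>) \<in> borel_measurable M"
      using L2_measurable[OF y] by measurable
    then show ?thesis
      by (intro conjI L2_dominated[OF y]) simp_all
  qed
  have w: "w \<in> L2 M" "norm_L2 M w \<le> norm_L2 M x + norm_L2 M z"
    unfolding w_def[abs_def] using L2_add[of "\<lambda>t. \<bar>x t\<bar>" M "\<lambda>t. \<bar>z t\<bar>"]
      norm_L2_triangle[of "\<lambda>t. \<bar>x t\<bar>" M "\<lambda>t. \<bar>z t\<bar>"] absL[OF x] absL[OF z] by auto
  note [measurable] = L2_measurable[OF w(1)]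
  \<comment> \<open>Where \<open>w\<close> vanishes so does \<open>x\<close>, and division by 0
    returns 0; hence \<open>f w = x\<close> holds at every point, and likewise for \<open>g\<close>
    and \<open>z\<close>.\<close>
  define f where "f t = x t / w t" for t
  define g where "g t = z t / w t" for t
  have m: "f \<in> borel_measurable M" "g \<in> borel_measurable M"
    unfolding f_def[abs_def] g_def[abs_def] by measurable
  have le: "\<bar>f t\<bar> \<le> 1" "\<bar>g t\<bar> \<le> 1" for t
    by (auto simp: f_def g_def w_def divide_le_eq_1)
  have eq: "(\<lambda>t. f t * w t) = x" "(\<lambda>t. g t * w t) = z"
    by (auto simp: f_def g_def w_def fun_eq_iff)
  define p where "p = (\<lambda>t. \<Omega> x t - f t * \<Omega> w t)"
  define q where "q = (\<lambda>t. \<Omega> z t - g t * \<Omega> w t)"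
  have p: "p \<in> L2 M" "norm_L2 M p \<le> C * norm_L2 M w"
    using \<Omega>_mult[OF w(1) m(1) le(1)] unfolding eq p_def by auto
  have q: "q \<in> L2 M" "norm_L2 M q \<le> C * norm_L2 M w"
    using \<Omega>_mult[OF w(1) m(2) le(2)] unfolding eq q_def by auto
  have s: "skew_form x z = (\<lambda>t. z t * p t - x t * q t)"
  proof
    fix t
    have "z t * f t = x t * g t"
      by (simp add: f_def g_def)
    then have "z t * (f t * \<Omega> w t) = x t * (g t * \<Omega> w t)"
      by (simp only: mult.assoc[symmetric])
    then show "skew_form x z t = z t * p t - x t * q t"
      unfolding skew_form_def p_def q_def right_diff_distrib by linarith
  qed
  show "integrable M (skew_form x z)"
    unfolding s by (intro Bochner_Integration.integrable_diff L2_mult_integrable x z p q)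
  have "(\<integral>t. skew_form x z t \<partial>M) = ip M z p - ip M x q"
    unfolding s ip_def by (intro Bochner_Integration.integral_diff L2_mult_integrable x z p q)
  then have "\<bar>\<integral>t. skew_form x z t \<partial>M\<bar> \<le> norm_L2 M z * norm_L2 M p + norm_L2 M x * norm_L2 M q"
    using ip_Cauchy_Schwarz[OF z p(1)] ip_Cauchy_Schwarz[OF x q(1)] by linarith
  also have "\<dots> \<le> norm_L2 M z * (C * norm_L2 M w) + norm_L2 M x * (C * norm_L2 M w)"
    by (intro add_mono mult_left_mono p q) auto
  also have "\<dots> = C * norm_L2 M w * (norm_L2 M x + norm_L2 M z)"
    by (simp add: algebra_simps)
  also have "\<dots> \<le> C * (norm_L2 M x + norm_L2 M z) * (norm_L2 M x + norm_L2 M z)"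
    by (intro mult_right_mono mult_left_mono w C_nonneg) auto
  finally show "\<bar>\<integral>t. skew_form x z t \<partial>M\<bar> \<le> C * (norm_L2 M x + norm_L2 M z)\<^sup>2"
    by (simp add: power2_eq_square)
qed

lemma \<Omega>_null:
  assumes x: "x \<in> L2 M" "AE t in M. x t = 0"
  shows "AE t in M. \<Omega> x t = 0"
proof -
  have 1: "AE t in M. \<Omega> x t = \<Omega> (\<lambda>t. 0 * x t) t"
    by (rule \<Omega>_cong[OF x(1) L2_cmult[OF x(1)]]) (use x(2) in auto)
  show ?thesis
    using 1 \<Omega>_cmult[OF x(1), of 0] by eventually_elim simp
qed

text \<open>
  A centralizer is symmetric up to a bounded form: for \<open>x = f w\<close> and \<open>z = g w\<close> both pairings are
  close to \<open>\<integral>f g w \<Omega>(w)\<close>.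
\<close>

lemma skew_form_bound:
  assumes x: "x \<in> L2 M" and z: "z \<in> L2 M"
  shows "\<bar>\<integral>t. skew_form x z t \<partial>M\<bar> \<le> 4 * C * norm_L2 M x * norm_L2 M z"
proof (cases "norm_L2 M x = 0 \<or> norm_L2 M z = 0")
  case True
  have "AE t in M. skew_form x z t = 0"
    using True
  proof
    assume "norm_L2 M x = 0"
    then have "AE t in M. x t = 0"
      by (simp add: norm_L2_eq_0_iff[OF x])
    moreover from \<Omega>_null[OF x this] have "AE t in M. \<Omega> x t = 0" .
    ultimately show ?thesis
      by eventually_elim (simp add: skew_form_def)
  next
    assume "norm_L2 M z = 0"
    then have "AE t in M. z t = 0"
      by (simp add: norm_L2_eq_0_iff[OF z])
    moreover from \<Omega>_null[OF z this] have "AE t in M. \<Omega> z t = 0" .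
    ultimately show ?thesis
      by eventually_elim (simp add: skew_form_def)
  qed
  then have "(\<integral>t. skew_form x z t \<partial>M) = 0"
    by (rule integral_eq_zero_AE)
  then show ?thesis
    using C_nonneg by simp
next
  case False
  define a where "a = norm_L2 M x"
  define b where "b = norm_L2 M z"
  have ab: "a > 0" "b > 0"
    using False norm_L2_nonneg[of M x] norm_L2_nonneg[of M z] by (auto simp: a_def b_def less_le)
  \<comment> \<open>Scaling by \<open>c\<close> and \<open>1 / c\<close> preserves the form almost
    everywhere and makes both norms equal to \<open>sqrt (a * b)\<close>, so the squared sum of
    norms becomes \<open>4 * a * b\<close>.\<close>
  define c where "c = sqrt (b / a)"
  have c: "c > 0"
    using ab by (simp add: c_def)
  let ?x = "\<lambda>t. c * x t" and ?z = "\<lambda>t. (1 / c) * z t"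
  have "AE t in M. skew_form x z t = skew_form ?x ?z t"
    using \<Omega>_cmult[OF x, of c] \<Omega>_cmult[OF z, of "1 / c"]
    by eventually_elim (use c in \<open>simp add: skew_form_def\<close>)
  then have "(\<integral>t. skew_form x z t \<partial>M) = (\<integral>t. skew_form ?x ?z t \<partial>M)"
    using skew_form_bound_add(1)[OF x z] skew_form_bound_add(1)[OF L2_cmult[OF x] L2_cmult[OF z]]
    by (intro integral_cong_AE borel_measurable_integrable)
  also have "\<bar>\<dots>\<bar> \<le> C * (norm_L2 M ?x + norm_L2 M ?z)\<^sup>2"
    by (rule skew_form_bound_add(2)[OF L2_cmult[OF x] L2_cmult[OF z]])
  also have "norm_L2 M ?x = c * a"
    unfolding norm_L2_cmult using c by (simp add: a_def)
  also have "norm_L2 M ?z = (1 / c) * b"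
    unfolding norm_L2_cmult using c by (simp add: b_def)
  also have "(1 / c) * b = c * a"
  proof -
    have "c * c = b / a"
      using ab by (simp add: c_def)
    then show ?thesis
      using ab c by (simp add: field_simps)
  qed
  also have "C * (c * a + c * a)\<^sup>2 = 4 * C * ((c * c) * a * a)"
    by (simp add: power2_eq_square algebra_simps)
  also have "c * c * a * a = a * b"
    using ab by (simp add: c_def)
  finally show ?thesis
    by (simp add: a_def b_def mult.assoc)
qed

lemma \<Omega>_linear_combination:
  assumes "finite I" "\<And>i. i \<in> I \<Longrightarrow> x i \<in> L2 M"
  shows "(\<lambda>t. \<Omega> (\<lambda>t. \<Sum>i\<in>I. a i * x i t) t - (\<Sum>i\<in>I. a i * \<Omega> (x i) t)) \<in> L2 M"
  using assms
proof (induction I rule: finite_induct)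
  case empty
  have "AE t in M. 0 = \<Omega> (\<lambda>t. 0) t"
    using \<Omega>_null[OF L2_zero] by auto
  then show ?case
    using measurable_\<Omega>[OF L2_zero] by (intro L2_AE_cong[OF L2_zero]) auto
next
  case (insert i I)
  let ?y = "\<lambda>t. a i * x i t" and ?s = "\<lambda>t. \<Sum>i\<in>I. a i * x i t"
  have y: "?y \<in> L2 M" and s: "?s \<in> L2 M" and xi: "x i \<in> L2 M"
    using insert by (auto intro!: L2_sum L2_cmult)
  have 1: "(\<lambda>t. \<Omega> (\<lambda>t. ?y t + ?s t) t - \<Omega> ?y t - \<Omega> ?s t) \<in> L2 M"
    by (rule \<Omega>_add(1)[OF y s])
  have 2: "(\<lambda>t. \<Omega> ?s t - (\<Sum>i\<in>I. a i * \<Omega> (x i) t)) \<in> L2 M"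
    by (rule insert.IH) (use insert in auto)
  have m: "\<And>j. j \<in> I \<Longrightarrow> \<Omega> (x j) \<in> borel_measurable M" "\<Omega> (x i) \<in> borel_measurable M"
    using insert by (auto intro: measurable_\<Omega>)
  show ?case
  proof (rule L2_AE_cong[OF L2_add[OF 1 2]])
    show "AE t in M. \<Omega> (\<lambda>t. ?y t + ?s t) t - \<Omega> ?y t - \<Omega> ?s t + (\<Omega> ?s t - (\<Sum>i\<in>I. a i * \<Omega> (x i) t)) =
      \<Omega> (\<lambda>t. \<Sum>i\<in>insert i I. a i * x i t) t - (\<Sum>i\<in>insert i I. a i * \<Omega> (x i) t)"
      using \<Omega>_cmult[OF xi, of "a i"] by eventually_elim (use insert.hyps in simp)
    show "(\<lambda>t. \<Omega> (\<lambda>t. \<Sum>i\<in>insert i I. a i * x i t) t - (\<Sum>i\<in>insert i I. a i * \<Omega> (x i) t)) \<in> borel_measurable M"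
      using m measurable_\<Omega>[OF L2_add[OF y s]] insert.hyps by simp
  qed
qed

end

text \<open>\<open>\<tau> x\<close> and \<open>v x\<close> stand for the two components of an
  extension at \<open>(\<Omega> x, x)\<close>. As \<open>u\<close> acts on \<open>L2\<close> only,
  the linearity of \<open>u \<Omega> - \<tau>\<close> is expressed by \<open>\<tau>_add\<close>,
  where \<open>u\<close> meets nothing but a defect of \<open>\<Omega>\<close>.\<close>

locale extended_isometry = L2_centralizer +
  fixes u v \<tau> :: "('a \<Rightarrow> real) \<Rightarrow> ('a \<Rightarrow> real)" and V :: real
  assumes u_L2: "x \<in> L2 M \<Longrightarrow> u x \<in> L2 M"
    and u_add: "x \<in> L2 M \<Longrightarrow> y \<in> L2 M \<Longrightarrow> AE t in M. u (\<lambda>t. x t + y t) t = u x t + u y t"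
    and u_cmult: "x \<in> L2 M \<Longrightarrow> AE t in M. u (\<lambda>t. c * x t) t = c * u x t"
    and u_iso: "x \<in> L2 M \<Longrightarrow> norm_L2 M (u x) = norm_L2 M x"
    and V_nonneg: "0 \<le> V"
    and v_L2: "x \<in> L2 M \<Longrightarrow> v x \<in> L2 M"
    and v_le: "x \<in> L2 M \<Longrightarrow> norm_L2 M (v x) \<le> V * norm_L2 M x"
    and v_add: "x \<in> L2 M \<Longrightarrow> y \<in> L2 M \<Longrightarrow> AE t in M. v (\<lambda>t. x t + y t) t = v x t + v y t"
    and v_cmult: "x \<in> L2 M \<Longrightarrow> AE t in M. v (\<lambda>t. c * x t) t = c * v x t"
    and \<tau>_meas: "x \<in> L2 M \<Longrightarrow> \<tau> x \<in> borel_measurable M"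
    and \<tau>_L2: "x \<in> L2 M \<Longrightarrow> (\<lambda>t. \<tau> x t - \<Omega> (v x) t) \<in> L2 M"
    and \<tau>_le: "x \<in> L2 M \<Longrightarrow> norm_L2 M (\<lambda>t. \<tau> x t - \<Omega> (v x) t) \<le> V * norm_L2 M x"
    and \<tau>_add: "x \<in> L2 M \<Longrightarrow> y \<in> L2 M \<Longrightarrow> AE t in M. \<tau> (\<lambda>t. x t + y t) t =
      \<tau> x t + \<tau> y t + u (\<lambda>t. \<Omega> (\<lambda>t. x t + y t) t - \<Omega> x t - \<Omega> y t) t"
    and \<tau>_cmult: "x \<in> L2 M \<Longrightarrow> AE t in M. \<tau> (\<lambda>t. c * x t) t = c * \<tau> x t"
begin

lemma u_ip:
  assumes x: "x \<in> L2 M" and y: "y \<in> L2 M"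
  shows "ip M (u x) (u y) = ip M x y"
proof -
  have "norm_L2 M (\<lambda>t. u x t + u y t) = norm_L2 M (u (\<lambda>t. x t + y t))"
    by (rule norm_L2_AE_cong) (use u_add[OF x y] L2_measurable[OF L2_add[OF u_L2[OF x] u_L2[OF y]]]
        L2_measurable[OF u_L2[OF L2_add[OF x y]]] in auto)
  also have "\<dots> = norm_L2 M (\<lambda>t. x t + y t)"
    by (rule u_iso[OF L2_add[OF x y]])
  finally have "(norm_L2 M (\<lambda>t. u x t + u y t))\<^sup>2 = (norm_L2 M (\<lambda>t. x t + y t))\<^sup>2"
    by simp
  then show ?thesis
    using norm_L2_add_power2[OF x y] norm_L2_add_power2[OF u_L2[OF x] u_L2[OF y]] u_iso[OF x] u_iso[OF y]
    by simp
qed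

lemma u_linear_combination:
  assumes "finite I" "\<And>i. i \<in> I \<Longrightarrow> x i \<in> L2 M"
  shows "AE t in M. u (\<lambda>t. \<Sum>i\<in>I. a i * x i t) t = (\<Sum>i\<in>I. a i * u (x i) t)"
  using assms
proof (induction I rule: finite_induct)
  case empty
  then show ?case
    using u_cmult[OF L2_zero, of 0] by simp
next
  case (insert i I)
  have y: "(\<lambda>t. a i * x i t) \<in> L2 M" and s: "(\<lambda>t. \<Sum>i\<in>I. a i * x i t) \<in> L2 M" and xi: "x i \<in> L2 M"
    using insert by (auto intro!: L2_sum L2_cmult)
  have IH: "AE t in M. u (\<lambda>t. \<Sum>i\<in>I. a i * x i t) t = (\<Sum>i\<in>I. a i * u (x i) t)"
    by (rule insert.IH) (use insert in auto)
  show ?case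
    using u_add[OF y s] u_cmult[OF xi, of "a i"] IH
    by eventually_elim (use insert.hyps in simp)
qed

text \<open>
  Formally, \<open>residual x z\<close> is the pairing of \<open>z\<close> with \<open>\<Omega> x - v\<^sup>* \<Omega>(u x)\<close>, corrected by terms that
  make it linear in \<open>z\<close>.
\<close>

definition residual_form :: "('a \<Rightarrow> real) \<Rightarrow> ('a \<Rightarrow> real) \<Rightarrow> 'a \<Rightarrow> real" where
  "residual_form x z t = z t * \<Omega> x t - v z t * \<Omega> (u x) t - x t * \<Omega> z t + u x t * \<tau> z t"

definition residual :: "('a \<Rightarrow> real) \<Rightarrow> ('a \<Rightarrow> real) \<Rightarrow> real" where
  "residual x z = (\<integral>t. residual_form x z t \<partial>M)"

text \<open>The grouping that shows integrability and boundedness: two skew forms and the pairing of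
  \<open>u x\<close> with the \<open>L2\<close> function
  \<open>\<tau> z - \<Omega> (v z)\<close>.\<close>

lemma residual_form_eq:
  "residual_form x z = (\<lambda>t. skew_form x z t - skew_form (u x) (v z) t + u x t * (\<tau> z t - \<Omega> (v z) t))"
  by (simp add: fun_eq_iff residual_form_def skew_form_def algebra_simps)

lemma residual_form_integrable:
  assumes "x \<in> L2 M" "z \<in> L2 M"
  shows "integrable M (residual_form x z)"
  unfolding residual_form_eq
  by (intro Bochner_Integration.integrable_add Bochner_Integration.integrable_diff skew_form_bound_add(1)
      L2_mult_integrable u_L2 v_L2 \<tau>_L2 assms)

lemma residual_le:
  assumes x: "x \<in> L2 M" and z: "z \<in> L2 M"
  shows "\<bar>residual x z\<bar> \<le> (4 * C + 4 * C * V + V) * norm_L2 M x * norm_L2 M z"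
proof -
  have "residual x z = (\<integral>t. skew_form x z t \<partial>M) - (\<integral>t. skew_form (u x) (v z) t \<partial>M) +
      ip M (u x) (\<lambda>t. \<tau> z t - \<Omega> (v z) t)"
    unfolding residual_def residual_form_eq ip_def
    by (simp add: skew_form_bound_add(1) L2_mult_integrable u_L2 v_L2 \<tau>_L2 x z)
  moreover have "\<bar>\<integral>t. skew_form x z t \<partial>M\<bar> \<le> 4 * C * norm_L2 M x * norm_L2 M z"
    by (rule skew_form_bound[OF x z])
  moreover have "\<bar>\<integral>t. skew_form (u x) (v z) t \<partial>M\<bar> \<le> 4 * C * V * norm_L2 M x * norm_L2 M z"
  proof -
    have "\<bar>\<integral>t. skew_form (u x) (v z) t \<partial>M\<bar> \<le> 4 * C * norm_L2 M (u x) * norm_L2 M (v z)"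
      by (rule skew_form_bound[OF u_L2[OF x] v_L2[OF z]])
    also have "\<dots> \<le> 4 * C * norm_L2 M (u x) * (V * norm_L2 M z)"
      by (intro mult_left_mono v_le z) (simp add: C_nonneg)
    finally show ?thesis
      by (simp add: u_iso[OF x] mult_ac)
  qed
  moreover have "\<bar>ip M (u x) (\<lambda>t. \<tau> z t - \<Omega> (v z) t)\<bar> \<le> V * norm_L2 M x * norm_L2 M z"
  proof -
    have "\<bar>ip M (u x) (\<lambda>t. \<tau> z t - \<Omega> (v z) t)\<bar> \<le> norm_L2 M (u x) * norm_L2 M (\<lambda>t. \<tau> z t - \<Omega> (v z) t)"
      by (rule ip_Cauchy_Schwarz[OF u_L2[OF x] \<tau>_L2[OF z]])
    also have "\<dots> \<le> norm_L2 M (u x) * (V * norm_L2 M z)"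
      by (intro mult_left_mono \<tau>_le z) simp
    finally show ?thesis
      by (simp add: u_iso[OF x] mult_ac)
  qed
  ultimately show ?thesis
    by (simp add: distrib_right)
qed

text \<open>The defect \<open>d\<close> of \<open>\<Omega>\<close> enters twice, as
  \<open>- ip M x d\<close> and, through \<open>\<tau>\<close>, as \<open>ip M (u x) (u d)\<close>;
  these cancel because \<open>u\<close> preserves inner products.\<close>

lemma residual_add:
  assumes x: "x \<in> L2 M" and z: "z \<in> L2 M" "z' \<in> L2 M"
  shows "residual x (\<lambda>t. z t + z' t) = residual x z + residual x z'"
proof -
  define d where "d = (\<lambda>t. \<Omega> (\<lambda>t. z t + z' t) t - \<Omega> z t - \<Omega> z' t)"
  have d: "d \<in> L2 M"
    unfolding d_def by (rule \<Omega>_add(1)[OF z])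
  note I = residual_form_integrable[OF x z(1)] residual_form_integrable[OF x z(2)]
    L2_mult_integrable[OF x d] L2_mult_integrable[OF u_L2[OF x] u_L2[OF d]]
  have "residual x (\<lambda>t. z t + z' t) =
      (\<integral>t. residual_form x z t + residual_form x z' t - x t * d t + u x t * u d t \<partial>M)"
    unfolding residual_def
  proof (rule integral_cong_AE)
    show "residual_form x (\<lambda>t. z t + z' t) \<in> borel_measurable M"
      by (rule borel_measurable_integrable[OF residual_form_integrable[OF x L2_add[OF z]]])
    show "(\<lambda>t. residual_form x z t + residual_form x z' t - x t * d t + u x t * u d t) \<in> borel_measurable M"
      using I by (intro borel_measurable_integrable Bochner_Integration.integrable_add Bochner_Integration.integrable_diff)
    show "AE t in M. residual_form x (\<lambda>t. z t + z' t) t =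
        residual_form x z t + residual_form x z' t - x t * d t + u x t * u d t"
      using v_add[OF z] \<tau>_add[OF z, folded d_def]
    proof eventually_elim
      case (elim t)
      have "\<Omega> (\<lambda>t. z t + z' t) t = d t + \<Omega> z t + \<Omega> z' t"
        by (simp add: d_def)
      then show ?case
        unfolding residual_form_def using elim by (simp add: algebra_simps)
    qed
  qed
  also have "\<dots> = residual x z + residual x z' - ip M x d + ip M (u x) (u d)"
    unfolding residual_def ip_def using I by simp
  also have "\<dots> = residual x z + residual x z'"
    by (simp add: u_ip[OF x d])
  finally show ?thesis .
qed

lemma residual_cmult:
  assumes x: "x \<in> L2 M" and z: "z \<in> L2 M"
  shows "residual x (\<lambda>t. c * z t) = c * residual x z"
proof -
  have "residual x (\<lambda>t. c * z t) = (\<integral>t. c * residual_form x z t \<partial>M)"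
    unfolding residual_def
  proof (rule integral_cong_AE)
    show "residual_form x (\<lambda>t. c * z t) \<in> borel_measurable M"
      by (rule borel_measurable_integrable[OF residual_form_integrable[OF x L2_cmult[OF z]]])
    show "(\<lambda>t. c * residual_form x z t) \<in> borel_measurable M"
      using borel_measurable_integrable[OF residual_form_integrable[OF x z]] by measurable
    show "AE t in M. residual_form x (\<lambda>t. c * z t) t = c * residual_form x z t"
      using v_cmult[OF z, of c] \<tau>_cmult[OF z, of c] \<Omega>_cmult[OF z, of c]
      by eventually_elim (simp add: residual_form_def algebra_simps)
  qed
  then show ?thesis
    by (simp add: residual_def)
qed

lemma residual_sum:
  assumes x: "x \<in> L2 M" and "finite I" "\<And>i. i \<in> I \<Longrightarrow> z i \<in> L2 M"
  shows "residual x (\<lambda>t. \<Sum>i\<in>I. a i * z i t) = (\<Sum>i\<in>I. a i * residual x (z i))"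
  using assms(2,3)
proof (induction I rule: finite_induct)
  case empty
  then show ?case
    using residual_cmult[OF x L2_zero, of 0] by simp
next
  case (insert i I)
  have "(\<lambda>t. a i * z i t) \<in> L2 M" "(\<lambda>t. \<Sum>i\<in>I. a i * z i t) \<in> L2 M" "z i \<in> L2 M"
    using insert by (auto intro!: L2_sum L2_cmult)
  then show ?case
    using insert residual_add[OF x, of "\<lambda>t. a i * z i t" "\<lambda>t. \<Sum>i\<in>I. a i * z i t"] residual_cmult[OF x]
    by simp
qed

text \<open>The terms with \<open>\<Omega> z\<close> and \<open>\<tau> z\<close> are linear in the
  first argument and drop out. What survives trades the nonlinearity of \<open>\<Omega>\<close> on
  the \<open>x i\<close> for its nonlinearity on their images, up to bounded residuals.\<close>

lemma residual_nonlinearity: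
  assumes I: "finite I" and x: "\<And>i. i \<in> I \<Longrightarrow> x i \<in> L2 M" and z: "z \<in> L2 M"
    and y: "\<And>i. i \<in> I \<Longrightarrow> y i \<in> L2 M" "\<And>i. i \<in> I \<Longrightarrow> AE t in M. u (x i) t = y i t"
  shows "residual (\<lambda>t. \<Sum>i\<in>I. a i * x i t) z - (\<Sum>i\<in>I. a i * residual (x i) z) =
    ip M (\<lambda>t. \<Omega> (\<lambda>t. \<Sum>i\<in>I. a i * x i t) t - (\<Sum>i\<in>I. a i * \<Omega> (x i) t)) z -
    ip M (\<lambda>t. \<Omega> (\<lambda>t. \<Sum>i\<in>I. a i * y i t) t - (\<Sum>i\<in>I. a i * \<Omega> (y i) t)) (v z)"
proof -
  define X where "X = (\<lambda>t. \<Sum>i\<in>I. a i * x i t)"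
  define Y where "Y = (\<lambda>t. \<Sum>i\<in>I. a i * y i t)"
  define D where "D = (\<lambda>t. \<Omega> X t - (\<Sum>i\<in>I. a i * \<Omega> (x i) t))"
  define E where "E = (\<lambda>t. \<Omega> Y t - (\<Sum>i\<in>I. a i * \<Omega> (y i) t))"
  have X: "X \<in> L2 M" and Y: "Y \<in> L2 M"
    unfolding X_def Y_def using x y(1) by (auto intro!: L2_sum L2_cmult)
  have D: "D \<in> L2 M" and E: "E \<in> L2 M"
    unfolding D_def X_def E_def Y_def by (intro \<Omega>_linear_combination I x y(1); assumption)+
  have ui: "AE t in M. \<forall>i\<in>I. u (x i) t = y i t"
    using I y(2) by (intro AE_finite_allI)
  have "AE t in M. u X t = (\<Sum>i\<in>I. a i * u (x i) t)"
    unfolding X_def by (rule u_linear_combination[OF I x])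
  with ui have uX: "AE t in M. u X t = Y t"
    by eventually_elim (simp add: Y_def)
  have \<Omega>i: "AE t in M. \<forall>i\<in>I. \<Omega> (u (x i)) t = \<Omega> (y i) t"
    using I by (intro AE_finite_allI \<Omega>_cong u_L2 x y)
  have \<Omega>X: "AE t in M. \<Omega> (u X) t = \<Omega> Y t"
    by (rule \<Omega>_cong[OF u_L2[OF X] Y uX])
  note J = residual_form_integrable[OF X z] residual_form_integrable[OF x z]
  have "residual X z - (\<Sum>i\<in>I. a i * residual (x i) z) =
      (\<integral>t. residual_form X z t - (\<Sum>i\<in>I. a i * residual_form (x i) z t) \<partial>M)"
    unfolding residual_def using J by simp
  also have "\<dots> = (\<integral>t. D t * z t - E t * v z t \<partial>M)"
  proof (rule integral_cong_AE)
    show "(\<lambda>t. residual_form X z t - (\<Sum>i\<in>I. a i * residual_form (x i) z t)) \<in> borel_measurable M"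
      using J by (intro borel_measurable_integrable) auto
    show "(\<lambda>t. D t * z t - E t * v z t) \<in> borel_measurable M"
      using D E z v_L2[OF z] by (intro borel_measurable_integrable Bochner_Integration.integrable_diff L2_mult_integrable)
    show "AE t in M. residual_form X z t - (\<Sum>i\<in>I. a i * residual_form (x i) z t) = D t * z t - E t * v z t"
      using ui uX \<Omega>i \<Omega>X
    proof eventually_elim
      case (elim t)
      have "(\<Sum>i\<in>I. a i * residual_form (x i) z t) =
          (\<Sum>i\<in>I. z t * (a i * \<Omega> (x i) t) - v z t * (a i * \<Omega> (y i) t) - \<Omega> z t * (a i * x i t) + \<tau> z t * (a i * y i t))"
        using elim(1,3) by (intro sum.cong refl) (simp add: residual_form_def algebra_simps)
      also have "\<dots> = z t * (\<Sum>i\<in>I. a i * \<Omega> (x i) t) - v z t * (\<Sum>i\<in>I. a i * \<Omega> (y i) t) - \<Omega> z t * X t + \<tau> z t * Y t"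
        by (simp add: sum.distrib sum_subtractf sum_distrib_left X_def Y_def)
      finally show ?case
        using elim(2,4) by (simp add: residual_form_def D_def E_def algebra_simps)
    qed
  qed
  also have "\<dots> = ip M D z - ip M E (v z)"
    unfolding ip_def using L2_mult_integrable[OF D z] L2_mult_integrable[OF E v_L2[OF z]] by simp
  finally show ?thesis
    unfolding D_def E_def X_def Y_def .
qed

end

section \<open>Nonlinearity on flat vectors\<close>

lemma unit_cell_sum_eq:
  assumes "family M F" "A \<in> F" "t \<in> A"
  shows "(\<Sum>B\<in>F. c B * unit_cell M B t) = c A * unit_cell M A t"
proof -
  have "(\<Sum>B\<in>F. c B * unit_cell M B t) = (\<Sum>B\<in>F. indicator B t * (c B * (1 / sqrt (measure M B))))"
    by (intro sum.cong refl) (simp add: unit_cell_def)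
  also have "\<dots> = c A * (1 / sqrt (measure M A))"
    by (rule family_sum_indicator[OF assms])
  finally show ?thesis
    using assms(3) by (simp add: unit_cell_def)
qed

lemma unit_cell_sum_eq_0: "t \<notin> \<Union>F \<Longrightarrow> (\<Sum>B\<in>F. c B * unit_cell M B t) = 0"
  by (intro sum.neutral) (auto simp: unit_cell_def indicator_def)

lemma ip_unit_cell:
  assumes "family M F" "A \<in> F" "B \<in> F"
  shows "ip M (unit_cell M A) (unit_cell M B) = (if A = B then 1 else 0)"
proof (cases "A = B")
  case False
  then have "A \<inter> B = {}"
    using assms unfolding family_def by (auto dest: disjointD)
  then show ?thesis
    using False by (simp add: ip_unit_cell_disjoint)
qed (use ip_unit_cell_self[OF family_cell[OF assms(1,3)]] in simp)

lemma norm_L2_unit_cell_sum: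
  assumes F: "family M F"
  shows "(norm_L2 M (\<lambda>t. \<Sum>A\<in>F. a A * unit_cell M A t))\<^sup>2 = (\<Sum>A\<in>F. (a A)\<^sup>2)"
  by (rule norm_L2_orthonormal_sum) (auto simp: unit_cell_L2 family_cell[OF F] family_finite[OF F] ip_unit_cell[OF F])

lemma simple_on_unit_cell_sum:
  assumes F: "family M F"
  shows "simple_on F (\<lambda>t. \<Sum>A\<in>F. a A * unit_cell M A t)"
  unfolding simple_on_def
proof (intro conjI ballI allI impI)
  fix A s t assume A: "A \<in> F" "s \<in> A" "t \<in> A"
  then have "unit_cell M A s = unit_cell M A t"
    by (simp add: unit_cell_def)
  then show "(\<Sum>A\<in>F. a A * unit_cell M A s) = (\<Sum>A\<in>F. a A * unit_cell M A t)"
    by (simp add: unit_cell_sum_eq[OF F A(1,2)] unit_cell_sum_eq[OF F A(1,3)])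
qed (rule unit_cell_sum_eq_0)

context L2_centralizer
begin

text \<open>
  With \<open>y\<^sub>0\<close> the normalised sum of the unit vectors, every \<open>Y A\<close> is \<open>m A \<cdot> y\<^sub>0\<close> with
  \<open>\<bar>m A\<bar> \<le> 3\<close>. A random sum \<open>f = \<Sum>\<epsilon>\<^sub>A \<alpha>\<^sub>A m\<^sub>A\<close> is mostly bounded by \<open>K \<nu>\<close>, where
  \<open>\<Omega>(f y\<^sub>0)\<close> is close to \<open>f \<Omega>(y\<^sub>0)\<close>; the tail has small mean square and costs only a small multiple of \<open>a\<close>.
\<close>

lemma flat_nonlinearity:
  fixes \<alpha> :: "'a set \<Rightarrow> real"
  assumes F: "family M F" "F \<noteq> {}" and a: "0 \<le> a" "dev_bound F a" and K: "K > 0"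
    and flat: "\<And>A B. A \<in> F \<Longrightarrow> B \<in> F \<Longrightarrow> \<bar>U A B\<bar> \<le> 3 / sqrt (real (card F))"
    and \<nu>: "\<nu> > 0" "\<nu>\<^sup>2 = (\<Sum>A\<in>F. (\<alpha> A)\<^sup>2)"
    and Y: "Y = (\<lambda>A t. \<Sum>B\<in>F. U B A * unit_cell M B t)"
  shows "sign_avg F (\<lambda>\<epsilon>. norm_L2 M (\<lambda>t. \<Omega> (\<lambda>t. \<Sum>A\<in>F. (\<epsilon> A * \<alpha> A) * Y A t) t -
      (\<Sum>A\<in>F. (\<epsilon> A * \<alpha> A) * \<Omega> (Y A) t))) \<le> \<nu> * (3 * C + 2 * C * K + (2 * C + 2 * a) * (16 / K))"
proof -
  note fin = family_finite[OF F(1)]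
  define N where "N = real (card F)"
  have N: "N > 0"
    using fin F(2) by (simp add: N_def card_gt_0_iff)
  define y\<^sub>0 where "y\<^sub>0 t = (\<Sum>B\<in>F. (1 / sqrt N) * unit_cell M B t)" for t
  have y0_simple: "simple_on F y\<^sub>0"
    unfolding y\<^sub>0_def[abs_def] by (rule simple_on_unit_cell_sum[OF F(1)])
  have y0: "y\<^sub>0 \<in> L2 M"
    by (rule simple_on_L2[OF F(1) y0_simple])
  have "(norm_L2 M y\<^sub>0)\<^sup>2 = (\<Sum>A\<in>F. (1 / sqrt N)\<^sup>2)"
    unfolding y\<^sub>0_def[abs_def] by (rule norm_L2_unit_cell_sum[OF F(1)])
  also have "\<dots> = 1"
    using N by (simp add: power_divide N_def)
  finally have y0_norm: "norm_L2 M y\<^sub>0 = 1"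
    using norm_L2_nonneg[of M y\<^sub>0] by (simp add: power2_eq_1_iff)
  \<comment> \<open>\<open>sqrt N\<close> undoes the normalisation of \<open>y\<^sub>0\<close>;
    flatness of \<open>U\<close> then bounds the multiplier independently of the size of the
    family.\<close>
  define m where "m A t = (\<Sum>B\<in>F. indicator B t * (sqrt N * U B A))" for A t
  have m_eq: "m A t = sqrt N * U B A" if "B \<in> F" "t \<in> B" for A B t
    unfolding m_def by (rule family_sum_indicator[OF F(1) that])
  have m_0: "m A t = 0" if "t \<notin> \<Union>F" for A t
    unfolding m_def by (rule family_sum_indicator'[OF that])
  have m_le: "\<bar>m A t\<bar> \<le> 3" if A: "A \<in> F" for A t
  proof (cases "t \<in> \<Union>F")
    case True
    then obtain B where B: "B \<in> F" "t \<in> B"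
      by blast
    have "\<bar>m A t\<bar> = sqrt N * \<bar>U B A\<bar>"
      using N by (simp add: m_eq[OF B] abs_mult)
    also have "\<dots> \<le> sqrt N * (3 / sqrt N)"
      using flat[OF B(1) A] N by (intro mult_left_mono) (auto simp: N_def)
    finally show ?thesis
      using N by simp
  qed (simp add: m_0)
  have m_meas [measurable]: "m A \<in> borel_measurable M" for A
    unfolding m_def[abs_def] using cell_sets[OF family_cell[OF F(1)]] by measurable
  have my: "m A t * y\<^sub>0 t = Y A t" for A t
  proof (cases "t \<in> \<Union>F")
    case True
    then obtain B where B: "B \<in> F" "t \<in> B"
      by blast
    show ?thesis
      unfolding m_eq[OF B] y\<^sub>0_def Y unit_cell_sum_eq[OF F(1) B] using N by simp
  next
    case False
    then show ?thesis
      by (simp add: m_0 Y unit_cell_sum_eq_0)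
  qed
  define f where "f \<epsilon> t = (\<Sum>A\<in>F. (\<epsilon> A * \<alpha> A) * m A t)" for \<epsilon> t
  have f_meas [measurable]: "f \<epsilon> \<in> borel_measurable M" for \<epsilon>
    unfolding f_def[abs_def] by measurable
  have fy: "f \<epsilon> t * y\<^sub>0 t = (\<Sum>A\<in>F. (\<epsilon> A * \<alpha> A) * Y A t)" for \<epsilon> t
    by (simp add: f_def sum_distrib_right mult.assoc my)
  define b where "b A = (\<lambda>t. \<Omega> (Y A) t - m A t * \<Omega> y\<^sub>0 t)" for A
  have b: "b A \<in> L2 M" "norm_L2 M (b A) \<le> 3 * C" if A: "A \<in> F" for A
    using \<Omega>_mult[OF y0 m_meas m_le[OF A]] y0_norm unfolding b_def my by auto
  define P where "P \<epsilon> = (\<lambda>t. \<Omega> (\<lambda>t. f \<epsilon> t * y\<^sub>0 t) t - f \<epsilon> t * \<Omega> y\<^sub>0 t)" for \<epsilon>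
  \<comment> \<open>Over random signs the root mean square of \<open>f\<close> at a point is at most
    \<open>3 * \<nu>\<close>, so for large \<open>K\<close> the part \<open>h\<close> above
    \<open>K * \<nu>\<close> is a small tail.\<close>
  define \<kappa> where "\<kappa> = K * \<nu>"
  have \<kappa>: "\<kappa> > 0"
    using K \<nu> by (simp add: \<kappa>_def)
  define h where "h \<epsilon> t = (if \<bar>f \<epsilon> t\<bar> > \<kappa> then f \<epsilon> t else 0)" for \<epsilon> t
  define g where "g \<epsilon> t = (if \<bar>f \<epsilon> t\<bar> > \<kappa> then 0 else f \<epsilon> t)" for \<epsilon> t
  have hg_meas [measurable]: "h \<epsilon> \<in> borel_measurable M" "g \<epsilon> \<in> borel_measurable M" for \<epsilon>
    unfolding h_def[abs_def] g_def[abs_def] by measurable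
  have f_bd: "\<bar>f (sign_of S) t\<bar> \<le> 3 * (\<Sum>A\<in>F. \<bar>\<alpha> A\<bar>)" for S t
  proof -
    have "\<bar>f (sign_of S) t\<bar> \<le> (\<Sum>A\<in>F. \<bar>\<alpha> A\<bar> * \<bar>m A t\<bar>)"
      unfolding f_def by (rule order_trans[OF sum_abs]) (simp add: abs_mult)
    also have "\<dots> \<le> (\<Sum>A\<in>F. \<bar>\<alpha> A\<bar> * 3)"
      by (intro sum_mono mult_left_mono m_le) auto
    finally show ?thesis
      by (simp add: sum_distrib_left mult.commute)
  qed
  have h_bd: "\<bar>h (sign_of S) t\<bar> \<le> 3 * (\<Sum>A\<in>F. \<bar>\<alpha> A\<bar>)" for S t
    using f_bd[of S t] order_trans[OF abs_ge_zero f_bd[of S t]] by (simp add: h_def)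
  have tail: "sign_avg F (\<lambda>\<epsilon>. norm_L2 M (\<lambda>t. h \<epsilon> t * p t)) \<le> 16 * \<nu> / K * norm_L2 M p"
    if p: "p \<in> L2 M" for p
  proof (rule sign_avg_le_sqrt[OF fin])
    have hp: "(\<lambda>t. h (sign_of S) t * p t) \<in> L2 M" for S
      by (rule L2_mult_bounded(1)[OF p hg_meas(1) h_bd])
    have pt: "sign_avg F (\<lambda>\<epsilon>. (h \<epsilon> t)\<^sup>2) \<le> (16 * \<nu> / K)\<^sup>2" for t
    proof -
      \<comment> \<open>Where \<open>h\<close> is nonzero, \<open>\<bar>f\<bar>\<close> exceeds
        \<open>\<kappa>\<close>, so the square of \<open>h\<close> is at most the fourth power of
        \<open>f\<close> divided by \<open>\<kappa>\<^sup>2\<close>. The fourth moment gives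
        \<open>3 * 9\<^sup>2 = 243\<close>, rounded up to \<open>16\<^sup>2\<close>.\<close>
      have "sign_avg F (\<lambda>\<epsilon>. (h \<epsilon> t)\<^sup>2) \<le> sign_avg F (\<lambda>\<epsilon>. (1 / \<kappa>\<^sup>2) * (\<Sum>A\<in>F. \<epsilon> A * (\<alpha> A * m A t)) ^ 4)"
      proof (rule sign_avg_mono)
        fix S
        have fS: "(\<Sum>A\<in>F. sign_of S A * (\<alpha> A * m A t)) = f (sign_of S) t"
          by (simp add: f_def mult.assoc)
        show "(h (sign_of S) t)\<^sup>2 \<le> (1 / \<kappa>\<^sup>2) * (\<Sum>A\<in>F. sign_of S A * (\<alpha> A * m A t)) ^ 4"
        proof (cases "\<bar>f (sign_of S) t\<bar> > \<kappa>")
          case True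
          then have "\<kappa>\<^sup>2 \<le> (f (sign_of S) t)\<^sup>2"
            using \<kappa> by (simp add: abs_le_square_iff[symmetric])
          then have "(f (sign_of S) t)\<^sup>2 * \<kappa>\<^sup>2 \<le> (f (sign_of S) t)\<^sup>2 * (f (sign_of S) t)\<^sup>2"
            by (intro mult_left_mono) auto
          then show ?thesis
            using True \<kappa> unfolding fS by (simp add: h_def field_simps power2_eq_square power4_eq_xxxx)
        next
          case False
          then show ?thesis
            by (simp add: h_def)
        qed
      qed
      also have "\<dots> \<le> (1 / \<kappa>\<^sup>2) * (3 * (\<Sum>A\<in>F. (\<alpha> A * m A t)\<^sup>2)\<^sup>2)"
        unfolding sign_avg_cmult by (intro mult_left_mono sign_avg_fourth_power fin) simp
      also have "\<dots> \<le> (1 / \<kappa>\<^sup>2) * (3 * (9 * \<nu>\<^sup>2)\<^sup>2)"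
      proof (intro mult_left_mono power_mono)
        have "(\<Sum>A\<in>F. (\<alpha> A * m A t)\<^sup>2) \<le> (\<Sum>A\<in>F. 9 * (\<alpha> A)\<^sup>2)"
        proof (rule sum_mono)
          fix A assume "A \<in> F"
          then have "(m A t)\<^sup>2 \<le> 3\<^sup>2"
            using m_le[of A t] abs_le_square_iff[of "m A t" 3] by simp
          then show "(\<alpha> A * m A t)\<^sup>2 \<le> 9 * (\<alpha> A)\<^sup>2"
            using mult_left_mono[of "(m A t)\<^sup>2" 9 "(\<alpha> A)\<^sup>2"] by (simp add: power_mult_distrib mult.commute)
        qed
        then show "(\<Sum>A\<in>F. (\<alpha> A * m A t)\<^sup>2) \<le> 9 * \<nu>\<^sup>2"
          by (simp add: \<nu>(2) sum_distrib_left)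
      qed (auto intro: sum_nonneg)
      also have "\<dots> = 243 * (\<nu> / K)\<^sup>2"
        using \<nu>(1) K by (simp add: \<kappa>_def field_simps power2_eq_square)
      also have "\<dots> \<le> 256 * (\<nu> / K)\<^sup>2"
        by (intro mult_right_mono) auto
      finally show ?thesis
        by (simp add: power_divide power_mult_distrib)
    qed
    have "sign_avg F (\<lambda>\<epsilon>. (norm_L2 M (\<lambda>t. h \<epsilon> t * p t))\<^sup>2) =
        sign_avg F (\<lambda>\<epsilon>. \<integral>t. (h \<epsilon> t * p t)\<^sup>2 \<partial>M)"
      by (simp add: norm_L2_def)
    also have "\<dots> = (\<integral>t. sign_avg F (\<lambda>\<epsilon>. (h \<epsilon> t * p t)\<^sup>2) \<partial>M)"
      by (rule sign_avg_integral) (rule L2_square_integrable[OF hp])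
    also have "\<dots> \<le> (\<integral>t. (16 * \<nu> / K)\<^sup>2 * (p t)\<^sup>2 \<partial>M)"
    proof (rule integral_mono)
      show "integrable M (\<lambda>t. sign_avg F (\<lambda>\<epsilon>. (h \<epsilon> t * p t)\<^sup>2))"
        by (rule sign_avg_integrable) (rule L2_square_integrable[OF hp])
      show "integrable M (\<lambda>t. (16 * \<nu> / K)\<^sup>2 * (p t)\<^sup>2)"
        by (intro integrable_mult_right L2_square_integrable p)
      fix t
      have "sign_avg F (\<lambda>\<epsilon>. (h \<epsilon> t * p t)\<^sup>2) = (p t)\<^sup>2 * sign_avg F (\<lambda>\<epsilon>. (h \<epsilon> t)\<^sup>2)"
        by (simp add: power_mult_distrib mult.commute flip: sign_avg_cmult)
      then show "sign_avg F (\<lambda>\<epsilon>. (h \<epsilon> t * p t)\<^sup>2) \<le> (16 * \<nu> / K)\<^sup>2 * (p t)\<^sup>2"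
        using mult_left_mono[OF pt[of t], of "(p t)\<^sup>2"] by (simp add: mult.commute)
    qed
    also have "\<dots> = (16 * \<nu> / K)\<^sup>2 * (norm_L2 M p)\<^sup>2"
      by (simp add: norm_L2_def)
    also have "\<dots> = (16 * \<nu> / K * norm_L2 M p)\<^sup>2"
      by (rule power_mult_distrib[symmetric])
    finally show "sign_avg F (\<lambda>\<epsilon>. (norm_L2 M (\<lambda>t. h \<epsilon> t * p t))\<^sup>2) \<le> (16 * \<nu> / K * norm_L2 M p)\<^sup>2" .
    show "0 \<le> 16 * \<nu> / K * norm_L2 M p"
      using \<nu>(1) K by simp
  qed
  have dev0: "norm_L2 M (dev F y\<^sub>0) \<le> a"
    using a(2) y0_simple y0_norm unfolding dev_bound_def by fastforce
  \<comment> \<open>\<open>p1\<close> is the cost of splitting off the tail, \<open>p2\<close> the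
    module defect of the bounded part, \<open>p3\<close> that of cutting to the cells. On a cell
    \<open>hy = h y\<^sub>0\<close>, so the multiples of \<open>\<Omega> (indicator A)\<close>
    cancel and \<open>dev F hy - h * dev F y\<^sub>0\<close> remains; here the bound
    \<open>a\<close> enters.\<close>
  have P: "P (sign_of S) \<in> L2 M" and P_le: "norm_L2 M (P (sign_of S)) \<le> 2 * C * \<kappa> +
      ((2 * C + a) * norm_L2 M (\<lambda>t. h (sign_of S) t * y\<^sub>0 t) + norm_L2 M (\<lambda>t. h (sign_of S) t * dev F y\<^sub>0 t))" for S
  proof -
    let ?h = "h (sign_of S)" and ?g = "g (sign_of S)" and ?f = "f (sign_of S)"
    define hy where "hy = (\<lambda>t. ?h t * y\<^sub>0 t)"
    define gy where "gy = (\<lambda>t. ?g t * y\<^sub>0 t)"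
    have hyL: "hy \<in> L2 M"
      unfolding hy_def by (rule L2_mult_bounded(1)[OF y0 hg_meas(1) h_bd])
    have g_bd: "\<bar>?g t\<bar> \<le> \<kappa>" for t
      using \<kappa> by (simp add: g_def)
    have gyL: "gy \<in> L2 M" "norm_L2 M gy \<le> \<kappa>"
      unfolding gy_def using L2_mult_bounded[OF y0 hg_meas(2) g_bd] y0_norm by auto
    have sum: "(\<lambda>t. gy t + hy t) = (\<lambda>t. ?f t * y\<^sub>0 t)"
      by (auto simp: gy_def hy_def g_def h_def fun_eq_iff)
    define p1 where "p1 = (\<lambda>t. \<Omega> (\<lambda>t. ?f t * y\<^sub>0 t) t - \<Omega> gy t - \<Omega> hy t)"
    have p1: "p1 \<in> L2 M" "norm_L2 M p1 \<le> C * (norm_L2 M gy + norm_L2 M hy)"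
      using \<Omega>_add[OF gyL(1) hyL] unfolding sum p1_def by auto
    define p2 where "p2 = (\<lambda>t. \<Omega> gy t - ?g t * \<Omega> y\<^sub>0 t)"
    have p2: "p2 \<in> L2 M" "norm_L2 M p2 \<le> C * \<kappa>"
      using \<Omega>_mult[OF y0 hg_meas(2) g_bd] \<kappa> y0_norm unfolding p2_def gy_def by auto
    have hy_simple: "simple_on F hy"
      unfolding simple_on_def
    proof (intro conjI ballI allI impI)
      fix A s t assume A: "A \<in> F" "s \<in> A" "t \<in> A"
      have "m B s = m B t" for B
        using m_eq[OF A(1,2)] m_eq[OF A(1,3)] by simp
      then have "?h s = ?h t"
        by (simp add: h_def f_def)
      moreover have "y\<^sub>0 s = y\<^sub>0 t"
        using y0_simple A unfolding simple_on_def by blast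
      ultimately show "hy s = hy t"
        by (simp add: hy_def)
    next
      fix t assume "t \<notin> \<Union>F"
      then have "y\<^sub>0 t = 0"
        using y0_simple unfolding simple_on_def by blast
      then show "hy t = 0"
        by (simp add: hy_def)
    qed
    define W where "W = \<Union>F"
    have W: "W \<in> sets M"
      unfolding W_def by (rule family_Union_sets[OF F(1)])
    have Why: "(\<lambda>t. indicator W t * hy t) = hy"
      using hy_simple by (auto simp: fun_eq_iff W_def simple_on_def indicator_def)
    define p3 where "p3 = (\<lambda>t. \<Omega> hy t - indicator W t * \<Omega> hy t)"
    have p3: "p3 \<in> L2 M" "norm_L2 M p3 \<le> C * norm_L2 M hy"
      using \<Omega>_indicator[OF hyL W] unfolding Why p3_def by auto
    define p4 where "p4 = (\<lambda>t. ?h t * dev F y\<^sub>0 t)"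
    have p4: "p4 \<in> L2 M"
      unfolding p4_def by (rule L2_mult_bounded(1)[OF dev_L2[OF F(1) y0_simple] hg_meas(1) h_bd])
    have d: "dev F hy \<in> L2 M" "norm_L2 M (dev F hy) \<le> a * norm_L2 M hy"
      using dev_L2[OF F(1) hy_simple] a(2) hy_simple by (auto simp: dev_bound_def)
    have eq: "P (sign_of S) = (\<lambda>t. p1 t + (p2 t + (p3 t + (dev F hy t - p4 t))))"
    proof
      fix t
      have "\<Omega> hy t - ?h t * \<Omega> y\<^sub>0 t = p3 t + (dev F hy t - p4 t)"
      proof (cases "t \<in> \<Union>F")
        case True
        then obtain A where A: "A \<in> F" "t \<in> A"
          by blast
        show ?thesis
          using True unfolding p3_def p4_def W_def dev_eq[OF F(1) A] by (simp add: hy_def algebra_simps)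
      next
        case False
        then have "?h t = 0"
          by (simp add: h_def f_def m_0)
        then show ?thesis
          using False by (simp add: p3_def p4_def dev_eq_0 W_def)
      qed
      moreover have "?f t = ?g t + ?h t"
        by (simp add: g_def h_def)
      ultimately show "P (sign_of S) t = p1 t + (p2 t + (p3 t + (dev F hy t - p4 t)))"
        by (simp add: P_def p1_def p2_def algebra_simps)
    qed
    note L4 = L2_diff[OF d(1) p4]
    note L3 = L2_add[OF p3(1) L4]
    note L2' = L2_add[OF p2(1) L3]
    show "P (sign_of S) \<in> L2 M"
      unfolding eq by (rule L2_add[OF p1(1) L2'])
    have "norm_L2 M (P (sign_of S)) \<le> norm_L2 M p1 + (norm_L2 M p2 + (norm_L2 M p3 + (norm_L2 M (dev F hy) + norm_L2 M p4)))"
      unfolding eq using norm_L2_triangle[OF p1(1) L2'] norm_L2_triangle[OF p2(1) L3] norm_L2_triangle[OF p3(1) L4]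
        norm_L2_triangle_diff[OF d(1) p4] by linarith
    moreover have "C * (norm_L2 M gy + norm_L2 M hy) \<le> C * (\<kappa> + norm_L2 M hy)"
      by (intro mult_left_mono add_right_mono gyL C_nonneg)
    ultimately have "norm_L2 M (P (sign_of S)) \<le>
        C * (\<kappa> + norm_L2 M hy) + (C * \<kappa> + (C * norm_L2 M hy + (a * norm_L2 M hy + norm_L2 M p4)))"
      using p1(2) p2(2) p3(2) d(2) by linarith
    then show "norm_L2 M (P (sign_of S)) \<le> 2 * C * \<kappa> +
      ((2 * C + a) * norm_L2 M (\<lambda>t. ?h t * y\<^sub>0 t) + norm_L2 M (\<lambda>t. ?h t * dev F y\<^sub>0 t))"
      by (simp add: hy_def p4_def algebra_simps)
  qed
  define Q where "Q \<epsilon> = (\<lambda>t. \<Sum>A\<in>F. (\<epsilon> A * \<alpha> A) * b A t)" for \<epsilon>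
  have Q: "Q \<epsilon> \<in> L2 M" for \<epsilon>
    unfolding Q_def by (intro L2_sum L2_cmult b)
  \<comment> \<open>The defects \<open>b A\<close> need not be orthogonal, but random signs remove
    the cross terms, so that the sum of squares governs the average and no factor from the number of
    cells appears.\<close>
  have Q_avg: "sign_avg F (\<lambda>\<epsilon>. norm_L2 M (Q \<epsilon>)) \<le> 3 * C * \<nu>"
  proof (rule sign_avg_le_sqrt[OF fin])
    have "(norm_L2 M (Q \<epsilon>))\<^sup>2 = (\<Sum>A\<in>F. \<Sum>B\<in>F. \<epsilon> A * \<epsilon> B * (\<alpha> A * \<alpha> B * ip M (b A) (b B)))" for \<epsilon>
      unfolding norm_L2_power2 Q_def by (subst ip_linear_combinations) (auto simp: b mult_ac)
    then have "sign_avg F (\<lambda>\<epsilon>. (norm_L2 M (Q \<epsilon>))\<^sup>2) = (\<Sum>A\<in>F. \<alpha> A * \<alpha> A * ip M (b A) (b A))"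
      by (simp add: sign_avg_bilinear[OF fin])
    also have "\<dots> \<le> (\<Sum>A\<in>F. (\<alpha> A)\<^sup>2 * (3 * C)\<^sup>2)"
      unfolding norm_L2_power2[symmetric] power2_eq_square[of "\<alpha> _", symmetric]
      by (intro sum_mono mult_left_mono power_mono b) auto
    also have "\<dots> = (3 * C * \<nu>)\<^sup>2"
      unfolding sum_distrib_right[symmetric] \<nu>(2)[symmetric] by (simp add: power_mult_distrib)
    finally show "sign_avg F (\<lambda>\<epsilon>. (norm_L2 M (Q \<epsilon>))\<^sup>2) \<le> (3 * C * \<nu>)\<^sup>2" .
  qed (use C_nonneg \<nu>(1) in simp)
  have \<Delta>: "(\<lambda>t. \<Omega> (\<lambda>t. \<Sum>A\<in>F. (\<epsilon> A * \<alpha> A) * Y A t) t - (\<Sum>A\<in>F. (\<epsilon> A * \<alpha> A) * \<Omega> (Y A) t)) =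
      (\<lambda>t. P \<epsilon> t - Q \<epsilon> t)" for \<epsilon>
  proof
    fix t
    have "(\<Sum>A\<in>F. (\<epsilon> A * \<alpha> A) * \<Omega> (Y A) t) = Q \<epsilon> t + f \<epsilon> t * \<Omega> y\<^sub>0 t"
      by (simp add: Q_def f_def b_def right_diff_distrib sum_subtractf sum_distrib_right mult.assoc)
    then show "\<Omega> (\<lambda>t. \<Sum>A\<in>F. (\<epsilon> A * \<alpha> A) * Y A t) t - (\<Sum>A\<in>F. (\<epsilon> A * \<alpha> A) * \<Omega> (Y A) t) = P \<epsilon> t - Q \<epsilon> t"
      by (simp add: P_def fy)
  qed
  have "sign_avg F (\<lambda>\<epsilon>. norm_L2 M (\<lambda>t. P \<epsilon> t - Q \<epsilon> t)) \<le>
      sign_avg F (\<lambda>\<epsilon>. 2 * C * \<kappa> + ((2 * C + a) * norm_L2 M (\<lambda>t. h \<epsilon> t * y\<^sub>0 t) +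
        norm_L2 M (\<lambda>t. h \<epsilon> t * dev F y\<^sub>0 t)) + norm_L2 M (Q \<epsilon>))"
  proof (rule sign_avg_mono)
    fix S
    show "norm_L2 M (\<lambda>t. P (sign_of S) t - Q (sign_of S) t) \<le>
      2 * C * \<kappa> + ((2 * C + a) * norm_L2 M (\<lambda>t. h (sign_of S) t * y\<^sub>0 t) +
        norm_L2 M (\<lambda>t. h (sign_of S) t * dev F y\<^sub>0 t)) + norm_L2 M (Q (sign_of S))"
      using norm_L2_triangle_diff[OF P[of S] Q[of "sign_of S"]] P_le[of S] by linarith
  qed
  also have "\<dots> = 2 * C * \<kappa> + ((2 * C + a) * sign_avg F (\<lambda>\<epsilon>. norm_L2 M (\<lambda>t. h \<epsilon> t * y\<^sub>0 t)) +
      sign_avg F (\<lambda>\<epsilon>. norm_L2 M (\<lambda>t. h \<epsilon> t * dev F y\<^sub>0 t))) + sign_avg F (\<lambda>\<epsilon>. norm_L2 M (Q \<epsilon>))"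
    unfolding sign_avg_add sign_avg_cmult sign_avg_const[OF fin] ..
  also have "\<dots> \<le> 2 * C * \<kappa> + ((2 * C + a) * (16 * \<nu> / K) + 16 * \<nu> / K * a) + 3 * C * \<nu>"
  proof (intro add_mono order_refl Q_avg)
    show "(2 * C + a) * sign_avg F (\<lambda>\<epsilon>. norm_L2 M (\<lambda>t. h \<epsilon> t * y\<^sub>0 t)) \<le> (2 * C + a) * (16 * \<nu> / K)"
      using tail[OF y0] y0_norm C_nonneg a(1) by (intro mult_left_mono) auto
    have "16 * \<nu> / K * norm_L2 M (dev F y\<^sub>0) \<le> 16 * \<nu> / K * a"
      using dev0 \<nu>(1) K by (intro mult_left_mono) auto
    then show "sign_avg F (\<lambda>\<epsilon>. norm_L2 M (\<lambda>t. h \<epsilon> t * dev F y\<^sub>0 t)) \<le> 16 * \<nu> / K * a"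
      using tail[OF dev_L2[OF F(1) y0_simple]] by linarith
  qed
  also have "\<dots> = \<nu> * (3 * C + 2 * C * K + (2 * C + 2 * a) * (16 / K))"
    using K by (simp add: \<kappa>_def field_simps)
  finally show ?thesis
    unfolding \<Delta> .
qed

end

section \<open>The self-improving bound for deviations\<close>

context extended_isometry
begin

definition residual_const :: real where
  "residual_const = 4 * C + 4 * C * V + V"

text \<open>The part of the estimate in \<open>dev_bound_improve\<close> that does not involve
  \<open>a\<close>: \<open>64 * V + 64\<close> is the value of \<open>K\<close> chosen there, and
  \<open>4 * C\<close> is \<open>3 * C\<close> plus the remainder
  \<open>2 * C * (16 / K) \<le> C\<close>.\<close>

definition improve_const :: real where
  "improve_const = C + 2 * residual_const + V * (4 * C + 2 * C * (64 * V + 64))"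

lemma residual_const_nonneg: "0 \<le> residual_const"
  using C_nonneg V_nonneg by (simp add: residual_const_def)

lemma improve_const_nonneg: "0 \<le> improve_const"
  using C_nonneg V_nonneg residual_const_nonneg by (simp add: improve_const_def)

text \<open>
  The nonlinearity \<open>DD \<epsilon>\<close> is tested against \<open>\<epsilon> D\<close>, where \<open>D = dev F x\<close>: the cross terms average to zero and
  \<open>\<parallel>D\<parallel>\<^sup>2\<close> remains.
\<close>

lemma dev_bound_improve:
  assumes F: "family M F" and a: "0 \<le> a" "dev_bound F a"
    and flat: "\<And>A B. A \<in> F \<Longrightarrow> B \<in> F \<Longrightarrow> \<bar>U A B\<bar> \<le> 3 / sqrt (real (card F))"
    and uU: "\<And>A. A \<in> F \<Longrightarrow> AE t in M. u (unit_cell M A) t = (\<Sum>B\<in>F. U B A * unit_cell M B t)"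
  shows "dev_bound F (improve_const + a / 2)"
  unfolding dev_bound_def
proof (intro allI impI)
  fix x assume x: "simple_on F x"
  note fin = family_finite[OF F]
  note xL = simple_on_L2[OF F x]
  let ?e = "unit_cell M"
  define \<nu> where "\<nu> = norm_L2 M x"
  define D where "D = dev F x"
  define \<delta> where "\<delta> = norm_L2 M D"
  have D: "D \<in> L2 M"
    unfolding D_def by (rule dev_L2[OF F x])
  have D_le: "\<delta> \<le> real (card F) * C * \<nu>"
    using dev_bound_card[OF F] x by (simp add: dev_bound_def \<delta>_def D_def \<nu>_def)
  have nn: "0 \<le> \<nu>" "0 \<le> \<delta>"
    by (simp_all add: \<nu>_def \<delta>_def)
  have "\<delta> \<le> (improve_const + a / 2) * \<nu>"
  proof (cases "F = {} \<or> \<nu> = 0 \<or> \<delta> = 0")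
    case True
    then have "\<delta> \<le> 0"
      using D_le by auto
    also have "0 \<le> (improve_const + a / 2) * \<nu>"
      using improve_const_nonneg a(1) nn by simp
    finally show ?thesis .
  next
    case False
    then have ne: "F \<noteq> {}" and \<nu>: "\<nu> > 0" and \<delta>: "\<delta> > 0"
      using nn by auto
    define \<alpha> where "\<alpha> A = cell_value x A * sqrt (measure M A)" for A
    have e: "?e A \<in> L2 M" if "A \<in> F" for A
      by (rule unit_cell_L2[OF family_cell[OF F that]])
    have x_eq: "x = (\<lambda>t. \<Sum>A\<in>F. \<alpha> A * ?e A t)"
    proof
      fix t
      have "x t = (\<Sum>A\<in>F. indicator A t * cell_value x A)"
        by (rule fun_cong[OF simple_on_expand[OF F x]])
      also have "\<dots> = (\<Sum>A\<in>F. \<alpha> A * ?e A t)"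
      proof (rule sum.cong[OF refl])
        fix A assume "A \<in> F"
        then have "sqrt (measure M A) > 0"
          using family_cell[OF F] by (simp add: cell_def)
        then show "indicator A t * cell_value x A = \<alpha> A * ?e A t"
          by (simp add: \<alpha>_def unit_cell_def)
      qed
      finally show "x t = (\<Sum>A\<in>F. \<alpha> A * ?e A t)" .
    qed
    have \<nu>2: "\<nu>\<^sup>2 = (\<Sum>A\<in>F. (\<alpha> A)\<^sup>2)"
      unfolding \<nu>_def by (subst x_eq) (rule norm_L2_unit_cell_sum[OF F])
    define DA where "DA A = (\<lambda>t. indicator A t * D t)" for A
    have DA: "DA A \<in> L2 M" if "A \<in> F" for A
      unfolding DA_def using L2_indicator_mult(1)[OF D cell_sets[OF family_cell[OF F that]]] .
    \<comment> \<open>The vector \<open>X\<close> and the test function \<open>z\<close> carry the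
      same signs on the cells; in the average only products of equal signs survive.\<close>
    define X where "X \<epsilon> = (\<lambda>t. \<Sum>A\<in>F. (\<epsilon> A * \<alpha> A) * ?e A t)" for \<epsilon>
    define z where "z \<epsilon> = (\<lambda>t. \<Sum>A\<in>F. \<epsilon> A * DA A t)" for \<epsilon>
    define \<sigma> where "\<sigma> \<epsilon> t = (\<Sum>A\<in>F. indicator A t * \<epsilon> A)" for \<epsilon> :: "'a set \<Rightarrow> real" and t
    have \<sigma>_eq: "\<sigma> \<epsilon> t = \<epsilon> A" if "A \<in> F" "t \<in> A" for \<epsilon> A t
      unfolding \<sigma>_def by (rule family_sum_indicator[OF F that])
    have \<sigma>_0: "\<sigma> \<epsilon> t = 0" if "t \<notin> \<Union>F" for \<epsilon> t
      unfolding \<sigma>_def by (rule family_sum_indicator'[OF that])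
    have \<sigma>_meas: "\<sigma> \<epsilon> \<in> borel_measurable M" for \<epsilon>
      unfolding \<sigma>_def[abs_def] using cell_sets[OF family_cell[OF F]] by measurable
    have \<sigma>_le: "\<bar>\<sigma> (sign_of S) t\<bar> \<le> 1" for S t
      using \<sigma>_eq[of _ t "sign_of S"] \<sigma>_0[of t "sign_of S"] by (cases "t \<in> \<Union>F") auto
    have X_eq: "X \<epsilon> = (\<lambda>t. \<sigma> \<epsilon> t * x t)" for \<epsilon>
    proof
      fix t
      show "X \<epsilon> t = \<sigma> \<epsilon> t * x t"
      proof (cases "t \<in> \<Union>F")
        case True
        then obtain A where A: "A \<in> F" "t \<in> A"
          by blast
        show ?thesis
          unfolding X_def \<sigma>_eq[OF A] unit_cell_sum_eq[OF F A]
          by (subst x_eq) (simp add: unit_cell_sum_eq[OF F A])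
      next
        case False
        then show ?thesis
          by (simp add: X_def unit_cell_sum_eq_0 \<sigma>_0)
      qed
    qed
    have z_cell: "z \<epsilon> t = \<epsilon> A * D t" if "A \<in> F" "t \<in> A" for \<epsilon> A t
    proof -
      have "z \<epsilon> t = (\<Sum>A\<in>F. indicator A t * (\<epsilon> A * D t))"
        unfolding z_def DA_def by (intro sum.cong refl) simp
      then show ?thesis
        by (simp add: family_sum_indicator[OF F that])
    qed
    have z_eq: "z \<epsilon> = (\<lambda>t. \<sigma> \<epsilon> t * D t)" for \<epsilon>
    proof
      fix t
      show "z \<epsilon> t = \<sigma> \<epsilon> t * D t"
      proof (cases "t \<in> \<Union>F")
        case True
        then obtain A where A: "A \<in> F" "t \<in> A"
          by blast
        show ?thesis
          by (simp add: z_cell[OF A] \<sigma>_eq[OF A])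
      next
        case False
        then have "D t = 0"
          unfolding D_def by (rule dev_eq_0)
        then show ?thesis
          by (simp add: z_def DA_def)
      qed
    qed
    have XL: "X (sign_of S) \<in> L2 M" "norm_L2 M (X (sign_of S)) \<le> \<nu>" for S
      using L2_mult_bounded[OF xL \<sigma>_meas \<sigma>_le] by (simp_all add: X_eq \<nu>_def)
    have zL: "z (sign_of S) \<in> L2 M" "norm_L2 M (z (sign_of S)) \<le> \<delta>" for S
      using L2_mult_bounded[OF D \<sigma>_meas \<sigma>_le] by (simp_all add: z_eq \<delta>_def)
    define Y where "Y = (\<lambda>A t. \<Sum>B\<in>F. U B A * ?e B t)"
    have YL: "Y A \<in> L2 M" for A
      unfolding Y_def by (intro L2_sum L2_cmult e)
    define DD where "DD \<epsilon> = (\<lambda>t. \<Omega> (X \<epsilon>) t - (\<Sum>A\<in>F. (\<epsilon> A * \<alpha> A) * \<Omega> (?e A) t))" for \<epsilon>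
    define EE where "EE \<epsilon> = (\<lambda>t. \<Omega> (\<lambda>t. \<Sum>A\<in>F. (\<epsilon> A * \<alpha> A) * Y A t) t - (\<Sum>A\<in>F. (\<epsilon> A * \<alpha> A) * \<Omega> (Y A) t))" for \<epsilon>
    have DD: "DD \<epsilon> \<in> L2 M" for \<epsilon>
      unfolding DD_def X_def by (rule \<Omega>_linear_combination[OF fin e])
    have EE: "EE \<epsilon> \<in> L2 M" for \<epsilon>
      unfolding EE_def by (rule \<Omega>_linear_combination[OF fin YL])
    define p where "p \<epsilon> = (\<lambda>t. \<Omega> (X \<epsilon>) t - \<sigma> \<epsilon> t * \<Omega> x t)" for \<epsilon>
    have p: "p (sign_of S) \<in> L2 M" "norm_L2 M (p (sign_of S)) \<le> C * \<nu>" for S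
      using \<Omega>_mult[OF xL \<sigma>_meas \<sigma>_le] by (simp_all add: p_def X_eq \<nu>_def)
    \<comment> \<open>Replacing \<open>\<Omega> (X \<epsilon>)\<close> by
      \<open>\<sigma> \<epsilon> * \<Omega> x\<close> costs one centralizer defect and makes the
      dependence on the signs explicit.\<close>
    define W where "W \<epsilon> = (\<lambda>t. DD \<epsilon> t - p \<epsilon> t)" for \<epsilon>
    have W: "W (sign_of S) \<in> L2 M" for S
      unfolding W_def by (intro L2_diff DD p)
    have W_eq: "W \<epsilon> t = \<sigma> \<epsilon> t * \<Omega> x t - (\<Sum>A\<in>F. (\<epsilon> A * \<alpha> A) * \<Omega> (?e A) t)" for \<epsilon> t
      by (simp add: W_def DD_def p_def)
    have \<Omega>e: "AE t in M. \<forall>A\<in>F. \<alpha> A * \<Omega> (?e A) t = cell_value x A * \<Omega> (indicator A) t"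
    proof (intro AE_finite_allI fin)
      fix A assume A: "A \<in> F"
      have "AE t in M. \<Omega> (?e A) t = 1 / sqrt (measure M A) * \<Omega> (indicator A) t"
        unfolding unit_cell_def[abs_def] by (rule \<Omega>_cmult[OF cell_indicator_L2[OF family_cell[OF F A]]])
      then show "AE t in M. \<alpha> A * \<Omega> (?e A) t = cell_value x A * \<Omega> (indicator A) t"
      proof eventually_elim
        case (elim t)
        have "sqrt (measure M A) > 0"
          using family_cell[OF F A] by (simp add: cell_def)
        then show ?case
          by (simp add: elim \<alpha>_def)
      qed
    qed
    \<comment> \<open>On a cell \<open>A\<close> the test function is
      \<open>\<epsilon> A * D\<close>; averaging keeps \<open>\<Omega> x\<close> and the single
      summand at \<open>A\<close>, and their difference is \<open>D\<close> again.\<close>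
    have avg_W: "sign_avg F (\<lambda>\<epsilon>. ip M (W \<epsilon>) (z \<epsilon>)) = \<delta>\<^sup>2"
    proof -
      have int: "integrable M (\<lambda>t. W (sign_of S) t * z (sign_of S) t)" for S
        by (rule L2_mult_integrable[OF W zL(1)])
      have "sign_avg F (\<lambda>\<epsilon>. ip M (W \<epsilon>) (z \<epsilon>)) = (\<integral>t. sign_avg F (\<lambda>\<epsilon>. W \<epsilon> t * z \<epsilon> t) \<partial>M)"
        unfolding ip_def by (rule sign_avg_integral) (rule int)
      also have "\<dots> = (\<integral>t. D t * D t \<partial>M)"
      proof (rule integral_cong_AE)
        show "(\<lambda>t. sign_avg F (\<lambda>\<epsilon>. W \<epsilon> t * z \<epsilon> t)) \<in> borel_measurable M"
          by (rule borel_measurable_integrable, rule sign_avg_integrable, rule int)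
        show "(\<lambda>t. D t * D t) \<in> borel_measurable M"
          by (rule borel_measurable_integrable[OF L2_mult_integrable[OF D D]])
        show "AE t in M. sign_avg F (\<lambda>\<epsilon>. W \<epsilon> t * z \<epsilon> t) = D t * D t"
          using \<Omega>e
        proof eventually_elim
          case (elim t)
          show ?case
          proof (cases "t \<in> \<Union>F")
            case True
            then obtain A where A: "A \<in> F" "t \<in> A"
              by blast
            have "W \<epsilon> t * z \<epsilon> t = D t * \<Omega> x t * (\<epsilon> A * \<epsilon> A) - (\<Sum>B\<in>F. D t * (\<alpha> B * \<Omega> (?e B) t) * (\<epsilon> B * \<epsilon> A))" for \<epsilon>
            proof -
              have "(\<Sum>B\<in>F. (\<epsilon> B * \<alpha> B) * \<Omega> (?e B) t) * (\<epsilon> A * D t) =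
                  (\<Sum>B\<in>F. D t * (\<alpha> B * \<Omega> (?e B) t) * (\<epsilon> B * \<epsilon> A))"
                unfolding sum_distrib_right by (intro sum.cong refl) (simp add: mult_ac)
              then show ?thesis
                unfolding W_eq z_cell[OF A] \<sigma>_eq[OF A] left_diff_distrib by (simp add: mult_ac)
            qed
            then have "sign_avg F (\<lambda>\<epsilon>. W \<epsilon> t * z \<epsilon> t) =
                D t * \<Omega> x t * 1 - (\<Sum>B\<in>F. D t * (\<alpha> B * \<Omega> (?e B) t) * (if B = A then 1 else 0))"
              by (simp only: sign_avg_diff sign_avg_sum sign_avg_cmult sign_avg_pair[OF fin] sign_avg_pair[OF fin A(1)] refl if_True)
                (simp add: sign_avg_pair[OF fin] cong: sum.cong)
            also have "\<dots> = D t * (\<Omega> x t - \<alpha> A * \<Omega> (?e A) t)"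
              using fin A(1) by (simp add: if_distrib right_diff_distrib cong: if_cong)
            also have "\<alpha> A * \<Omega> (?e A) t = x t * \<Omega> (indicator A) t"
              using elim A cell_value_eq[OF x A] by simp
            finally show ?thesis
              by (simp add: D_def dev_eq[OF F A])
          next
            case False
            then have "D t = 0"
              unfolding D_def by (rule dev_eq_0)
            then show ?thesis
              by (simp add: z_eq sign_avg_const[OF fin])
          qed
        qed
      qed
      finally show ?thesis
        by (simp add: \<delta>_def norm_L2_power2 ip_def)
    qed
    have DA_sum: "(\<Sum>A\<in>F. (norm_L2 M (DA A))\<^sup>2) = \<delta>\<^sup>2"
    proof -
      have "(\<Sum>A\<in>F. (norm_L2 M (DA A))\<^sup>2) = (\<integral>t. (\<Sum>A\<in>F. DA A t * DA A t) \<partial>M)"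
        unfolding norm_L2_power2 ip_def
        by (rule Bochner_Integration.integral_sum[symmetric]) (intro L2_mult_integrable DA)
      also have "(\<lambda>t. \<Sum>A\<in>F. DA A t * DA A t) = (\<lambda>t. D t * D t)"
      proof
        fix t
        have "(\<Sum>A\<in>F. DA A t * DA A t) = (\<Sum>A\<in>F. indicator A t * (D t * D t))"
          by (intro sum.cong refl) (simp add: DA_def indicator_def)
        also have "\<dots> = D t * D t"
        proof (cases "t \<in> \<Union>F")
          case True
          then obtain A where A: "A \<in> F" "t \<in> A"
            by blast
          show ?thesis
            by (rule family_sum_indicator[OF F A])
        next
          case False
          then have "D t = 0"
            unfolding D_def by (rule dev_eq_0)
          then show ?thesis
            by simp
        qed
        finally show "(\<Sum>A\<in>F. DA A t * DA A t) = D t * D t" .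
      qed
      finally show ?thesis
        by (simp add: \<delta>_def norm_L2_power2 ip_def)
    qed
    \<comment> \<open>Only the diagonal terms pairing \<open>A\<close> with \<open>DA A\<close>
      survive; Cauchy-Schwarz over the cells then avoids a factor growing with the family.\<close>
    have avg_R: "- sign_avg F (\<lambda>\<epsilon>. \<Sum>A\<in>F. (\<epsilon> A * \<alpha> A) * residual (?e A) (z \<epsilon>)) \<le> residual_const * \<nu> * \<delta>"
    proof -
      have "sign_avg F (\<lambda>\<epsilon>. \<Sum>A\<in>F. (\<epsilon> A * \<alpha> A) * residual (?e A) (z \<epsilon>)) =
          sign_avg F (\<lambda>\<epsilon>. \<Sum>A\<in>F. \<Sum>B\<in>F. \<epsilon> A * \<epsilon> B * (\<alpha> A * residual (?e A) (DA B)))"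
      proof (intro sign_avg_cong sum.cong refl)
        fix S A assume A: "A \<in> F"
        have "residual (?e A) (z (sign_of S)) = (\<Sum>B\<in>F. sign_of S B * residual (?e A) (DA B))"
          unfolding z_def by (rule residual_sum[OF e[OF A] fin DA])
        then show "(sign_of S A * \<alpha> A) * residual (?e A) (z (sign_of S)) =
            (\<Sum>B\<in>F. sign_of S A * sign_of S B * (\<alpha> A * residual (?e A) (DA B)))"
          by (simp add: sum_distrib_left mult_ac)
      qed
      also have "\<dots> = (\<Sum>A\<in>F. \<alpha> A * residual (?e A) (DA A))"
        by (rule sign_avg_bilinear[OF fin])
      also have "- \<dots> \<le> (\<Sum>A\<in>F. residual_const * (\<bar>\<alpha> A\<bar> * \<bar>norm_L2 M (DA A)\<bar>))"
        unfolding sum_negf[symmetric]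
      proof (rule sum_mono)
        fix A assume A: "A \<in> F"
        have "- (\<alpha> A * residual (?e A) (DA A)) \<le> \<bar>\<alpha> A\<bar> * \<bar>residual (?e A) (DA A)\<bar>"
          using abs_ge_minus_self[of "\<alpha> A * residual (?e A) (DA A)"] by (simp add: abs_mult)
        also have "\<dots> \<le> \<bar>\<alpha> A\<bar> * (residual_const * norm_L2 M (DA A))"
          using residual_le[OF e[OF A] DA[OF A]] norm_L2_unit_cell[OF family_cell[OF F A]]
          by (intro mult_left_mono) (simp_all add: residual_const_def)
        finally show "- (\<alpha> A * residual (?e A) (DA A)) \<le> residual_const * (\<bar>\<alpha> A\<bar> * \<bar>norm_L2 M (DA A)\<bar>)"
          by (simp add: mult_ac)
      qed
      also have "\<dots> \<le> residual_const * (L2_set \<alpha> F * L2_set (\<lambda>A. norm_L2 M (DA A)) F)"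
        unfolding sum_distrib_left[symmetric] by (intro mult_left_mono L2_set_mult_ineq residual_const_nonneg)
      also have "L2_set \<alpha> F = \<nu>"
        unfolding L2_set_def \<nu>2[symmetric] using \<nu> by simp
      also have "L2_set (\<lambda>A. norm_L2 M (DA A)) F = \<delta>"
        unfolding L2_set_def DA_sum using \<delta> by simp
      finally show ?thesis
        by (simp add: mult.assoc)
    qed
    \<comment> \<open>The summand \<open>64 * V\<close> makes the coefficient
      \<open>32 * V / K\<close> of \<open>a\<close> at most \<open>1 / 2\<close>; the summand 64
      keeps \<open>K\<close> positive and at least 32.\<close>
    define K where "K = 64 * V + 64"
    have K: "K > 0"
      using V_nonneg by (simp add: K_def)
    have avg_E: "sign_avg F (\<lambda>\<epsilon>. norm_L2 M (EE \<epsilon>)) \<le> \<nu> * (3 * C + 2 * C * K + (2 * C + 2 * a) * (16 / K))"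
      unfolding EE_def by (rule flat_nonlinearity[OF F ne a K flat \<nu> \<nu>2 Y_def])
    have "\<delta>\<^sup>2 \<le> sign_avg F (\<lambda>\<epsilon>. residual_const * \<nu> * \<delta> -
        (\<Sum>A\<in>F. (\<epsilon> A * \<alpha> A) * residual (?e A) (z \<epsilon>)) + V * \<delta> * norm_L2 M (EE \<epsilon>) + C * \<nu> * \<delta>)"
      unfolding avg_W[symmetric]
    proof (rule sign_avg_mono)
      fix S
      let ?X = "X (sign_of S)" and ?z = "z (sign_of S)" and ?E = "EE (sign_of S)"
      \<comment> \<open>For a fixed sign pattern everything can be bounded except the sum of single
        residuals, which would grow with the family and is left to \<open>avg_R\<close>.\<close>
      have "residual ?X ?z - (\<Sum>A\<in>F. (sign_of S A * \<alpha> A) * residual (?e A) ?z) =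
          ip M (DD (sign_of S)) ?z - ip M ?E (v ?z)"
        unfolding X_def DD_def EE_def
        by (rule residual_nonlinearity[OF fin e zL(1) YL]) (use uU in \<open>simp_all add: Y_def\<close>)
      moreover have "ip M (W (sign_of S)) ?z = ip M (DD (sign_of S)) ?z - ip M (p (sign_of S)) ?z"
        unfolding W_def by (rule ip_diff_left[OF DD p(1) zL(1)])
      moreover have "residual ?X ?z \<le> residual_const * \<nu> * \<delta>"
      proof -
        have "residual ?X ?z \<le> residual_const * norm_L2 M ?X * norm_L2 M ?z"
          using residual_le[OF XL(1) zL(1), of S S] by (simp add: residual_const_def)
        also have "\<dots> \<le> residual_const * \<nu> * \<delta>"
          by (intro mult_mono XL zL mult_nonneg_nonneg residual_const_nonneg nn order_refl) auto
        finally show ?thesis .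
      qed
      moreover have "ip M ?E (v ?z) \<le> V * \<delta> * norm_L2 M ?E"
      proof -
        have "ip M ?E (v ?z) \<le> norm_L2 M ?E * norm_L2 M (v ?z)"
          using ip_Cauchy_Schwarz[OF EE v_L2[OF zL(1)], of "sign_of S" S] by linarith
        also have "\<dots> \<le> norm_L2 M ?E * (V * \<delta>)"
          by (intro mult_left_mono order_trans[OF v_le[OF zL(1)]] zL V_nonneg) auto
        finally show ?thesis
          by (simp add: mult_ac)
      qed
      moreover have "- ip M (p (sign_of S)) ?z \<le> C * \<nu> * \<delta>"
      proof -
        have "- ip M (p (sign_of S)) ?z \<le> norm_L2 M (p (sign_of S)) * norm_L2 M ?z"
          using ip_Cauchy_Schwarz[OF p(1) zL(1), of S S] by linarith
        also have "\<dots> \<le> C * \<nu> * \<delta>"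
          by (intro mult_mono p zL mult_nonneg_nonneg C_nonneg nn) auto
        finally show ?thesis .
      qed
      ultimately show "ip M (W (sign_of S)) ?z \<le> residual_const * \<nu> * \<delta> -
        (\<Sum>A\<in>F. (sign_of S A * \<alpha> A) * residual (?e A) ?z) + V * \<delta> * norm_L2 M ?E + C * \<nu> * \<delta>"
        by linarith
    qed
    also have "\<dots> = residual_const * \<nu> * \<delta> - sign_avg F (\<lambda>\<epsilon>. \<Sum>A\<in>F. (\<epsilon> A * \<alpha> A) * residual (?e A) (z \<epsilon>)) +
        V * \<delta> * sign_avg F (\<lambda>\<epsilon>. norm_L2 M (EE \<epsilon>)) + C * \<nu> * \<delta>"
      unfolding sign_avg_add sign_avg_diff sign_avg_cmult sign_avg_const[OF fin] ..
    also have "\<dots> \<le> residual_const * \<nu> * \<delta> + residual_const * \<nu> * \<delta> +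
        V * \<delta> * (\<nu> * (3 * C + 2 * C * K + (2 * C + 2 * a) * (16 / K))) + C * \<nu> * \<delta>"
    proof -
      have "V * \<delta> * sign_avg F (\<lambda>\<epsilon>. norm_L2 M (EE \<epsilon>)) \<le>
          V * \<delta> * (\<nu> * (3 * C + 2 * C * K + (2 * C + 2 * a) * (16 / K)))"
        by (intro mult_left_mono avg_E mult_nonneg_nonneg V_nonneg nn)
      then show ?thesis
        using avg_R by linarith
    qed
    also have "\<dots> = \<delta> * \<nu> * (C + 2 * residual_const + V * (3 * C + 2 * C * K + (2 * C + 2 * a) * (16 / K)))"
      by (simp add: algebra_simps)
    also have "\<dots> \<le> \<delta> * \<nu> * (improve_const + a / 2)"
    proof (intro mult_left_mono)
      have "32 * V \<le> K / 2"
        using V_nonneg by (simp add: K_def)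
      then have "a * (32 * V) \<le> a * (K / 2)"
        by (intro mult_left_mono a)
      then have 1: "V * (2 * a * (16 / K)) \<le> a / 2"
        using K by (simp add: field_simps)
      have "C * 32 \<le> C * K"
        using V_nonneg C_nonneg by (intro mult_left_mono) (auto simp: K_def)
      then have "2 * C * (16 / K) \<le> C"
        using K by (simp add: field_simps)
      then have 2: "V * (2 * C * (16 / K)) \<le> V * C"
        by (intro mult_left_mono V_nonneg)
      have "V * (3 * C + 2 * C * K + (2 * C + 2 * a) * (16 / K)) =
          V * (3 * C + 2 * C * K) + V * (2 * C * (16 / K)) + V * (2 * a * (16 / K))"
        by (simp add: algebra_simps)
      also have "\<dots> \<le> V * (3 * C + 2 * C * K) + V * C + a / 2"
        using 1 2 by linarith
      also have "\<dots> = V * (4 * C + 2 * C * K) + a / 2"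
        by (simp add: algebra_simps)
      finally show "C + 2 * residual_const + V * (3 * C + 2 * C * K + (2 * C + 2 * a) * (16 / K)) \<le> improve_const + a / 2"
        by (simp add: improve_const_def K_def)
    qed (use nn in simp)
    finally have "\<delta> * \<delta> \<le> \<delta> * ((improve_const + a / 2) * \<nu>)"
      by (simp add: power2_eq_square mult_ac)
    then show ?thesis
      using \<delta> by (simp only: mult_le_cancel_left_pos)
  qed
  then show "norm_L2 M (dev F x) \<le> (improve_const + a / 2) * norm_L2 M x"
    by (simp add: \<delta>_def D_def \<nu>_def)
qed

text \<open>Iterating \<open>a \<mapsto> improve_const + a / 2\<close> from the bound by the number
  of cells contracts towards the fixed point \<open>2 * improve_const\<close>; the extra 1 absorbs
  the error left after finitely many steps. The size of \<open>F\<close> disappears from the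
  bound.\<close>

lemma dev_bound_uniform:
  assumes F: "family M F"
    and flat: "\<And>A B. A \<in> F \<Longrightarrow> B \<in> F \<Longrightarrow> \<bar>U A B\<bar> \<le> 3 / sqrt (real (card F))"
    and uU: "\<And>A. A \<in> F \<Longrightarrow> AE t in M. u (unit_cell M A) t = (\<Sum>B\<in>F. U B A * unit_cell M B t)"
  shows "dev_bound F (2 * improve_const + 1)"
proof -
  define a where "a = real (card F) * C"
  have a: "0 \<le> a"
    using C_nonneg by (simp add: a_def)
  have bound: "dev_bound F (2 * improve_const + a / 2 ^ n)" for n
  proof (induction n)
    case 0
    show ?case
      by (rule dev_bound_mono[OF dev_bound_card[OF F]]) (use improve_const_nonneg in \<open>simp add: a_def\<close>)
  next
    case (Suc n)
    have "dev_bound F (improve_const + (2 * improve_const + a / 2 ^ n) / 2)"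
      using a improve_const_nonneg by (intro dev_bound_improve[OF F _ Suc flat uU]) auto
    also have "improve_const + (2 * improve_const + a / 2 ^ n) / 2 = 2 * improve_const + a / 2 ^ Suc n"
      by (simp add: field_simps)
    finally show ?case .
  qed
  obtain n where "a < 2 ^ n"
    using real_arch_pow[of 2 a] by auto
  then have "a / 2 ^ n \<le> 1"
    by (simp add: field_simps)
  then show ?thesis
    by (intro dev_bound_mono[OF bound[of n]]) simp
qed

end

section \<open>From an extension to a contradiction\<close>

context L2_centralizer
begin

text \<open>
  Applying an extension \<open>\<beta>\<close> to \<open>(\<Omega> x, x)\<close> turns it into a pair of maps on \<open>L\<^sub>2\<close>.
\<close>

lemma extension_imp_extended_isometry:
  assumes u: "complex_structure M u" and iso: "\<And>x. x \<in> L2 M \<Longrightarrow> norm_L2 M (u x) = norm_L2 M x"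
    and ext: "extends_to_twisted_sum M \<Omega> u"
  obtains v \<tau> V where "extended_isometry M \<Omega> C u v \<tau> V"
proof -
  obtain \<beta> where \<beta>: "twisted_operator M \<Omega> \<beta>"
    and \<beta>u: "\<And>x. x \<in> L2 M \<Longrightarrow> pair_eq M (\<beta> (x, \<lambda>t. 0)) (u x, \<lambda>t. 0)"
    using ext unfolding extends_to_twisted_sum_def by blast
  let ?T = "twisted_sum M \<Omega>"
  have \<beta>_T: "\<beta> p \<in> ?T" if "p \<in> ?T" for p
    using \<beta> that by (simp add: twisted_operator_def)
  have \<beta>_cong: "pair_eq M (\<beta> p) (\<beta> q)" if "p \<in> ?T" "q \<in> ?T" "pair_eq M p q" for p q
    using \<beta> that by (simp add: twisted_operator_def)
  have \<beta>_add: "pair_eq M (\<beta> (pair_add p q)) (pair_add (\<beta> p) (\<beta> q))" if "p \<in> ?T" "q \<in> ?T" for p q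
    using \<beta> that by (simp add: twisted_operator_def)
  have \<beta>_scale: "pair_eq M (\<beta> (pair_scale c p)) (pair_scale c (\<beta> p))" if "p \<in> ?T" for p c
    using \<beta> that by (simp add: twisted_operator_def)
  obtain B where B: "\<And>p. p \<in> ?T \<Longrightarrow> twisted_norm M \<Omega> (\<beta> p) \<le> B * twisted_norm M \<Omega> p"
    using \<beta> unfolding twisted_operator_def by blast
  define V where "V = \<bar>B\<bar>"
  define v where "v x = snd (\<beta> (\<Omega> x, x))" for x
  define \<tau> where "\<tau> x = fst (\<beta> (\<Omega> x, x))" for x
  have px: "(\<Omega> x, x) \<in> ?T" if "x \<in> L2 M" for x
    using that by (simp add: twisted_sum_def measurable_\<Omega>)
  have \<beta>x: "\<beta> (\<Omega> x, x) = (\<tau> x, v x)" for x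
    by (simp add: v_def \<tau>_def)
  have \<tau>v: "\<tau> x \<in> borel_measurable M" "v x \<in> L2 M" "(\<lambda>t. \<tau> x t - \<Omega> (v x) t) \<in> L2 M" if "x \<in> L2 M" for x
    using \<beta>_T[OF px[OF that]] unfolding \<beta>x by (auto simp: twisted_sum_def)
  have bound: "norm_L2 M (v x) + norm_L2 M (\<lambda>t. \<tau> x t - \<Omega> (v x) t) \<le> V * norm_L2 M x" if "x \<in> L2 M" for x
  proof -
    have "norm_L2 M (v x) + norm_L2 M (\<lambda>t. \<tau> x t - \<Omega> (v x) t) \<le> B * norm_L2 M x"
      using B[OF px[OF that]] unfolding \<beta>x by (simp add: twisted_norm_def)
    also have "\<dots> \<le> V * norm_L2 M x"
      by (intro mult_right_mono) (auto simp: V_def)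
    finally show ?thesis .
  qed
  \<comment> \<open>The pair at \<open>x + y\<close> is the sum of the pairs at \<open>x\<close> and
    \<open>y\<close> and of \<open>(d, 0)\<close> with \<open>d\<close> in \<open>L2\<close>; on the
    last one the extension acts as \<open>u\<close>.\<close>
  have add: "pair_eq M (\<beta> (\<Omega> (\<lambda>t. x t + y t), \<lambda>t. x t + y t))
      (\<lambda>t. \<tau> x t + \<tau> y t + u (\<lambda>t. \<Omega> (\<lambda>t. x t + y t) t - \<Omega> x t - \<Omega> y t) t, \<lambda>t. v x t + v y t)"
    if x: "x \<in> L2 M" and y: "y \<in> L2 M" for x y
  proof -
    define d where "d = (\<lambda>t. \<Omega> (\<lambda>t. x t + y t) t - \<Omega> x t - \<Omega> y t)"
    have d: "d \<in> L2 M"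
      unfolding d_def by (rule \<Omega>_add(1)[OF x y])
    have dT: "(d, \<lambda>t. 0) \<in> ?T"
    proof -
      have "AE t in M. d t = d t - \<Omega> (\<lambda>t. 0) t"
        using \<Omega>_null[OF L2_zero] by auto
      then have "(\<lambda>t. d t - \<Omega> (\<lambda>t. 0) t) \<in> L2 M"
        using L2_measurable[OF d] measurable_\<Omega>[OF L2_zero] by (intro L2_AE_cong[OF d]) auto
      then show ?thesis
        using L2_measurable[OF d] by (simp add: twisted_sum_def)
    qed
    let ?q = "pair_add (\<Omega> x, x) (\<Omega> y, y)"
    have q: "?q \<in> ?T"
    proof -
      have "(\<lambda>t. \<Omega> x t + \<Omega> y t - \<Omega> (\<lambda>t. x t + y t) t) = (\<lambda>t. - d t)"
        by (simp add: d_def fun_eq_iff)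
      then show ?thesis
        using x y L2_uminus[OF d] measurable_\<Omega>[OF x] measurable_\<Omega>[OF y]
        by (simp add: pair_add_def twisted_sum_def L2_add)
    qed
    have eq: "(\<Omega> (\<lambda>t. x t + y t), \<lambda>t. x t + y t) = pair_add ?q (d, \<lambda>t. 0)"
      by (simp add: pair_add_def d_def fun_eq_iff)
    show ?thesis
      unfolding eq d_def[symmetric]
      using \<beta>_add[OF q dT] \<beta>_add[OF px[OF x] px[OF y]] \<beta>u[OF d]
      unfolding pair_eq_def ae_eq_def \<beta>x pair_add_def fst_conv snd_conv by auto
  qed
  \<comment> \<open>\<open>\<Omega>\<close> is homogeneous only almost everywhere, so the scaled
    pair is reached through the compatibility of \<open>\<beta>\<close> with equality almost
    everywhere.\<close>
  have scale: "pair_eq M (\<beta> (\<Omega> (\<lambda>t. c * x t), \<lambda>t. c * x t)) (\<lambda>t. c * \<tau> x t, \<lambda>t. c * v x t)"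
    if x: "x \<in> L2 M" for x c
  proof -
    have "AE t in M. 0 = c * \<Omega> x t - \<Omega> (\<lambda>t. c * x t) t"
      using \<Omega>_cmult[OF x, of c] by auto
    then have "(\<lambda>t. c * \<Omega> x t - \<Omega> (\<lambda>t. c * x t) t) \<in> L2 M"
      using measurable_\<Omega>[OF x] measurable_\<Omega>[OF L2_cmult[OF x]] by (intro L2_AE_cong[OF L2_zero]) auto
    then have s: "pair_scale c (\<Omega> x, x) \<in> ?T"
      using x measurable_\<Omega>[OF x] by (simp add: pair_scale_def twisted_sum_def L2_cmult)
    have "pair_eq M (\<Omega> (\<lambda>t. c * x t), \<lambda>t. c * x t) (pair_scale c (\<Omega> x, x))"
      using \<Omega>_cmult[OF x, of c] by (simp add: pair_eq_def ae_eq_def pair_scale_def)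
    note cong = \<beta>_cong[OF px[OF L2_cmult[OF x]] s this]
    show ?thesis
      using cong \<beta>_scale[OF px[OF x], of c]
      unfolding pair_eq_def ae_eq_def \<beta>x pair_scale_def fst_conv snd_conv by auto
  qed
  have "extended_isometry M \<Omega> C u v \<tau> V"
  proof unfold_locales
    fix x assume x: "x \<in> L2 M"
    show "u x \<in> L2 M"
      using u x by (simp add: complex_structure_def L2_to_def)
    show "norm_L2 M (u x) = norm_L2 M x"
      by (rule iso[OF x])
    show "v x \<in> L2 M" "\<tau> x \<in> borel_measurable M" "(\<lambda>t. \<tau> x t - \<Omega> (v x) t) \<in> L2 M"
      by (rule \<tau>v[OF x])+
    show "norm_L2 M (v x) \<le> V * norm_L2 M x"
      using bound[OF x] norm_L2_nonneg[of M "\<lambda>t. \<tau> x t - \<Omega> (v x) t"] by linarith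
    show "norm_L2 M (\<lambda>t. \<tau> x t - \<Omega> (v x) t) \<le> V * norm_L2 M x"
      using bound[OF x] norm_L2_nonneg[of M "v x"] by linarith
    fix c
    show "AE t in M. u (\<lambda>t. c * x t) t = c * u x t"
      using u x by (simp add: complex_structure_def L2_linear_def L2_homogeneous_def ae_eq_def)
    show "AE t in M. v (\<lambda>t. c * x t) t = c * v x t" "AE t in M. \<tau> (\<lambda>t. c * x t) t = c * \<tau> x t"
      using scale[OF x, of c] by (simp_all add: pair_eq_def ae_eq_def v_def \<tau>_def)
  next
    fix x y assume xy: "x \<in> L2 M" "y \<in> L2 M"
    show "AE t in M. u (\<lambda>t. x t + y t) t = u x t + u y t"
      using u xy by (simp add: complex_structure_def L2_linear_def ae_eq_def)
    show "AE t in M. v (\<lambda>t. x t + y t) t = v x t + v y t"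
      "AE t in M. \<tau> (\<lambda>t. x t + y t) t = \<tau> x t + \<tau> y t + u (\<lambda>t. \<Omega> (\<lambda>t. x t + y t) t - \<Omega> x t - \<Omega> y t) t"
      using add[OF xy] by (simp_all add: pair_eq_def ae_eq_def v_def \<tau>_def)
  qed (simp add: V_def)
  then show thesis
    by (rule that)
qed

text \<open>\<open>u\<close> is fixed before an extension is assumed. The extension enters
  \<open>improve_const\<close> only through \<open>V\<close>, and some \<open>F n\<close> has a
  deviation beyond the resulting uniform bound.\<close>

lemma nontrivial_imp_not_extendable:
  assumes "\<not> trivial_centralizer M \<Omega>"
  shows "\<exists>u. complex_structure M u \<and> \<not> extends_to_twisted_sum M \<Omega> u"
proof -
  obtain F z where F: "\<And>n. family M (F n)" "\<And>n. even (card (F n))" "\<And>n. \<not> dev_bound (F n) (real n)"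
    and z: "\<And>n. cell M (z n)" "\<And>n. z n \<notin> F n"
    and disj: "\<And>m n A B. m \<noteq> n \<Longrightarrow> A \<in> insert (z m) (F m) \<Longrightarrow> B \<in> insert (z n) (F n) \<Longrightarrow> A \<inter> B = {}"
    and disj_z: "\<And>n A. A \<in> F n \<Longrightarrow> A \<inter> z n = {}"
    by (rule nontrivial_families[OF assms]) (rule that)
  obtain u where u: "complex_structure M u" "\<And>x. x \<in> L2 M \<Longrightarrow> norm_L2 M (u x) = norm_L2 M x"
    and uF: "\<And>n. \<exists>U. (\<forall>A\<in>F n. \<forall>B\<in>F n. \<bar>U A B\<bar> \<le> 3 / sqrt (real (card (F n)))) \<and>
      (\<forall>A\<in>F n. AE t in M. u (unit_cell M A) t = (\<Sum>B\<in>F n. U B A * unit_cell M B t))"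
    by (rule adapted_complex_structure[OF F(1,2) z disj disj_z]) (assumption | rule that)+
  have "\<not> extends_to_twisted_sum M \<Omega> u"
  proof
    assume ext: "extends_to_twisted_sum M \<Omega> u"
    obtain v \<tau> V where "extended_isometry M \<Omega> C u v \<tau> V"
      using extension_imp_extended_isometry[OF u(1) _ ext] u(2) by blast
    then interpret extended_isometry M \<Omega> C u v \<tau> V .
    obtain n where n: "2 * improve_const + 1 \<le> real n"
      using real_arch_simple by blast
    obtain U where U: "\<forall>A\<in>F n. \<forall>B\<in>F n. \<bar>U A B\<bar> \<le> 3 / sqrt (real (card (F n)))"
      "\<forall>A\<in>F n. AE t in M. u (unit_cell M A) t = (\<Sum>B\<in>F n. U B A * unit_cell M B t)"
      using uF[of n] by (elim exE conjE)
    have "dev_bound (F n) (2 * improve_const + 1)"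
      by (rule dev_bound_uniform[OF F(1), of _ U]) (use U in blast)+
    then show False
      using F(3)[of n] dev_bound_mono n by blast
  qed
  with u(1) show ?thesis
    by blast
qed

end

theorem theorem3p1:
  shows "(\<forall>M :: 'a measure. sigma_finite_measure M \<longrightarrow>
            (\<forall>\<Omega>. centralizer M \<Omega> \<and> \<not> trivial_centralizer M \<Omega> \<longrightarrow>
               (\<exists>u. complex_structure M u \<and> \<not> extends_to_twisted_sum M \<Omega> u))) \<and>
         (\<forall>\<Omega>. centralizer counting \<Omega> \<and> \<not> trivial_centralizer counting \<Omega> \<longrightarrow>
            (\<exists>u. complex_structure counting u \<and> \<not> extends_to_twisted_sum counting \<Omega> u))"
proof (intro conjI allI impI; elim conjE)
  fix M :: "'a measure" and \<Omega>
  assume "sigma_finite_measure M" "centralizer M \<Omega>" and nontriv: "\<not> trivial_centralizer M \<Omega>"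
  then obtain C where "L2_centralizer M \<Omega> C"
    by (elim centralizer_imp_L2_centralizer)
  then show "\<exists>u. complex_structure M u \<and> \<not> extends_to_twisted_sum M \<Omega> u"
    using nontriv by (rule L2_centralizer.nontrivial_imp_not_extendable)
next
  fix \<Omega> :: "(nat \<Rightarrow> real) \<Rightarrow> nat \<Rightarrow> real"
  assume cent: "centralizer counting \<Omega>" and nontriv: "\<not> trivial_centralizer counting \<Omega>"
  \<comment> \<open>The element type of \<open>M\<close> in the first conjunct is fixed, so the case
    of \<open>nat\<close> is taken from the polymorphic lemmas again.\<close>
  obtain C where "L2_centralizer counting \<Omega> C"
    using sigma_finite_measure_count_space cent by (rule centralizer_imp_L2_centralizer)
  then show "\<exists>u. complex_structure counting u \<and> \<not> extends_to_twisted_sum counting \<Omega> u"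
    using nontriv by (rule L2_centralizer.nontrivial_imp_not_extendable)
qed

end
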